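(* Let $k$ be a field of characteristic $3$, let $S$ be a para-Hurwitz algebra over $k$, and let $J=H_3(C,* )$ be the Jordan algebra of $3\times 3$ hermitian matrices over the associated Hurwitz algebra $C$ (so $S=\bar C$). Then the linear map $$\Psi:\mathfrak g(S_{1,2},S)\longrightarrow \mathfrak g(J)$$ determined by: (1) $\Psi$ restricted to $\mathfrak{tri}(S_{1,2})_{\bar 0}\simeq\mathfrak{sp}(V)$ is the identity map onto $\mathfrak{sp}(V)\subseteq \mathfrak g(J)_{\bar 0}$; (2) $\Psi$ restricted to the subalgebra $\mathfrak g(S_1,S)=\mathfrak{tri}(S)\oplus\bigl(\oplus_{i=0}^2\iota_i(k1\otimes S)\bigr)$ of $\mathfrak g(S_{1,2},S)$ is the map $\Phi:\mathfrak g(S_1,S)\to\mathfrak{der}\,J$ given by $\Phi((d_0,d_1,d_2))=D_{(d_0,d_1,d_2)}$ and $\Phi(\iota_i(1\otimes a))=D_i(a)$; (3) $\Psi(\sigma_{1,u})=u\otimes\hat\iota(1)$ for $u\in V$, where $\sigma_{1,u}$ stands for the element $(\sigma_{1,u},\sigma_{1,u},\sigma_{1,u})\in\mathfrak{tri}(S_{1,2})_{\bar 1}$; (4) $\Psi(\iota_i(u\otimes s))=u\otimes\hat\iota_i(s)$ for all $u\in V$, $s\in S$, $i=0,1,2$; is an isomorphism of Lie superalgebras.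
   Context: All vector spaces are over $k$; $|x|\in\{0,1\}$ is the parity of a homogeneous element $x$; indices $i=0,1,2$ are modulo $3$. Composition superalgebras. A quadratic superform on $U=U_{\bar 0}\oplus U_{\bar 1}$ is a pair $q=(q_{\bar 0},\mathrm b)$ with $q_{\bar 0}$ a quadratic form on $U_{\bar 0}$ and $\mathrm b$ an even supersymmetric bilinear form on $U$ whose restriction to $U_{\bar 0}$ is the polar form of $q_{\bar 0}$; it is regular if $q_{\bar 0}$ is regular and $\mathrm b|_{U_{\bar 1}}$ is nondegenerate. A superalgebra $C$ with a regular quadratic superform is a composition superalgebra if $q_{\bar 0}(x_0y_0)=q_{\bar 0}(x_0)q_{\bar 0}(y_0)$, $\mathrm b(x_0y,x_0z)=q_{\bar 0}(x_0)\mathrm b(y,z)=\mathrm b(yx_0,zx_0)$ and $\mathrm b(xy,zt)+(-1)^{|x||y|+|x||z|+|y||z|}\mathrm b(zy,xt)=(-1)^{|y||z|}\mathrm b(x,z)\mathrm b(y,t)$ for $x_0,y_0\in C_{\bar 0}$ and homogeneous $x,y,z,t\in C$. Unital ones are called Hurwitz superalgebras; their standard involution is $\bar x=\mathrm b(x,1)1-x$. The para-Hurwitz superalgebra attached to a Hurwitz superalgebra $C$ is $\bar C$: the same superspace and norm with product $x\bullet y=\bar x\bar y$. A Hurwitz or para-Hurwitz algebra is one with zero odd part. $S_1=\bar k=k1$, with $1\bullet 1=1$, $\mathrm b(1,1)=2$. Let $V$ be a two-dimensional space with a nonzero alternating form $\langle\cdot|\cdot\rangle$. $B(1,2)=k1\oplus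 V$ (even part $k1$, odd part $V$), with $1$ the unit, $uv=\langle u|v\rangle 1$ for $u,v\in V$, $q_{\bar 0}(1)=1$, $\mathrm b(u,v)=\langle u|v\rangle$; in characteristic $3$ it is a Hurwitz superalgebra. $S_{1,2}$ is the para-Hurwitz superalgebra attached to $B(1,2)$; it contains $S_1=k1$. Triality and $\mathfrak g(S,S')$. For a para-Hurwitz superalgebra $S$, $\mathfrak{tri}(S)$ is the Lie superalgebra (componentwise bracket) spanned by the homogeneous triples $(d_0,d_1,d_2)\in\mathfrak{osp}(S,q)^3$ of a common parity with $d_0(x\bullet y)=d_1(x)\bullet y+(-1)^{|d_0||x|}x\bullet d_2(y)$. Put $l_x(y)=x\bullet y$, $r_x(y)=(-1)^{|x||y|}y\bullet x$, $\sigma_{x,y}(z)=(-1)^{|y||z|}\mathrm b(x,z)y-(-1)^{|x|(|y|+|z|)}\mathrm b(y,z)x$, $t_{x,y}=(\sigma_{x,y},\tfrac12\mathrm b(x,y)1-r_xl_y,\tfrac12\mathrm b(x,y)1-l_xr_y)\in\mathfrak{tri}(S)$, $\theta(d_0,d_1,d_2)=(d_2,d_0,d_1)$. For para-Hurwitz superalgebras $S,S'$ (primes denote the objects for $S'$), $\mathfrak g(S,S')=(\mathfrak{tri}(S)\oplus\mathfrak{tri}(S'))\oplus(\oplus_{i=0}^2\iota_i(S\otimes S'))$, with $\iota_i(S\otimes S')$ a copy of $S\otimes S'$, is the Lie superalgebra in which $\mathfrak{tri}(S)\oplus\mathfrak{tri}(S')$ is a subsuperalgebra (direct sum of ideals)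 and $[(d_0,d_1,d_2),\iota_i(x\otimes x')]=\iota_i(d_i(x)\otimes x')$; $[(d_0',d_1',d_2'),\iota_i(x\otimes x')]=(-1)^{|d_i'||x|}\iota_i(x\otimes d_i'(x'))$; $[\iota_i(x\otimes x'),\iota_{i+1}(y\otimes y')]=(-1)^{|x'||y|}\iota_{i+2}((x\bullet y)\otimes(x'\bullet y'))$; $[\iota_i(x\otimes x'),\iota_i(y\otimes y')]=(-1)^{|x||x'|+|x||y'|+|y||y'|}\mathrm b'(x',y')\theta^i(t_{x,y})+(-1)^{|y||x'|}\mathrm b(x,y)\theta'^i(t'_{x',y'})$. Facts fixing the identifications: $\mathfrak{tri}(S_1)=0$; $\mathfrak{tri}(S_{1,2})=\{(d,d,d):d\in\mathfrak{osp}(S_{1,2},\mathrm b)\}$, with even part $\{(d,d,d): d\in\sigma_{V,V}\}$, identified with $\mathfrak{sp}(V)$ by restricting $d$ to $V$ (elements of $\sigma_{V,V}$ kill $1$), and odd part $\{(\sigma_{1,u},\sigma_{1,u},\sigma_{1,u}):u\in V\}\simeq V$. Thus $\mathfrak g(S_{1,2},S)_{\bar 0}=\mathfrak{sp}(V)\oplus\mathfrak g(S_1,S)$ and $\mathfrak g(S_{1,2},S)_{\bar 1}=\sigma_{1,V}\oplus(\oplus_i\iota_i(V\otimes S))$. The Jordan algebra. $J=H_3(C,* )$ consists of the $3\times3$ matrices over $C$ fixed by $(a_{ij})^*=(\bar a_{ji})$, with product $x\circ y=\frac12(xy+yx)$. $e_0,e_1,e_2$ are the diagonal matrix units (in positions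 $(1,1),(2,2),(3,3)$), and for $a\in S=\bar C$ (same space as $C$): $\iota_0(a)=2(\bar aE_{23}+aE_{32})$, $\iota_1(a)=2(aE_{13}+\bar aE_{31})$, $\iota_2(a)=2(\bar aE_{12}+aE_{21})$, so $J=(\oplus_i ke_i)\oplus(\oplus_i\iota_i(S))$. $L_x$ is multiplication by $x$ in $J$. $D_{(d_0,d_1,d_2)}\in\mathfrak{der}\,J$ is defined for $(d_0,d_1,d_2)\in\mathfrak{tri}(S)$ by $e_i\mapsto 0$, $\iota_i(a)\mapsto\iota_i(d_i(a))$; and $D_i(a)=2[L_{\iota_i(a)},L_{e_{i+1}}]$. The Lie superalgebra $\mathfrak g(J)$. Let $t$ be the trace on $J$, $J_0=\{x\in J:t(x)=0\}$ (which contains $1=e_0+e_1+e_2$ as the characteristic is $3$), $T_J^o=J_0/k1$, $\hat x=x+k1$, with symmetric form $(\hat x|\hat y)=t(x\circ y)$ and triple product $[\hat x\hat y\hat z]=\widehat{[L_x,L_y](z)}$. $\mathfrak{der}\,J$ acts faithfully on $T_J^o$ by $d(\hat x)=\widehat{d(x)}$. $\mathfrak g(J)$ is the Lie superalgebra with even part $\mathfrak{sp}(V)\oplus\mathfrak{der}\,J$ (direct sum of ideals), odd part $V\otimes T_J^o$, natural action $[s,v\otimes x]=s(v)\otimes x$, $[d,v\otimes x]=v\otimes d(x)$ of the even part on the odd part, and $[u\otimes\hat x,v\otimes\hat y]=-(\hat x|\hat y)\gamma_{u,v}+\langle u|v\rangle[L_x,L_y]$, where $\gamma_{u,v}(w)=\langle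 u|w\rangle v+\langle v|w\rangle u$. Finally $\hat\iota(1)=\widehat{e_0-e_1}=\widehat{e_1-e_2}=\widehat{e_2-e_0}$ and $\hat\iota_i(s)=\widehat{\iota_i(s)}$, so that $T_J^o=k\hat\iota(1)\oplus(\oplus_i\hat\iota_i(S))$. *)

theory Defs
  imports
    "HOL-Analysis.Finite_Cartesian_Product"
    "HOL-Library.Function_Algebras"
    "HOL-Library.Product_Plus"
    "HOL-Library.Numeral_Type"
begin

text \<open>
  Conventions. Parities are the naturals 0 and 1. Indices modulo 3 are elements of the type \<open>3\<close>,
  in which \<open>3 = 0\<close>; hence matrix row or column 3 is the element 0 of that type.
  A formula given for homogeneous elements is extended to arbitrary elements by summing over the
  parities of their homogeneous components. Spaces of functions carry the pointwise addition of
  \<open>Function_Algebras\<close>.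
\<close>

subsection \<open>Tensor products over a field\<close>

record ('k, 'a) vspace =
  vcar :: "'a set"
  vadd :: "'a \<Rightarrow> 'a \<Rightarrow> 'a"
  vscl :: "'k \<Rightarrow> 'a \<Rightarrow> 'a"

definition bilinear_form :: "('k::field, 'a) vspace \<Rightarrow> ('k, 'b) vspace \<Rightarrow> ('a \<Rightarrow> 'b \<Rightarrow> 'k) \<Rightarrow> bool" where
  "bilinear_form A B \<beta> \<longleftrightarrow>
     (\<forall>a\<in>vcar A. \<forall>a'\<in>vcar A. \<forall>b\<in>vcar B. \<beta> (vadd A a a') b = \<beta> a b + \<beta> a' b) \<and>
     (\<forall>a\<in>vcar A. \<forall>b\<in>vcar B. \<forall>b'\<in>vcar B. \<beta> a (vadd B b b') = \<beta> a b + \<beta> a b') \<and>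
     (\<forall>c. \<forall>a\<in>vcar A. \<forall>b\<in>vcar B. \<beta> (vscl A c a) b = c * \<beta> a b \<and> \<beta> a (vscl B c b) = c * \<beta> a b)"

text \<open>
  The tensor product of two vector spaces is realised inside the dual of the space of bilinear forms
  on them: \<open>tens A B a b\<close> is evaluation of bilinear forms at \<open>(a, b)\<close>, and the tensor
  product consists of the finite sums of such elements. Over a field this is a model of the
  tensor product, because linear functionals separate the points of every vector space.
\<close>

type_synonym ('k, 'a, 'b) tensor = "('a \<Rightarrow> 'b \<Rightarrow> 'k) \<Rightarrow> 'k"

definition tens :: "('k::field, 'a) vspace \<Rightarrow> ('k, 'b) vspace \<Rightarrow> 'a \<Rightarrow> 'b \<Rightarrow> ('k, 'a, 'b) tensor" where
  "tens A B a b = (\<lambda>\<beta>. if bilinear_form A B \<beta> then \<beta> a b else 0)"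

definition tensor_span ::
  "('k::field, 'a) vspace \<Rightarrow> ('k, 'b) vspace \<Rightarrow> ('a \<times> 'b) set \<Rightarrow> ('k, 'a, 'b) tensor set" where
  "tensor_span A B R = {\<Sum>(a, b)\<leftarrow>ps. tens A B a b | ps. set ps \<subseteq> R}"

definition tensor_space :: "('k::field, 'a) vspace \<Rightarrow> ('k, 'b) vspace \<Rightarrow> ('k, 'a, 'b) tensor set" where
  "tensor_space A B = tensor_span A B (vcar A \<times> vcar B)"

definition tensor_scale :: "'k::field \<Rightarrow> ('k, 'a, 'b) tensor \<Rightarrow> ('k, 'a, 'b) tensor" where
  "tensor_scale c t = (\<lambda>\<beta>. c * t \<beta>)"

text \<open>
  The linear map on the tensor product induced by a map \<open>f\<close> that is bilinear on the carriers; for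
  such \<open>f\<close> the value does not depend on the chosen expression of \<open>t\<close> as a sum.
\<close>

definition tensor_lift ::
  "('k::field, 'a) vspace \<Rightarrow> ('k, 'b) vspace \<Rightarrow> ('a \<Rightarrow> 'b \<Rightarrow> 'w::ab_group_add) \<Rightarrow> ('k, 'a, 'b) tensor \<Rightarrow> 'w" where
  "tensor_lift A B f t =
     (SOME w. \<exists>ps. set ps \<subseteq> vcar A \<times> vcar B \<and> t = (\<Sum>(a, b)\<leftarrow>ps. tens A B a b) \<and>
        w = (\<Sum>(a, b)\<leftarrow>ps. f a b))"

subsection \<open>Superalgebras with a quadratic superform\<close>

text \<open>
  \<open>prt A p x\<close> is the component of parity \<open>p\<close> of \<open>x\<close>. The quadratic form \<open>nrm\<close> is only
  meaningful on the even part; \<open>pol\<close> is the bilinear form \<open>b\<close> of the superform.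
\<close>

record ('k, 'a) superalg =
  scl :: "'k \<Rightarrow> 'a \<Rightarrow> 'a"
  prt :: "nat \<Rightarrow> 'a \<Rightarrow> 'a"
  mul :: "'a \<Rightarrow> 'a \<Rightarrow> 'a"
  nrm :: "'a \<Rightarrow> 'k"
  pol :: "'a \<Rightarrow> 'a \<Rightarrow> 'k"

definition vs_of :: "('k::field, 'a::ab_group_add) superalg \<Rightarrow> ('k, 'a) vspace" where
  "vs_of A = \<lparr>vcar = UNIV, vadd = (+), vscl = scl A\<rparr>"

definition homog :: "('k::field, 'a::ab_group_add) superalg \<Rightarrow> nat \<Rightarrow> 'a set" where
  "homog A p = {x. prt A p x = x}"

definition superspace :: "('k::field, 'a::ab_group_add) superalg \<Rightarrow> bool" where
  "superspace A \<longleftrightarrow>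
     vector_space (scl A) \<and>
     (\<forall>p<2. Vector_Spaces.linear (scl A) (scl A) (prt A p)) \<and>
     (\<forall>x. prt A 0 x + prt A 1 x = x) \<and>
     (\<forall>p<2. \<forall>q<2. \<forall>x. prt A p (prt A q x) = (if p = q then prt A q x else 0))"

definition superalgebra :: "('k::field, 'a::ab_group_add) superalg \<Rightarrow> bool" where
  "superalgebra A \<longleftrightarrow>
     superspace A \<and>
     (\<forall>x. Vector_Spaces.linear (scl A) (scl A) (mul A x)) \<and>
     (\<forall>y. Vector_Spaces.linear (scl A) (scl A) (\<lambda>x. mul A x y)) \<and>
     (\<forall>p<2. \<forall>q<2. \<forall>x\<in>homog A p. \<forall>y\<in>homog A q. mul A x y \<in> homog A ((p + q) mod 2))"

definition quadratic_superform :: "('k::field, 'a::ab_group_add) superalg \<Rightarrow> bool" where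
  "quadratic_superform A \<longleftrightarrow>
     (\<forall>c. \<forall>x\<in>homog A 0. nrm A (scl A c x) = c ^ 2 * nrm A x) \<and>
     (\<forall>x\<in>homog A 0. \<forall>y\<in>homog A 0. pol A x y = nrm A (x + y) - nrm A x - nrm A y) \<and>
     (\<forall>x. Vector_Spaces.linear (scl A) (*) (pol A x)) \<and>
     (\<forall>y. Vector_Spaces.linear (scl A) (*) (\<lambda>x. pol A x y)) \<and>
     (\<forall>p<2. \<forall>q<2. \<forall>x\<in>homog A p. \<forall>y\<in>homog A q.
        (p \<noteq> q \<longrightarrow> pol A x y = 0) \<and> pol A x y = (-1) ^ (p * q) * pol A y x)"

text \<open>
  Regularity of the quadratic form is taken as nondegeneracy of its polar form, which is the
  meaning of the term in characteristic different from 2.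
\<close>

definition regular_superform :: "('k::field, 'a::ab_group_add) superalg \<Rightarrow> bool" where
  "regular_superform A \<longleftrightarrow>
     (\<forall>p<2. \<forall>x\<in>homog A p. (\<forall>y\<in>homog A p. pol A x y = 0) \<longrightarrow> x = 0)"

text \<open>Composition superalgebras are nonzero.\<close>

definition composition_superalgebra :: "('k::field, 'a::ab_group_add) superalg \<Rightarrow> bool" where
  "composition_superalgebra A \<longleftrightarrow>
     superalgebra A \<and> quadratic_superform A \<and> regular_superform A \<and> (\<exists>x::'a. x \<noteq> 0) \<and>
     (\<forall>x\<in>homog A 0. \<forall>y\<in>homog A 0. nrm A (mul A x y) = nrm A x * nrm A y) \<and>
     (\<forall>x\<in>homog A 0. \<forall>y z. pol A (mul A x y) (mul A x z) = nrm A x * pol A y z \<and>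
        pol A (mul A y x) (mul A z x) = nrm A x * pol A y z) \<and>
     (\<forall>p<2. \<forall>q<2. \<forall>r<2. \<forall>s<2. \<forall>x\<in>homog A p. \<forall>y\<in>homog A q. \<forall>z\<in>homog A r. \<forall>t\<in>homog A s.
        pol A (mul A x y) (mul A z t) + (-1) ^ (p * q + p * r + q * r) * pol A (mul A z y) (mul A x t)
          = (-1) ^ (q * r) * pol A x z * pol A y t)"

definition is_unit_elt :: "('k::field, 'a::ab_group_add) superalg \<Rightarrow> 'a \<Rightarrow> bool" where
  "is_unit_elt A e \<longleftrightarrow> (\<forall>x. mul A e x = x \<and> mul A x e = x)"

definition unit_elt :: "('k::field, 'a::ab_group_add) superalg \<Rightarrow> 'a" where
  "unit_elt A = (THE e. is_unit_elt A e)"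

definition hurwitz_superalgebra :: "('k::field, 'a::ab_group_add) superalg \<Rightarrow> bool" where
  "hurwitz_superalgebra A \<longleftrightarrow> composition_superalgebra A \<and> (\<exists>e. is_unit_elt A e)"

definition hurwitz_algebra :: "('k::field, 'a::ab_group_add) superalg \<Rightarrow> bool" where
  "hurwitz_algebra A \<longleftrightarrow> hurwitz_superalgebra A \<and> homog A 1 = {0}"

definition std_inv :: "('k::field, 'a::ab_group_add) superalg \<Rightarrow> 'a \<Rightarrow> 'a" where
  "std_inv A x = scl A (pol A x (unit_elt A)) (unit_elt A) - x"

definition para_hurwitz :: "('k::field, 'a::ab_group_add) superalg \<Rightarrow> ('k, 'a) superalg" where
  "para_hurwitz A = A\<lparr>mul := \<lambda>x y. mul A (std_inv A x) (std_inv A y)\<rparr>"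

subsection \<open>The plane V and the superalgebra B(1,2)\<close>

record ('k, 'v) plane =
  pscl :: "'k \<Rightarrow> 'v \<Rightarrow> 'v"
  alt :: "'v \<Rightarrow> 'v \<Rightarrow> 'k"

definition symplectic_plane :: "('k::field, 'v::ab_group_add) plane \<Rightarrow> bool" where
  "symplectic_plane V \<longleftrightarrow>
     vector_space (pscl V) \<and> vector_space.dim (pscl V) (UNIV :: 'v set) = 2 \<and>
     (\<forall>u. Vector_Spaces.linear (pscl V) (*) (alt V u)) \<and>
     (\<forall>v. Vector_Spaces.linear (pscl V) (*) (\<lambda>u. alt V u v)) \<and>
     (\<forall>u. alt V u u = 0) \<and> (\<exists>u v. alt V u v \<noteq> 0)"

definition B12 :: "('k::field, 'v::ab_group_add) plane \<Rightarrow> ('k, 'k \<times> 'v) superalg" where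
  "B12 V =
    \<lparr>scl = (\<lambda>c (a, u). (c * a, pscl V c u)),
     prt = (\<lambda>p (a, u). if p = 0 then (a, 0) else (0, u)),
     mul = (\<lambda>(a, u) (b, v). (a * b + alt V u v, pscl V a v + pscl V b u)),
     nrm = (\<lambda>(a, u). a ^ 2),
     pol = (\<lambda>(a, u) (b, v). 2 * a * b + alt V u v)\<rparr>"

definition S12 :: "('k::field, 'v::ab_group_add) plane \<Rightarrow> ('k, 'k \<times> 'v) superalg" where
  "S12 V = para_hurwitz (B12 V)"

subsection \<open>Triality\<close>

definition osp_homog :: "('k::field, 'a::ab_group_add) superalg \<Rightarrow> nat \<Rightarrow> ('a \<Rightarrow> 'a) set" where
  "osp_homog A p =
     {d. Vector_Spaces.linear (scl A) (scl A) d \<and>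
         (\<forall>r<2. \<forall>x\<in>homog A r. d x \<in> homog A ((p + r) mod 2)) \<and>
         (\<forall>r<2. \<forall>x\<in>homog A r. \<forall>y. pol A (d x) y + (-1) ^ (p * r) * pol A x (d y) = 0)}"

type_synonym 'a triple = "3 \<Rightarrow> 'a \<Rightarrow> 'a"

definition tri_homog :: "('k::field, 'a::ab_group_add) superalg \<Rightarrow> nat \<Rightarrow> 'a triple set" where
  "tri_homog S p =
     {d. (\<forall>i. d i \<in> osp_homog S p) \<and>
         (\<forall>r<2. \<forall>x\<in>homog S r. \<forall>y.
            d 0 (mul S x y) = mul S (d 1 x) y + scl S ((-1) ^ (p * r)) (mul S x (d 2 y)))}"

definition tri :: "('k::field, 'a::ab_group_add) superalg \<Rightarrow> 'a triple set" where
  "tri S = {d + e | d e. d \<in> tri_homog S 0 \<and> e \<in> tri_homog S 1}"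

definition endo_prt :: "('k::field, 'a::ab_group_add) superalg \<Rightarrow> nat \<Rightarrow> ('a \<Rightarrow> 'a) \<Rightarrow> 'a \<Rightarrow> 'a" where
  "endo_prt A p d = (\<lambda>x. \<Sum>r<2. prt A ((p + r) mod 2) (d (prt A r x)))"

definition super_commutator ::
  "('k::field, 'a::ab_group_add) superalg \<Rightarrow> ('a \<Rightarrow> 'a) \<Rightarrow> ('a \<Rightarrow> 'a) \<Rightarrow> 'a \<Rightarrow> 'a" where
  "super_commutator A d e = (\<lambda>x. \<Sum>p<2. \<Sum>q<2.
     endo_prt A p d (endo_prt A q e x) - scl A ((-1) ^ (p * q)) (endo_prt A q e (endo_prt A p d x)))"

definition tri_bracket ::
  "('k::field, 'a::ab_group_add) superalg \<Rightarrow> 'a triple \<Rightarrow> 'a triple \<Rightarrow> 'a triple" where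
  "tri_bracket S d e = (\<lambda>i. super_commutator S (d i) (e i))"

definition lft :: "('k::field, 'a::ab_group_add) superalg \<Rightarrow> 'a \<Rightarrow> 'a \<Rightarrow> 'a" where
  "lft S x = (\<lambda>y. mul S x y)"

definition rgt :: "('k::field, 'a::ab_group_add) superalg \<Rightarrow> 'a \<Rightarrow> 'a \<Rightarrow> 'a" where
  "rgt S x = (\<lambda>y. \<Sum>p<2. \<Sum>q<2. scl S ((-1) ^ (p * q)) (mul S (prt S q y) (prt S p x)))"

definition sigma :: "('k::field, 'a::ab_group_add) superalg \<Rightarrow> 'a \<Rightarrow> 'a \<Rightarrow> 'a \<Rightarrow> 'a" where
  "sigma S x y = (\<lambda>z. \<Sum>p<2. \<Sum>q<2. \<Sum>r<2.
     scl S ((-1) ^ (q * r) * pol S (prt S p x) (prt S r z)) (prt S q y)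
     - scl S ((-1) ^ (p * (q + r)) * pol S (prt S q y) (prt S r z)) (prt S p x))"

definition tri_elt :: "('k::field, 'a::ab_group_add) superalg \<Rightarrow> 'a \<Rightarrow> 'a \<Rightarrow> 'a triple" where
  "tri_elt S x y = (\<lambda>i.
     if i = 0 then sigma S x y
     else if i = 1 then (\<lambda>z. scl S (1 / 2 * pol S x y) z - rgt S x (lft S y z))
     else (\<lambda>z. scl S (1 / 2 * pol S x y) z - lft S x (rgt S y z)))"

text \<open>
  Since \<open>\<theta> (d\<^sub>0, d\<^sub>1, d\<^sub>2) = (d\<^sub>2, d\<^sub>0, d\<^sub>1)\<close> has \<open>d\<^sub>j\<^sub>-\<^sub>1\<close> in position \<open>j\<close>, its
  \<open>i\<close>-th power has \<open>d\<^sub>j\<^sub>-\<^sub>i\<close> there (indices modulo 3).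
\<close>

definition theta_pow :: "3 \<Rightarrow> 'a triple \<Rightarrow> 'a triple" where
  "theta_pow i d = (\<lambda>j. d (j - i))"

subsection \<open>Graded algebras on subspaces, and their isomorphisms\<close>

text \<open>
  Both sides of the isomorphism are given by explicit even and odd subspaces of an additive group
  type and an explicit bracket. An isomorphism is an even linear bijection between the carriers
  that preserves brackets; values outside the carriers are irrelevant.
\<close>

record ('k, 'g) lie_superalg =
  lscl :: "'k \<Rightarrow> 'g \<Rightarrow> 'g"
  lprt :: "nat \<Rightarrow> 'g set"
  lbr :: "'g \<Rightarrow> 'g \<Rightarrow> 'g"

definition lcar :: "('k, 'g::ab_group_add) lie_superalg \<Rightarrow> 'g set" where
  "lcar G = {x + y | x y. x \<in> lprt G 0 \<and> y \<in> lprt G 1}"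

definition linear_on ::
  "('k, 'g::ab_group_add) lie_superalg \<Rightarrow> ('k, 'h::ab_group_add) lie_superalg \<Rightarrow> ('g \<Rightarrow> 'h) \<Rightarrow> bool" where
  "linear_on G H f \<longleftrightarrow>
     (\<forall>x\<in>lcar G. f x \<in> lcar H) \<and>
     (\<forall>x\<in>lcar G. \<forall>y\<in>lcar G. f (x + y) = f x + f y) \<and>
     (\<forall>c. \<forall>x\<in>lcar G. f (lscl G c x) = lscl H c (f x))"

definition lie_superalg_iso ::
  "('k, 'g::ab_group_add) lie_superalg \<Rightarrow> ('k, 'h::ab_group_add) lie_superalg \<Rightarrow> ('g \<Rightarrow> 'h) \<Rightarrow> bool" where
  "lie_superalg_iso G H f \<longleftrightarrow>
     linear_on G H f \<and> bij_betw f (lcar G) (lcar H) \<and>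
     (\<forall>p<2. f ` lprt G p \<subseteq> lprt H p) \<and>
     (\<forall>x\<in>lcar G. \<forall>y\<in>lcar G. f (lbr G x y) = lbr H (f x) (f y))"

subsection \<open>The Lie superalgebra g(S,S')\<close>

text \<open>
  An element is a triple \<open>(d, d', T)\<close> with \<open>d\<close> in \<open>tri S\<close>, \<open>d'\<close> in \<open>tri S'\<close>, and \<open>T i\<close> the
  tensor whose image under \<open>\<iota>\<^sub>i\<close> is the component in the \<open>i\<close>-th copy of the tensor product.
\<close>

type_synonym ('k, 'a, 'b) gelt = "'a triple \<times> 'b triple \<times> (3 \<Rightarrow> ('k, 'a, 'b) tensor)"

context
  fixes S :: "('k::field, 'a::ab_group_add) superalg" and S' :: "('k, 'b::ab_group_add) superalg"
begin

definition tn :: "'a \<Rightarrow> 'b \<Rightarrow> ('k, 'a, 'b) tensor" where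
  "tn = tens (vs_of S) (vs_of S')"

definition tlift :: "('a \<Rightarrow> 'b \<Rightarrow> 'w::ab_group_add) \<Rightarrow> ('k, 'a, 'b) tensor \<Rightarrow> 'w" where
  "tlift = tensor_lift (vs_of S) (vs_of S')"

definition tensor_homog :: "nat \<Rightarrow> ('k, 'a, 'b) tensor set" where
  "tensor_homog p = tensor_span (vs_of S) (vs_of S')
     (\<Union>r<2. \<Union>s\<in>{s. s < 2 \<and> (r + s) mod 2 = p}. homog S r \<times> homog S' s)"

definition tensor_prt :: "nat \<Rightarrow> ('k, 'a, 'b) tensor \<Rightarrow> ('k, 'a, 'b) tensor" where
  "tensor_prt p = tlift (\<lambda>x x'. \<Sum>r<2. tn (prt S r x) (prt S' ((p + r) mod 2) x'))"

text \<open>The brackets of \<open>d\<close> in \<open>tri S\<close>, respectively \<open>d'\<close> in \<open>tri S'\<close>, with a tensor in the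
  \<open>i\<close>-th copy; the argument is the \<open>i\<close>-th entry of the triple.\<close>

definition act1 :: "('a \<Rightarrow> 'a) \<Rightarrow> ('k, 'a, 'b) tensor \<Rightarrow> ('k, 'a, 'b) tensor" where
  "act1 d = tlift (\<lambda>x x'. tn (d x) x')"

definition act2 :: "('b \<Rightarrow> 'b) \<Rightarrow> ('k, 'a, 'b) tensor \<Rightarrow> ('k, 'a, 'b) tensor" where
  "act2 d' = tlift (\<lambda>x x'. \<Sum>p<2. \<Sum>r<2.
     tensor_scale ((-1) ^ (p * r)) (tn (prt S r x) (endo_prt S' p d' x')))"

text \<open>\<open>[\<iota>\<^sub>i t, \<iota>\<^sub>i\<^sub>+\<^sub>1 u]\<close>, as a tensor in the copy with index \<open>i + 2\<close>.\<close>

definition tmul ::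
  "('k, 'a, 'b) tensor \<Rightarrow> ('k, 'a, 'b) tensor \<Rightarrow> ('k, 'a, 'b) tensor" where
  "tmul t u = tlift (\<lambda>x x'. tlift (\<lambda>y y'. \<Sum>p<2. \<Sum>q<2.
     tensor_scale ((-1) ^ (p * q)) (tn (mul S x (prt S q y)) (mul S' (prt S' p x') y'))) u) t"

text \<open>The components of \<open>[\<iota>\<^sub>i t, \<iota>\<^sub>i u]\<close> in \<open>tri S\<close> and \<open>tri S'\<close>, before applying \<open>\<theta>\<^sup>i\<close>.\<close>

definition ttri1 :: "('k, 'a, 'b) tensor \<Rightarrow> ('k, 'a, 'b) tensor \<Rightarrow> 'a triple" where
  "ttri1 t u = tlift (\<lambda>x x'. tlift (\<lambda>y y' i z. \<Sum>p<2. \<Sum>p'<2. \<Sum>q<2. \<Sum>q'<2.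
     scl S ((-1) ^ (p * p' + p * q' + q * q') * pol S' (prt S' p' x') (prt S' q' y'))
       (tri_elt S (prt S p x) (prt S q y) i z)) u) t"

definition ttri2 :: "('k, 'a, 'b) tensor \<Rightarrow> ('k, 'a, 'b) tensor \<Rightarrow> 'b triple" where
  "ttri2 t u = tlift (\<lambda>x x'. tlift (\<lambda>y y' i z. \<Sum>p'<2. \<Sum>q<2.
     scl S' ((-1) ^ (q * p') * pol S x (prt S q y)) (tri_elt S' (prt S' p' x') y' i z)) u) t"

text \<open>
  Brackets taken in the order opposite to the defining formulas come from super-anticommutativity,
  \<open>[X, Y] = - (-1)\<^sup>|\<^sup>X\<^sup>|\<^sup>|\<^sup>Y\<^sup>| [Y, X]\<close>; these are the terms with a minus sign.
\<close>

definition g_bracket :: "('k, 'a, 'b) gelt \<Rightarrow> ('k, 'a, 'b) gelt \<Rightarrow> ('k, 'a, 'b) gelt" where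
  "g_bracket = (\<lambda>(d, d', T) (e, e', U).
     (tri_bracket S d e + (\<Sum>i\<in>UNIV. theta_pow i (ttri1 (T i) (U i))),
      tri_bracket S' d' e' + (\<Sum>i\<in>UNIV. theta_pow i (ttri2 (T i) (U i))),
      \<lambda>j. act1 (d j) (U j) + act2 (d' j) (U j)
        - (\<Sum>p<2. \<Sum>q<2. tensor_scale ((-1) ^ (p * q))
             (act1 (endo_prt S q (e j)) (tensor_prt p (T j)) +
              act2 (endo_prt S' q (e' j)) (tensor_prt p (T j))))
        + tmul (T (j + 1)) (U (j + 2))
        - (\<Sum>p<2. \<Sum>q<2. tensor_scale ((-1) ^ (p * q))
             (tmul (tensor_prt q (U (j + 1))) (tensor_prt p (T (j + 2)))))))"

definition g_alg :: "('k, ('k, 'a, 'b) gelt) lie_superalg" where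
  "g_alg =
    \<lparr>lscl = (\<lambda>c (d, d', T).
       (\<lambda>i x. scl S c (d i x), \<lambda>i x. scl S' c (d' i x), \<lambda>i. tensor_scale c (T i))),
     lprt = (\<lambda>p. {(d, d', T). d \<in> tri_homog S p \<and> d' \<in> tri_homog S' p \<and> (\<forall>i. T i \<in> tensor_homog p)}),
     lbr = g_bracket\<rparr>"

definition g_iota :: "3 \<Rightarrow> ('k, 'a, 'b) tensor \<Rightarrow> ('k, 'a, 'b) gelt" where
  "g_iota i t = (0, 0, \<lambda>j. if j = i then t else 0)"

end

subsection \<open>The Jordan algebra of hermitian 3 by 3 matrices\<close>

context
  fixes C :: "('k::field, 'c::ab_group_add) superalg"
begin

definition mat_scale :: "'k \<Rightarrow> 'c^3^3 \<Rightarrow> 'c^3^3" where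
  "mat_scale c x = (\<chi> i j. scl C c (x $ i $ j))"

definition mat_mul :: "'c^3^3 \<Rightarrow> 'c^3^3 \<Rightarrow> 'c^3^3" where
  "mat_mul x y = (\<chi> i j. \<Sum>l\<in>UNIV. mul C (x $ i $ l) (y $ l $ j))"

definition mat_star :: "'c^3^3 \<Rightarrow> 'c^3^3" where
  "mat_star x = (\<chi> i j. std_inv C (x $ j $ i))"

definition E :: "3 \<Rightarrow> 3 \<Rightarrow> 'c \<Rightarrow> 'c^3^3" where
  "E r s a = (\<chi> i j. if i = r \<and> j = s then a else 0)"

definition jordan :: "('c^3^3) set" where
  "jordan = {x. mat_star x = x}"

definition jmul :: "'c^3^3 \<Rightarrow> 'c^3^3 \<Rightarrow> 'c^3^3" where
  "jmul x y = mat_scale (1 / 2) (mat_mul x y + mat_mul y x)"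

definition je :: "3 \<Rightarrow> 'c^3^3" where
  "je i = E (i + 1) (i + 1) (unit_elt C)"

definition jiota :: "3 \<Rightarrow> 'c \<Rightarrow> 'c^3^3" where
  "jiota i a = mat_scale 2
     (if i = 0 then E 2 3 (std_inv C a) + E 3 2 a
      else if i = 1 then E 1 3 a + E 3 1 (std_inv C a)
      else E 1 2 (std_inv C a) + E 2 1 a)"

definition jone :: "'c^3^3" where
  "jone = (\<Sum>i\<in>UNIV. je i)"

text \<open>
  Linear endomorphisms of the Jordan algebra are represented by functions that vanish outside it.
\<close>

definition jL :: "'c^3^3 \<Rightarrow> 'c^3^3 \<Rightarrow> 'c^3^3" where
  "jL x = (\<lambda>y. if y \<in> jordan then jmul x y else 0)"

definition der :: "('c^3^3 \<Rightarrow> 'c^3^3) set" where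
  "der = {d.
     (\<forall>x\<in>jordan. d x \<in> jordan) \<and> (\<forall>x. x \<notin> jordan \<longrightarrow> d x = 0) \<and>
     (\<forall>x\<in>jordan. \<forall>y\<in>jordan. d (x + y) = d x + d y) \<and>
     (\<forall>c. \<forall>x\<in>jordan. d (mat_scale c x) = mat_scale c (d x)) \<and>
     (\<forall>x\<in>jordan. \<forall>y\<in>jordan. d (jmul x y) = jmul (d x) y + jmul x (d y))}"

definition commutator :: "('c^3^3 \<Rightarrow> 'c^3^3) \<Rightarrow> ('c^3^3 \<Rightarrow> 'c^3^3) \<Rightarrow> 'c^3^3 \<Rightarrow> 'c^3^3" where
  "commutator f g = (\<lambda>x. f (g x) - g (f x))"

text \<open>
  The element \<open>a\<close> of the component \<open>\<iota>\<^sub>i a\<close> of \<open>x\<close>: half of the entry of \<open>x\<close> in position (3,2),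
  (1,3), (2,1) for \<open>i = 0, 1, 2\<close>.
\<close>

definition jcoord :: "3 \<Rightarrow> 'c^3^3 \<Rightarrow> 'c" where
  "jcoord i x = scl C (1 / 2) (x $ i $ (i + 2))"

definition D_tri :: "'c triple \<Rightarrow> 'c^3^3 \<Rightarrow> 'c^3^3" where
  "D_tri d = (\<lambda>x. if x \<in> jordan then \<Sum>i\<in>UNIV. jiota i (d i (jcoord i x)) else 0)"

definition D_iota :: "3 \<Rightarrow> 'c \<Rightarrow> 'c^3^3 \<Rightarrow> 'c^3^3" where
  "D_iota i a = (\<lambda>x. mat_scale 2 (commutator (jL (jiota i a)) (jL (je (i + 1))) x))"

text \<open>The diagonal entries of a hermitian matrix lie in \<open>k1\<close>; the trace is their sum as a scalar.\<close>

definition jtrace :: "'c^3^3 \<Rightarrow> 'k" where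
  "jtrace x = (THE c. (\<Sum>i\<in>UNIV. x $ i $ i) = scl C c (unit_elt C))"

definition jordan0 :: "('c^3^3) set" where
  "jordan0 = {x \<in> jordan. jtrace x = 0}"

definition hat :: "'c^3^3 \<Rightarrow> ('c^3^3) set" where
  "hat x = {x + mat_scale c jone | c. True}"

definition TJ :: "('k, ('c^3^3) set) vspace" where
  "TJ = \<lparr>vcar = hat ` jordan0,
         vadd = (\<lambda>X Y. {x + y | x y. x \<in> X \<and> y \<in> Y}),
         vscl = (\<lambda>c X. {mat_scale c x + mat_scale m jone | x m. x \<in> X})\<rparr>"

text \<open>
  Form, commutator \<open>[L\<^sub>x, L\<^sub>y]\<close> and derivation action on cosets, computed on arbitrary
  representatives; the values do not depend on these.
\<close>

definition rep :: "('c^3^3) set \<Rightarrow> 'c^3^3" where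
  "rep X = (SOME x. x \<in> X)"

definition TJ_form :: "('c^3^3) set \<Rightarrow> ('c^3^3) set \<Rightarrow> 'k" where
  "TJ_form X Y = jtrace (jmul (rep X) (rep Y))"

definition TJ_comm :: "('c^3^3) set \<Rightarrow> ('c^3^3) set \<Rightarrow> 'c^3^3 \<Rightarrow> 'c^3^3" where
  "TJ_comm X Y = commutator (jL (rep X)) (jL (rep Y))"

definition TJ_act :: "('c^3^3 \<Rightarrow> 'c^3^3) \<Rightarrow> ('c^3^3) set \<Rightarrow> ('c^3^3) set" where
  "TJ_act d X = hat (d (rep X))"

definition hat_iota1 :: "('c^3^3) set" where
  "hat_iota1 = hat (je 0 - je 1)"

definition hat_iota :: "3 \<Rightarrow> 'c \<Rightarrow> ('c^3^3) set" where
  "hat_iota i a = hat (jiota i a)"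

end

subsection \<open>The Lie superalgebra g(J)\<close>

definition sp :: "('k::field, 'v::ab_group_add) plane \<Rightarrow> ('v \<Rightarrow> 'v) set" where
  "sp V = {s. Vector_Spaces.linear (pscl V) (pscl V) s \<and> (\<forall>u v. alt V (s u) v + alt V u (s v) = 0)}"

definition gam :: "('k::field, 'v::ab_group_add) plane \<Rightarrow> 'v \<Rightarrow> 'v \<Rightarrow> 'v \<Rightarrow> 'v" where
  "gam V u v = (\<lambda>w. pscl V (alt V u w) v + pscl V (alt V v w) u)"

definition vs_plane :: "('k::field, 'v::ab_group_add) plane \<Rightarrow> ('k, 'v) vspace" where
  "vs_plane V = \<lparr>vcar = UNIV, vadd = (+), vscl = pscl V\<rparr>"

type_synonym ('k, 'v, 'c) gJelt =
  "('v \<Rightarrow> 'v) \<times> ('c^3^3 \<Rightarrow> 'c^3^3) \<times> ('k, 'v, ('c^3^3) set) tensor"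

context
  fixes V :: "('k::field, 'v::ab_group_add) plane" and C :: "('k, 'c::ab_group_add) superalg"
begin

definition tnJ :: "'v \<Rightarrow> ('c^3^3) set \<Rightarrow> ('k, 'v, ('c^3^3) set) tensor" where
  "tnJ = tens (vs_plane V) (TJ C)"

definition tliftJ ::
  "('v \<Rightarrow> ('c^3^3) set \<Rightarrow> 'w::ab_group_add) \<Rightarrow> ('k, 'v, ('c^3^3) set) tensor \<Rightarrow> 'w" where
  "tliftJ = tensor_lift (vs_plane V) (TJ C)"

definition actJ ::
  "('v \<Rightarrow> 'v) \<Rightarrow> ('c^3^3 \<Rightarrow> 'c^3^3) \<Rightarrow> ('k, 'v, ('c^3^3) set) tensor \<Rightarrow> ('k, 'v, ('c^3^3) set) tensor" where
  "actJ s d = tliftJ (\<lambda>v X. tnJ (s v) X + tnJ v (TJ_act C d X))"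

definition oddJ1 ::
  "('k, 'v, ('c^3^3) set) tensor \<Rightarrow> ('k, 'v, ('c^3^3) set) tensor \<Rightarrow> 'v \<Rightarrow> 'v" where
  "oddJ1 t t' = tliftJ (\<lambda>u X. tliftJ (\<lambda>v Y w. pscl V (- TJ_form C X Y) (gam V u v w)) t') t"

definition oddJ2 ::
  "('k, 'v, ('c^3^3) set) tensor \<Rightarrow> ('k, 'v, ('c^3^3) set) tensor \<Rightarrow> 'c^3^3 \<Rightarrow> 'c^3^3" where
  "oddJ2 t t' = tliftJ (\<lambda>u X. tliftJ (\<lambda>v Y z. mat_scale C (alt V u v) (TJ_comm C X Y z)) t') t"

definition gJ_bracket :: "('k, 'v, 'c) gJelt \<Rightarrow> ('k, 'v, 'c) gJelt \<Rightarrow> ('k, 'v, 'c) gJelt" where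
  "gJ_bracket = (\<lambda>(s, d, t) (s', d', t').
     ((\<lambda>w. s (s' w) - s' (s w)) + oddJ1 t t',
      commutator d d' + oddJ2 t t',
      actJ s d t' - actJ s' d' t))"

definition gJ_alg :: "('k, ('k, 'v, 'c) gJelt) lie_superalg" where
  "gJ_alg =
    \<lparr>lscl = (\<lambda>c (s, d, t). (\<lambda>v. pscl V c (s v), \<lambda>x. mat_scale C c (d x), tensor_scale c t)),
     lprt = (\<lambda>p. if p = 0 then sp V \<times> der C \<times> {0} else {0} \<times> {0} \<times> tensor_space (vs_plane V) (TJ C)),
     lbr = gJ_bracket\<rparr>"

text \<open>
  The conditions determining the map, with S the para-Hurwitz algebra attached to C. In (1), an
  element of the even part of \<open>tri (S12 V)\<close> has equal entries \<open>d\<close> and corresponds to the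
  restriction of \<open>d\<close> to the odd part V of \<open>S12 V\<close>.
\<close>

definition Psi_conditions ::
  "(('k, 'k \<times> 'v, 'c) gelt \<Rightarrow> ('k, 'v, 'c) gJelt) \<Rightarrow> bool" where
  "Psi_conditions \<Psi> \<longleftrightarrow>
     (\<forall>d\<in>tri_homog (S12 V) 0. \<Psi> (d, 0, 0) = (\<lambda>v. snd (d 0 (0, v)), 0, 0)) \<and>
     (\<forall>d\<in>tri (para_hurwitz C). \<Psi> (0, d, 0) = (0, D_tri C d, 0)) \<and>
     (\<forall>i a. \<Psi> (g_iota i (tn (S12 V) (para_hurwitz C) (1, 0) a)) = (0, D_iota C i a, 0)) \<and>
     (\<forall>u. \<Psi> ((\<lambda>_. sigma (S12 V) (1, 0) (0, u)), 0, 0) = (0, 0, tnJ u (hat_iota1 C))) \<and>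
     (\<forall>i u s. \<Psi> (g_iota i (tn (S12 V) (para_hurwitz C) (0, u) s)) = (0, 0, tnJ u (hat_iota C i s)))"

end

end

theory Submission
  imports Defs "HOL-Analysis.Cartesian_Space"
begin

text \<open>
  Both Lie superalgebras have the same coordinates, and \<open>\<Psi>\<close> is the identity in them. Write
  \<open>\<diamondop>\<close> for the para-Hurwitz product of \<open>S\<close> and \<open>v\<^sub>1, v\<^sub>2\<close> for a symplectic basis of \<open>V\<close>.

  On the source side, \<open>tri(S(1,2))\<close> consists of the constant triples of \<open>s\<close> in \<open>sp(V)\<close> and of
  \<open>\<sigma>\<^sub>1\<^sub>,\<^sub>u\<close>, because the triality identity forces the entries of a triple to agree. So every element
  is uniquely a sum of \<open>s\<close>, of \<open>F(d, a) = d + \<Sum>\<iota>\<^sub>i(1 \<otimes> a\<^sub>i)\<close> with \<open>d\<close> in \<open>tri(S)\<close>, and of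
  \<open>R(u, t, b) = t \<sigma>\<^sub>1\<^sub>,\<^sub>u + \<Sum>\<iota>\<^sub>i(u \<otimes> b\<^sub>i)\<close> for \<open>u = v\<^sub>1\<close> and \<open>u = v\<^sub>2\<close>. On the target side, every
  derivation of \<open>J\<close> is uniquely \<open>\<Phi>(d, a) = D\<^sub>d + \<Sum>D\<^sub>i(a\<^sub>i)\<close> (lemmas \<open>der_is_Phi\<close>, \<open>Phi_inject\<close>): its values
  on the idempotents \<open>e\<^sub>i\<close> determine \<open>a\<close>, and a derivation killing the \<open>e\<^sub>i\<close> preserves the Peirce
  spaces \<open>\<iota>\<^sub>i(S)\<close>, where the multiplication rules turn it into a triple of \<open>tri(S)\<close>. In
  characteristic 3 the unit has trace zero and \<open>e\<^sub>0 - e\<^sub>1\<close>, \<open>e\<^sub>1 - e\<^sub>2\<close>, \<open>e\<^sub>2 - e\<^sub>0\<close> agree modulo the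
  unit, so that every class in the module \<open>T\<^sub>J\<close> is uniquely
  \<open>t (e\<^sub>0 - e\<^sub>1) + \<Sum>\<iota>\<^sub>i(b\<^sub>i)\<close>. The conditions on \<open>\<Psi>\<close> say that \<open>s\<close> goes to \<open>s\<close>, \<open>F(d, a)\<close> to
  \<open>\<Phi>(d, a)\<close>, and \<open>R(u, t, b)\<close> to \<open>u\<close> tensored with this class; hence \<open>\<Psi>\<close> is unique and bijective.

  It remains to compare brackets of generators. The brackets of the \<open>F\<close> correspond to commutators of
  derivations (\<open>commutator_Phi\<close>), those of \<open>F\<close> with \<open>R\<close> to the action of derivations on \<open>T\<^sub>J\<close>
  (\<open>TJ_act_TJel\<close>), and those of the \<open>R\<close> to the commutators \<open>[L\<^sub>x, L\<^sub>y]\<close> (\<open>commutator_jL\<close>). Each is an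
  identity between polynomial expressions in the coordinates that follows from three facts on \<open>\<diamondop>\<close>:
  \<open>b(x \<diamondop> y, z) = b(x, y \<diamondop> z)\<close> and \<open>(x \<diamondop> y) \<diamondop> z + (z \<diamondop> y) \<diamondop> x = b(x, z) y = x \<diamondop> (y \<diamondop> z) + z \<diamondop> (y \<diamondop> x)\<close>,
  together with the triality identity and \<open>1/2 = 2 = -1\<close>.
\<close>

section \<open>Linear maps out of tensor products\<close>

text \<open>
  The target is given by its scalar multiplication, since the brackets take values in
  spaces of functions, for which there is no canonical scalar structure on the type.
\<close>

definition bilinear_map ::
  "('k::field, 'a) vspace \<Rightarrow> ('k, 'b) vspace \<Rightarrow> ('k \<Rightarrow> 'w::ab_group_add \<Rightarrow> 'w) \<Rightarrow> ('a \<Rightarrow> 'b \<Rightarrow> 'w) \<Rightarrow> bool" where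
  "bilinear_map A B sc f \<longleftrightarrow> vector_space sc \<and>
     (\<forall>a\<in>vcar A. \<forall>a'\<in>vcar A. \<forall>b\<in>vcar B. f (vadd A a a') b = f a b + f a' b) \<and>
     (\<forall>a\<in>vcar A. \<forall>b\<in>vcar B. \<forall>b'\<in>vcar B. f a (vadd B b b') = f a b + f a b') \<and>
     (\<forall>c. \<forall>a\<in>vcar A. \<forall>b\<in>vcar B. f (vscl A c a) b = sc c (f a b) \<and> f a (vscl B c b) = sc c (f a b))"

lemma functional_separates:
  fixes sc :: "'k::field \<Rightarrow> 'w::ab_group_add \<Rightarrow> 'w"
  assumes "vector_space sc" "w \<noteq> 0"
  shows "\<exists>\<phi>. Vector_Spaces.linear sc (*) \<phi> \<and> \<phi> w \<noteq> 0"
proof -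
  interpret vector_space sc by fact
  interpret vector_space_pair sc "(*) :: 'k \<Rightarrow> 'k \<Rightarrow> 'k"
    by unfold_locales (auto simp: algebra_simps)
  have "\<not> dependent {w}" using assms(2) by simp
  from linear_independent_extend[OF this, of "\<lambda>_. 1"] show ?thesis by auto
qed

lemma sum_list_apply: "(\<Sum>x\<leftarrow>xs. g x) \<beta> = (\<Sum>x\<leftarrow>xs. g x \<beta>)"
  by (induction xs) auto

lemma linear_rules:
  assumes "Vector_Spaces.linear s sc f"
  shows "f (x + y) = f x + f y" "f (s c x) = sc c (f x)" "f (x - y) = f x - f y" "f (- x) = - f x" "f 0 = 0"
proof -
  interpret l: Vector_Spaces.linear s sc f by fact
  show "f (x + y) = f x + f y" "f (s c x) = sc c (f x)" "f (x - y) = f x - f y" "f (- x) = - f x" "f 0 = 0"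
    by (simp_all add: l.add l.scale l.diff l.neg)
qed

lemma linear_sum_list:
  "Vector_Spaces.linear s1 s2 \<phi> \<Longrightarrow> \<phi> (\<Sum>x\<leftarrow>xs. g x) = (\<Sum>x\<leftarrow>xs. \<phi> (g x))"
  by (induction xs) (simp_all add: linear_rules[of s1 s2 \<phi>])

text \<open>
  Two expressions of one tensor have the same value under a bilinear map, because a linear
  functional composed with that map is one of the bilinear forms at which tensors are evaluated,
  and the functionals on the target separate its points.
\<close>

lemma tensor_lift_sum:
  assumes f: "bilinear_map A B sc f" and ps: "set ps \<subseteq> vcar A \<times> vcar B"
  shows "tensor_lift A B f (\<Sum>(a, b)\<leftarrow>ps. tens A B a b) = (\<Sum>(a, b)\<leftarrow>ps. f a b)"
proof -
  have "w = (\<Sum>(a, b)\<leftarrow>ps. f a b)"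
    if w: "\<exists>ps'. set ps' \<subseteq> vcar A \<times> vcar B \<and> (\<Sum>(a, b)\<leftarrow>ps. tens A B a b) = (\<Sum>(a, b)\<leftarrow>ps'. tens A B a b) \<and>
        w = (\<Sum>(a, b)\<leftarrow>ps'. f a b)" for w
  proof (rule ccontr)
    from w obtain ps' where ps': "set ps' \<subseteq> vcar A \<times> vcar B"
      and eq: "(\<Sum>(a, b)\<leftarrow>ps. tens A B a b) = (\<Sum>(a, b)\<leftarrow>ps'. tens A B a b)"
      and w': "w = (\<Sum>(a, b)\<leftarrow>ps'. f a b)" by blast
    assume "w \<noteq> (\<Sum>(a, b)\<leftarrow>ps. f a b)"
    then have ne: "w - (\<Sum>(a, b)\<leftarrow>ps. f a b) \<noteq> 0" by simp
    have sc: "vector_space sc" using f unfolding bilinear_map_def by blast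
    from functional_separates[OF sc ne]
    obtain \<phi> where \<phi>: "Vector_Spaces.linear sc (*) \<phi>" "\<phi> (w - (\<Sum>(a, b)\<leftarrow>ps. f a b)) \<noteq> 0"
      by blast
    define \<beta> where "\<beta> = (\<lambda>a b. \<phi> (f a b))"
    have \<beta>: "bilinear_form A B \<beta>"
      using f \<phi>(1) unfolding bilinear_form_def bilinear_map_def \<beta>_def Vector_Spaces.linear_iff by auto
    have ev: "(\<Sum>(a, b)\<leftarrow>qs. tens A B a b) \<beta> = \<phi> (\<Sum>(a, b)\<leftarrow>qs. f a b)" for qs
      using \<beta> by (simp add: sum_list_apply linear_sum_list[OF \<phi>(1)] tens_def split_beta \<beta>_def)
    have "\<phi> w = \<phi> (\<Sum>(a, b)\<leftarrow>ps. f a b)"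
      using ev[of ps] ev[of ps'] eq w' by simp
    moreover have "\<phi> (w - v) = \<phi> w - \<phi> v" for v
      using \<phi>(1) module_hom.diff[OF Vector_Spaces.linear.axioms(3)] by blast
    ultimately show False using \<phi>(2) by simp
  qed
  then show ?thesis
    unfolding tensor_lift_def using ps by (intro some_equality) blast+
qed

lemma tensor_space_sum:
  "set ps \<subseteq> vcar A \<times> vcar B \<Longrightarrow> (\<Sum>(a, b)\<leftarrow>ps. tens A B a b) \<in> tensor_space A B"
  unfolding tensor_space_def tensor_span_def by blast

lemma tensor_spaceE:
  assumes "t \<in> tensor_space A B"
  obtains ps where "set ps \<subseteq> vcar A \<times> vcar B" "t = (\<Sum>(a, b)\<leftarrow>ps. tens A B a b)"
  using assms unfolding tensor_space_def tensor_span_def by blast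

lemma tensor_space_tens: "a \<in> vcar A \<Longrightarrow> b \<in> vcar B \<Longrightarrow> tens A B a b \<in> tensor_space A B"
  using tensor_space_sum[of "[(a, b)]" A B] by simp

lemma tensor_span_0: "0 \<in> tensor_span A B R"
  unfolding tensor_span_def by (intro CollectI exI[of _ "[]"]) simp

lemma tensor_span_add: "s \<in> tensor_span A B R \<Longrightarrow> t \<in> tensor_span A B R \<Longrightarrow> s + t \<in> tensor_span A B R"
  unfolding tensor_span_def
  by (clarsimp, rename_tac ps qs, rule_tac x = "ps @ qs" in exI) auto

lemma tensor_span_tens: "(a, b) \<in> R \<Longrightarrow> tens A B a b \<in> tensor_span A B R"
  unfolding tensor_span_def by (intro CollectI exI[of _ "[(a, b)]"]) simp

lemma tensor_span_induct [consumes 1, case_names zero add]: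
  assumes "t \<in> tensor_span A B R" "P 0"
    and "\<And>a b s. (a, b) \<in> R \<Longrightarrow> s \<in> tensor_span A B R \<Longrightarrow> P s \<Longrightarrow> P (tens A B a b + s)"
  shows "P t"
proof -
  obtain ps where ps: "set ps \<subseteq> R" and t: "t = (\<Sum>(a, b)\<leftarrow>ps. tens A B a b)"
    using assms(1) unfolding tensor_span_def by blast
  from ps have "(\<Sum>(a, b)\<leftarrow>ps. tens A B a b) \<in> tensor_span A B R \<and> P (\<Sum>(a, b)\<leftarrow>ps. tens A B a b)"
  proof (induction ps)
    case Nil
    then show ?case using assms(2) tensor_span_0 by (simp add: zero_fun_def)
  next
    case (Cons p ps)
    then obtain a b where p: "p = (a, b)" "(a, b) \<in> R" by (cases p) auto
    have IH: "(\<Sum>(a, b)\<leftarrow>ps. tens A B a b) \<in> tensor_span A B R" "P (\<Sum>(a, b)\<leftarrow>ps. tens A B a b)"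
      using Cons by auto
    show ?case
      using assms(3)[OF p(2) IH] tensor_span_add[OF tensor_span_tens[OF p(2)] IH(1)]
      unfolding p(1) list.map sum_list.Cons prod.case by blast
  qed
  then show ?thesis using t by simp
qed

lemma tensor_lift_tens:
  "bilinear_map A B sc f \<Longrightarrow> a \<in> vcar A \<Longrightarrow> b \<in> vcar B \<Longrightarrow> tensor_lift A B f (tens A B a b) = f a b"
  using tensor_lift_sum[of A B sc f "[(a, b)]"] by simp

lemma tensor_lift_add:
  assumes "bilinear_map A B sc f" "s \<in> tensor_space A B" "t \<in> tensor_space A B"
  shows "tensor_lift A B f (s + t) = tensor_lift A B f s + tensor_lift A B f t"
proof -
  obtain ps where ps: "set ps \<subseteq> vcar A \<times> vcar B" "s = (\<Sum>(a, b)\<leftarrow>ps. tens A B a b)"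
    using assms(2) by (rule tensor_spaceE)
  obtain qs where qs: "set qs \<subseteq> vcar A \<times> vcar B" "t = (\<Sum>(a, b)\<leftarrow>qs. tens A B a b)"
    using assms(3) by (rule tensor_spaceE)
  have "s + t = (\<Sum>(a, b)\<leftarrow>ps @ qs. tens A B a b)" using ps qs by simp
  then show ?thesis
    using tensor_lift_sum[OF assms(1), of "ps @ qs"] tensor_lift_sum[OF assms(1), of ps]
      tensor_lift_sum[OF assms(1), of qs] ps qs by simp
qed

lemma tensor_lift_0: "bilinear_map A B sc f \<Longrightarrow> tensor_lift A B f 0 = 0"
  using tensor_lift_sum[of A B sc f "[]"] by simp

lemma tensor_lift_cong:
  assumes "\<And>a b. a \<in> vcar A \<Longrightarrow> b \<in> vcar B \<Longrightarrow> f a b = g a b"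
  shows "tensor_lift A B f t = tensor_lift A B g t"
proof -
  have "(\<Sum>(a, b)\<leftarrow>ps. f a b) = (\<Sum>(a, b)\<leftarrow>ps. g a b)" if "set ps \<subseteq> vcar A \<times> vcar B" for ps
    using that assms by (intro arg_cong[of _ _ sum_list] map_cong) auto
  then show ?thesis unfolding tensor_lift_def by (intro arg_cong[of _ _ Eps] ext) metis
qed

lemma bilinear_map_add:
  "bilinear_map A B sc f \<Longrightarrow> bilinear_map A B sc g \<Longrightarrow> bilinear_map A B sc (\<lambda>a b. f a b + g a b)"
  unfolding bilinear_map_def by (auto simp: vector_space.vector_space_assms algebra_simps)

lemma bilinear_map_scale:
  "bilinear_map A B sc f \<Longrightarrow> bilinear_map A B sc (\<lambda>a b. sc c (f a b))"
  unfolding bilinear_map_def by (auto simp: vector_space.vector_space_assms mult.commute)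

lemma tensor_lift_add_map:
  assumes "bilinear_map A B sc f" "bilinear_map A B sc g" "t \<in> tensor_space A B"
  shows "tensor_lift A B (\<lambda>a b. f a b + g a b) t = tensor_lift A B f t + tensor_lift A B g t"
proof -
  obtain ps where ps: "set ps \<subseteq> vcar A \<times> vcar B" "t = (\<Sum>(a, b)\<leftarrow>ps. tens A B a b)"
    using assms(3) by (rule tensor_spaceE)
  have "(\<Sum>(a, b)\<leftarrow>ps. f a b + g a b) = (\<Sum>(a, b)\<leftarrow>ps. f a b) + (\<Sum>(a, b)\<leftarrow>ps. g a b)"
    by (induction ps) auto
  then show ?thesis
    using tensor_lift_sum[OF bilinear_map_add[OF assms(1,2)], of ps]
      tensor_lift_sum[OF assms(1), of ps] tensor_lift_sum[OF assms(2), of ps] ps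
    by simp
qed

lemma tensor_lift_scale_map:
  assumes f: "bilinear_map A B sc f" and t: "t \<in> tensor_space A B"
  shows "tensor_lift A B (\<lambda>a b. sc c (f a b)) t = sc c (tensor_lift A B f t)"
proof -
  obtain ps where ps: "set ps \<subseteq> vcar A \<times> vcar B" "t = (\<Sum>(a, b)\<leftarrow>ps. tens A B a b)"
    using t by (rule tensor_spaceE)
  interpret vector_space sc using f unfolding bilinear_map_def by blast
  have "sc c (\<Sum>(a, b)\<leftarrow>ps. f a b) = (\<Sum>(a, b)\<leftarrow>ps. sc c (f a b))"
    by (induction ps) (auto simp: scale_right_distrib)
  then show ?thesis
    using ps tensor_lift_sum[OF f, of ps] tensor_lift_sum[OF bilinear_map_scale[OF f], of ps c]
    by simp
qed

lemma tens_scale: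
  "a \<in> vcar A \<Longrightarrow> b \<in> vcar B \<Longrightarrow> tensor_scale c (tens A B a b) = tens A B (vscl A c a) b"
  unfolding tensor_scale_def tens_def bilinear_form_def by auto

lemma tensor_lift_scale:
  assumes f: "bilinear_map A B sc f" and t: "t \<in> tensor_space A B"
    and cl: "\<And>a. a \<in> vcar A \<Longrightarrow> vscl A c a \<in> vcar A"
  shows "tensor_lift A B f (tensor_scale c t) = sc c (tensor_lift A B f t)"
proof -
  obtain ps where ps: "set ps \<subseteq> vcar A \<times> vcar B" "t = (\<Sum>(a, b)\<leftarrow>ps. tens A B a b)"
    using t by (rule tensor_spaceE)
  interpret vector_space sc using f unfolding bilinear_map_def by blast
  define qs where "qs = map (\<lambda>(a, b). (vscl A c a, b)) ps"
  have "tensor_scale c t = (\<Sum>(a, b)\<leftarrow>qs. tens A B a b)"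
  proof -
    have "tensor_scale c (\<Sum>(a, b)\<leftarrow>ps. tens A B a b) = (\<Sum>(a, b)\<leftarrow>ps. tensor_scale c (tens A B a b))"
      unfolding tensor_scale_def by (induction ps) (auto simp: fun_eq_iff algebra_simps)
    also have "\<dots> = (\<Sum>(a, b)\<leftarrow>qs. tens A B a b)"
      using ps(1) unfolding qs_def by (induction ps) (auto simp: tens_scale)
    finally show ?thesis using ps by simp
  qed
  moreover have "set qs \<subseteq> vcar A \<times> vcar B" using ps(1) cl unfolding qs_def by auto
  moreover have "sc c (\<Sum>(a, b)\<leftarrow>ps. f a b) = (\<Sum>(a, b)\<leftarrow>qs. f a b)"
    using ps(1) f unfolding qs_def bilinear_map_def by (induction ps) (auto simp: scale_right_distrib)
  ultimately show ?thesis
    using tensor_lift_sum[OF f, of ps] tensor_lift_sum[OF f, of qs] ps by simp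
qed

lemma vector_space_fun: "vector_space sc \<Longrightarrow> vector_space (\<lambda>c f x. sc c (f x))"
  unfolding vector_space_def by (auto simp: fun_eq_iff)

lemma vector_space_mult: "vector_space ((*) :: 'k::field \<Rightarrow> 'k \<Rightarrow> 'k)"
  by unfold_locales (auto simp: algebra_simps)

lemma vector_space_tensor_scale:
  "vector_space (tensor_scale :: 'k::field \<Rightarrow> ('k, 'a, 'b) tensor \<Rightarrow> _)"
  unfolding tensor_scale_def using vector_space_fun[OF vector_space_mult] .

lemma bilinear_map_tens: "bilinear_map A B tensor_scale (tens A B)"
  unfolding bilinear_map_def
  by (auto simp: vector_space_tensor_scale tens_def tensor_scale_def bilinear_form_def fun_eq_iff)

text \<open>
  The brackets on odd or mixed components are linear extensions in two tensor arguments at once;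
  the following facts on such iterated extensions give their biadditivity.
\<close>

definition tensor_lift2 ::
  "('k::field, 'a) vspace \<Rightarrow> ('k, 'b) vspace \<Rightarrow> ('a \<Rightarrow> 'b \<Rightarrow> 'a \<Rightarrow> 'b \<Rightarrow> 'w::ab_group_add) \<Rightarrow>
    ('k, 'a, 'b) tensor \<Rightarrow> ('k, 'a, 'b) tensor \<Rightarrow> 'w" where
  "tensor_lift2 A B F t u = tensor_lift A B (\<lambda>x x'. tensor_lift A B (F x x') u) t"

definition quadrilinear_map ::
  "('k::field, 'a) vspace \<Rightarrow> ('k, 'b) vspace \<Rightarrow> ('k \<Rightarrow> 'w::ab_group_add \<Rightarrow> 'w) \<Rightarrow>
    ('a \<Rightarrow> 'b \<Rightarrow> 'a \<Rightarrow> 'b \<Rightarrow> 'w) \<Rightarrow> bool" where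
  "quadrilinear_map A B sc F \<longleftrightarrow> vector_space sc \<and>
     (\<forall>x\<in>vcar A. \<forall>x'\<in>vcar B. bilinear_map A B sc (F x x')) \<and>
     (\<forall>y\<in>vcar A. \<forall>y'\<in>vcar B. bilinear_map A B sc (\<lambda>x x'. F x x' y y'))"

context
  fixes A :: "('k::field, 'a) vspace" and B :: "('k, 'b) vspace"
    and sc :: "'k \<Rightarrow> 'w::ab_group_add \<Rightarrow> 'w" and F :: "'a \<Rightarrow> 'b \<Rightarrow> 'a \<Rightarrow> 'b \<Rightarrow> 'w"
  assumes F: "quadrilinear_map A B sc F"
begin

lemma quadrilinear_inner: "x \<in> vcar A \<Longrightarrow> x' \<in> vcar B \<Longrightarrow> bilinear_map A B sc (F x x')"
  using F unfolding quadrilinear_map_def by blast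

lemma quadrilinear_outer:
  assumes u: "u \<in> tensor_space A B"
  shows "bilinear_map A B sc (\<lambda>x x'. tensor_lift A B (F x x') u)"
proof -
  have o: "bilinear_map A B sc (\<lambda>x x'. F x x' y y')" if "y \<in> vcar A" "y' \<in> vcar B" for y y'
    using F that unfolding quadrilinear_map_def by blast
  note i = quadrilinear_inner
  have "tensor_lift A B (F (vadd A x y) x') u = tensor_lift A B (F x x') u + tensor_lift A B (F y x') u"
    if "x \<in> vcar A" "y \<in> vcar A" "x' \<in> vcar B" for x y x'
    using tensor_lift_add_map[OF i[OF that(1,3)] i[OF that(2,3)] u] o that
    by (subst tensor_lift_cong[of A B _ "\<lambda>a b. F x x' a b + F y x' a b"]) (auto simp: bilinear_map_def)
  moreover have "tensor_lift A B (F x (vadd B x' y')) u = tensor_lift A B (F x x') u + tensor_lift A B (F x y') u"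
    if "x \<in> vcar A" "x' \<in> vcar B" "y' \<in> vcar B" for x x' y'
    using tensor_lift_add_map[OF i[OF that(1,2)] i[OF that(1,3)] u] o that
    by (subst tensor_lift_cong[of A B _ "\<lambda>a b. F x x' a b + F x y' a b"]) (auto simp: bilinear_map_def)
  moreover have "tensor_lift A B (F (vscl A c x) x') u = sc c (tensor_lift A B (F x x') u)"
    "tensor_lift A B (F x (vscl B c x')) u = sc c (tensor_lift A B (F x x') u)"
    if "x \<in> vcar A" "x' \<in> vcar B" for x x' c
    using tensor_lift_scale_map[OF i[OF that] u] o that
    by (subst tensor_lift_cong[of A B _ "\<lambda>a b. sc c (F x x' a b)"]; auto simp: bilinear_map_def)+
  ultimately show ?thesis using F unfolding bilinear_map_def quadrilinear_map_def by auto
qed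

lemma tensor_lift2_add_left:
  "s \<in> tensor_space A B \<Longrightarrow> t \<in> tensor_space A B \<Longrightarrow> u \<in> tensor_space A B \<Longrightarrow>
    tensor_lift2 A B F (s + t) u = tensor_lift2 A B F s u + tensor_lift2 A B F t u"
  unfolding tensor_lift2_def by (rule tensor_lift_add[OF quadrilinear_outer])

lemma tensor_lift2_add_right:
  assumes t: "t \<in> tensor_space A B" and u: "u \<in> tensor_space A B" "v \<in> tensor_space A B"
  shows "tensor_lift2 A B F t (u + v) = tensor_lift2 A B F t u + tensor_lift2 A B F t v"
  unfolding tensor_lift2_def
  using tensor_lift_add_map[OF quadrilinear_outer[OF u(1)] quadrilinear_outer[OF u(2)] t]
  by (subst tensor_lift_cong[of A B _ "\<lambda>x x'. tensor_lift A B (F x x') u + tensor_lift A B (F x x') v"])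
     (auto intro: tensor_lift_add[OF quadrilinear_inner] u)

lemma tensor_lift2_tens:
  assumes "x \<in> vcar A" "x' \<in> vcar B" "y \<in> vcar A" "y' \<in> vcar B"
  shows "tensor_lift2 A B F (tens A B x x') (tens A B y y') = F x x' y y'"
  unfolding tensor_lift2_def
  by (simp add: tensor_lift_tens[OF quadrilinear_outer] tensor_lift_tens[OF quadrilinear_inner]
      tensor_space_tens assms)

end

section \<open>Indices modulo 3\<close>

lemma index3_arith [simp]:
  fixes i :: 3
  shows "i + 1 \<noteq> i" "i + 2 \<noteq> i" "i + 1 \<noteq> i + 2" "i + 2 \<noteq> i + 1" "i \<noteq> i + 1" "i \<noteq> i + 2"
    "i + 1 + 1 = i + 2" "i + 1 + 2 = i" "i + 2 + 1 = i" "i + 2 + 2 = i + 1"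
  using exhaust_3[of i] by auto

lemma index3_diff [simp]:
  fixes i :: 3
  shows "i - 1 = i + 2" "i - 2 = i + 1" "i - (i + 1) = 2" "i - (i + 2) = 1"
    "i + 1 - (i + 2) = 2" "i + 2 - (i + 1) = 1"
  using exhaust_3[of i] by auto

lemma sum_index3: "(\<Sum>j\<in>UNIV. f j) = f i + f (i + 1) + f (i + 2)" for i :: 3
  proof -
  have "f 4 = f 1" "f 5 = f 2" by (rule arg_cong[of _ _ f], simp)+
  then show ?thesis using exhaust_3[of i] by (auto simp: sum_3 ac_simps)
qed

text \<open>
  Normalising sums of indices produces these numerals.
\<close>

lemma numerals_index3 [simp]: "(3::3) = 0" "(4::3) = 1" "(5::3) = 2"
  by simp_all

lemma index3_exhaust: "i = 0 \<or> i = 1 \<or> i = 2" for i :: 3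
  using exhaust_3[of i] by auto

lemma index3_cases:
  fixes i j :: 3
  obtains "j = i" | "j = i + 1" | "j = i + 2"
  using exhaust_3[of i] exhaust_3[of j] by auto

lemma char3_numerals:
  assumes "CHAR('k::field) = 3"
  shows "(3::'k) = 0" "(2::'k) = -1" "1 / (2::'k) = -1"
proof -
  show 3: "(3::'k) = 0" using of_nat_CHAR[where 'a='k] assms by simp
  show 2: "(2::'k) = -1" using 3 by (simp add: eq_neg_iff_add_eq_0)
  show "1 / (2::'k) = -1" by (simp add: 2)
qed

section \<open>Hurwitz algebras in characteristic 3\<close>

locale hurwitz_char3 =
  fixes C :: "('k::field, 'c::ab_group_add) superalg"
  assumes char3: "CHAR('k) = 3" and hurwitz: "hurwitz_algebra C"
begin

text \<open>
  Small integer coefficients are reduced to \<open>-1\<close>, \<open>0\<close>, \<open>1\<close>; in particular \<open>1/2\<close> becomes \<open>-1\<close>.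
\<close>

lemma two_char3 [simp]: "(2::'k) = -1"
  and three_char3 [simp]: "(3::'k) = 0"
  and four_char3 [simp]: "(4::'k) = 1"
proof -
  show 2: "(2::'k) = -1" and "(3::'k) = 0" using char3_numerals[OF char3] by simp_all
  have "(4::'k) = 2 * 2" by simp
  also have "\<dots> = 1" unfolding 2 by simp
  finally show "(4::'k) = 1" .
qed

abbreviation cmul (infixl "\<cdot>" 70) where "x \<cdot> y \<equiv> mul C x y"
abbreviation cscl (infixr "\<odot>" 75) where "c \<odot> x \<equiv> scl C c x"
abbreviation bf where "bf x y \<equiv> pol C x y"
abbreviation cone where "cone \<equiv> unit_elt C"
abbreviation cj where "cj x \<equiv> std_inv C x"
abbreviation S where "S \<equiv> para_hurwitz C"
abbreviation linC where "linC d \<equiv> Vector_Spaces.linear (scl C) (scl C) d"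
abbreviation pmul (infixl "\<diamondop>" 70) where "x \<diamondop> y \<equiv> mul S x y"

lemma composition: "composition_superalgebra C" and unit_ex: "\<exists>e. is_unit_elt C e"
  and odd_trivial: "homog C 1 = {0}"
  using hurwitz unfolding hurwitz_algebra_def hurwitz_superalgebra_def by auto

lemma superspace_C: "superspace C" and superalgebra_C: "superalgebra C"
  and superform_C: "quadratic_superform C" and regular_C: "regular_superform C"
  and nonzero_C: "\<exists>x::'c. x \<noteq> 0"
  using composition unfolding composition_superalgebra_def superalgebra_def by auto

sublocale vector_space "scl C"
  using superspace_C unfolding superspace_def by simp

lemma prt_C [simp]: "prt C (Suc 0) x = 0" "prt C 0 x = x"
proof -
  have "prt C 1 (prt C 1 x) = prt C 1 x" using superspace_C unfolding superspace_def by simp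
  then have "prt C 1 x \<in> homog C 1" unfolding homog_def by simp
  then show "prt C (Suc 0) x = 0" using odd_trivial by simp
  moreover have "prt C 0 x + prt C 1 x = x" using superspace_C unfolding superspace_def by simp
  ultimately show "prt C 0 x = x" by simp
qed

lemma homog_C [simp]: "homog C 0 = UNIV" "homog C (Suc 0) = {0}"
  by (auto simp: homog_def)

lemma para_simps [simp]:
  "scl S = scl C" "prt S = prt C" "pol S = pol C"
  "nrm S = nrm C"
  unfolding para_hurwitz_def by simp_all

lemma homog_para [simp]: "homog S = homog C"
  unfolding homog_def by simp

lemma para_eq: "x \<diamondop> y = cj x \<cdot> cj y"
  unfolding para_hurwitz_def by simp

lemma linear_mul: "linC (\<lambda>y. x \<cdot> y)"
    "linC (\<lambda>x. x \<cdot> y)"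
  using superalgebra_C unfolding superalgebra_def by auto

lemma linear_bf: "Vector_Spaces.linear (scl C) (*) (\<lambda>y. bf x y)"
    "Vector_Spaces.linear (scl C) (*) (\<lambda>x. bf x y)"
  using superform_C unfolding quadratic_superform_def by blast+

lemmas bilinear_simps [simp] = linear_rules[OF linear_mul(1)] linear_rules[OF linear_mul(2)]
  linear_rules[OF linear_bf(1)] linear_rules[OF linear_bf(2)]

lemma bf_sym: "bf x y = bf y x"
proof -
  have "\<forall>p<2. \<forall>q<2. \<forall>x\<in>homog C p. \<forall>y\<in>homog C q. bf x y = (-1) ^ (p * q) * bf y x"
    using superform_C unfolding quadratic_superform_def by blast
  from this[rule_format, of 0 0 x y] show ?thesis by simp
qed

lemma bf_nondegenerate: "(\<And>z. bf x z = 0) \<Longrightarrow> x = 0"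
  using regular_C unfolding regular_superform_def by (metis UNIV_I homog_C(1) zero_less_numeral)

lemma bf_eqI: "(\<And>z. bf x z = bf y z) \<Longrightarrow> x = y"
  using bf_nondegenerate[of "x - y"] by simp

lemma composition_linearized: "bf (x \<cdot> y) (z \<cdot> t) + bf (z \<cdot> y) (x \<cdot> t) = bf x z * bf y t"
proof -
  have "\<forall>p<2. \<forall>q<2. \<forall>r<2. \<forall>s<2. \<forall>x\<in>homog C p. \<forall>y\<in>homog C q. \<forall>z\<in>homog C r. \<forall>t\<in>homog C s.
        bf (x \<cdot> y) (z \<cdot> t) + (-1) ^ (p * q + p * r + q * r) * bf (z \<cdot> y) (x \<cdot> t)
          = (-1) ^ (q * r) * bf x z * bf y t"
    using composition unfolding composition_superalgebra_def by blast
  from this[rule_format, of 0 0 0 0 x y z t] show ?thesis by simp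
qed

lemma is_unit_cone: "is_unit_elt C cone"
proof -
  obtain e where e: "is_unit_elt C e" using unit_ex by blast
  have "e' = e" if "is_unit_elt C e'" for e' using e that unfolding is_unit_elt_def by metis
  then show ?thesis unfolding unit_elt_def using e by (metis theI)
qed

lemma unit_simps [simp]: "cone \<cdot> x = x" "x \<cdot> cone = x"
  using is_unit_cone unfolding is_unit_elt_def by auto

text \<open>
  The composition law at \<open>1\<close> reads \<open>2 b(1,1) = b(1,1)\<^sup>2\<close>, and \<open>b(1,1) = 0\<close> would make the form vanish.
\<close>

lemma bf_cone [simp]: "bf cone cone = -1"
proof (rule ccontr)
  assume n: "bf cone cone \<noteq> -1"
  have "bf cone cone + bf cone cone = bf cone cone * bf cone cone"
    using composition_linearized[of cone cone cone cone] by simp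
  then have "bf cone cone * (bf cone cone - 2) = 0" by (simp only: right_diff_distrib flip: mult_2) simp
  then have "bf cone cone = 0" using n by (simp add: eq_neg_iff_add_eq_0)
  then have "bf x y + bf x y = 0" for x y using composition_linearized[of cone x cone y] by simp
  then have "bf x y = 0" for x y by (simp flip: mult_2)
  then show False using bf_nondegenerate nonzero_C by blast
qed

lemma cone_nonzero [simp]: "cone \<noteq> 0"
  using bf_cone by fastforce

lemma cj_eq: "cj x = bf x cone \<odot> cone - x"
  by (simp add: std_inv_def)

lemma linear_cj: "linC cj"
  unfolding Vector_Spaces.linear_iff
  using vector_space_axioms by (auto simp: cj_eq algebra_simps)

lemmas cj_linear [simp] = linear_rules[OF linear_cj]

lemma bf_cj_cone [simp]: "bf (cj x) cone = bf x cone"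
  by (simp add: cj_eq flip: mult_2)

lemma cj_cj [simp]: "cj (cj x) = x"
  unfolding cj_eq[of "cj x"] bf_cj_cone by (simp add: cj_eq)

lemma cj_cone [simp]: "cj cone = cone"
proof -
  have "cj cone = -(cone + cone)" by (simp add: cj_eq)
  also have "cone + cone = 2 \<odot> cone" by (simp only: scale_left_distrib[of 1 1] flip: one_add_one) simp
  finally show ?thesis by simp
qed

lemma bf_cj [simp]: "bf (cj x) (cj y) = bf x y"
  by (simp add: cj_eq bf_sym[of cone y] algebra_simps)

lemma bf_cj_left: "bf (cj x) y = bf x (cj y)"
  using bf_cj[of "cj x" y] by simp

text \<open>
  Multiplication by \<open>x\<close> has multiplication by the conjugate of \<open>x\<close> as its adjoint: put \<open>1\<close> for one of the
  four factors of the composition law.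
\<close>

lemma adjoint_left: "bf (x \<cdot> y) z = bf y (cj x \<cdot> z)"
  using composition_linearized[of x y cone z] by (simp add: cj_eq algebra_simps)

lemma adjoint_right: "bf (x \<cdot> y) z = bf x (z \<cdot> cj y)"
  using composition_linearized[of x y z cone] by (simp add: cj_eq algebra_simps bf_sym[of "z \<cdot> y"])

lemma cj_mul: "cj (x \<cdot> y) = cj y \<cdot> cj x"
proof (rule bf_eqI)
  fix z
  have "bf (cj (x \<cdot> y)) z = bf x (cj z \<cdot> cj y)" by (simp add: bf_cj_left adjoint_right)
  moreover have "bf (z \<cdot> (x \<cdot> y)) cone = bf ((z \<cdot> x) \<cdot> y) cone"
    using adjoint_left[of z "x \<cdot> y" cone] adjoint_right[of x y "cj z"]
      adjoint_right[of "z \<cdot> x" y cone] adjoint_left[of z x "cj y"] by simp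
  moreover have "bf (cj (x \<cdot> y)) z = bf (z \<cdot> (x \<cdot> y)) cone"
    using adjoint_left[of z "x \<cdot> y" cone] by (simp add: bf_cj_left)
  moreover have "bf ((z \<cdot> x) \<cdot> y) cone = bf (cj y \<cdot> cj x) z"
    using adjoint_right[of "z \<cdot> x" y cone] adjoint_right[of z x "cj y"] by (simp add: bf_sym)
  ultimately show "bf (cj (x \<cdot> y)) z = bf (cj y \<cdot> cj x) z" by simp
qed

lemma linear_para: "linC (\<lambda>y. x \<diamondop> y)"
    "linC (\<lambda>x. x \<diamondop> y)"
  unfolding Vector_Spaces.linear_iff using vector_space_axioms by (auto simp: para_eq)

lemmas para_linear [simp] = linear_rules[OF linear_para(1)] linear_rules[OF linear_para(2)]

text \<open>
  The para-Hurwitz product is that of a symmetric composition algebra: the polar form is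
  associative, and the norm multiplicative in the strong form of the two identities below. Once the matrix
  product of \<open>J\<close> is written in coordinates, the product enters only through these three facts.
\<close>

lemma para_assoc: "bf (x \<diamondop> y) z = bf x (y \<diamondop> z)"
  unfolding para_eq by (simp add: adjoint_right bf_cj_left cj_mul)

lemma para_left: "(x \<diamondop> y) \<diamondop> z + (z \<diamondop> y) \<diamondop> x = bf x z \<odot> y"
proof (rule bf_eqI)
  fix w
  show "bf ((x \<diamondop> y) \<diamondop> z + (z \<diamondop> y) \<diamondop> x) w = bf (bf x z \<odot> y) w"
    using composition_linearized[of y x w z]
    by (simp add: para_eq cj_mul adjoint_right[of "y \<cdot> x"] adjoint_right[of "y \<cdot> z"] bf_sym[of "w \<cdot> x"] mult.commute)
qed

lemma para_right: "x \<diamondop> (y \<diamondop> z) + z \<diamondop> (y \<diamondop> x) = bf x z \<odot> y"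
proof (rule bf_eqI)
  fix w
  show "bf (x \<diamondop> (y \<diamondop> z) + z \<diamondop> (y \<diamondop> x)) w = bf (bf x z \<odot> y) w"
    using composition_linearized[of z y x w]
    by (simp add: para_eq cj_mul adjoint_left[of "cj x"] adjoint_left[of "cj z"] bf_sym[of z x])
qed

lemma para_comp: "bf (y \<diamondop> u) (x \<diamondop> v) + bf (x \<diamondop> u) (y \<diamondop> v) = bf x y * bf u v"
  using composition_linearized[of "cj y" "cj u" "cj x" "cj v"] by (simp add: para_eq bf_sym[of y x])

text \<open>
  Rewrite rules that reduce coefficients modulo 3 where no numerals are available.
\<close>

lemma double_k: "x + x = - x" "x + (x + y) = y - x" for x y :: 'k
proof -
  show "x + x = - x" using mult_2[of x] by simp
  then show "x + (x + y) = y - x" by (simp flip: add.assoc)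
qed

lemma double_char3: "x + x = - x" "x + (x + y) = y - x" for x y :: 'c
proof -
  have "x + x = 2 \<odot> x" by (simp only: scale_left_distrib[of 1 1] flip: one_add_one) simp
  then show "x + x = - x" by simp
  then show "x + (x + y) = y - x" by (simp flip: add.assoc)
qed

text \<open>
  Normalisation of sums of scalars and of vectors, without touching sums of indices.
\<close>

lemmas kc_simps = scale_right_distrib scale_left_distrib scale_right_diff_distrib scale_left_diff_distrib
  add.assoc[where 'a='c] add.commute[where 'a='c] add.left_commute[where 'a='c]
  diff_diff_eq[where 'a='c] add_diff_eq[where 'a='c] diff_diff_eq2[where 'a='c] diff_add_eq[where 'a='c]
  diff_eq_eq[where 'a='c] eq_diff_eq[where 'a='c]
  add.assoc[where 'a='k] add.commute[where 'a='k] add.left_commute[where 'a='k]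
  diff_diff_eq[where 'a='k] add_diff_eq[where 'a='k] diff_diff_eq2[where 'a='k] diff_add_eq[where 'a='k]
  diff_eq_eq[where 'a='k] eq_diff_eq[where 'a='k]
  mult.assoc[where 'a='k] mult.commute[where 'a='k] mult.left_commute[where 'a='k]
  distrib_left[where 'a='k] distrib_right[where 'a='k]
  left_diff_distrib[where 'a='k] right_diff_distrib[where 'a='k]

subsection \<open>Triality\<close>

text \<open>
  The related triples of \<open>S\<close>, with the identity required at all three indices;
  by \<open>triality_shift\<close> the identity at one index implies the others.
\<close>

definition triality :: "'c triple \<Rightarrow> bool" where
  "triality d \<longleftrightarrow> (\<forall>i. linC (d i)) \<and>
     (\<forall>i x y. bf (d i x) y = - bf x (d i y)) \<and>
     (\<forall>i x y. d i (x \<diamondop> y) = d (i + 1) x \<diamondop> y + x \<diamondop> d (i + 2) y)"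

lemma sum_lessThan_2: "(\<Sum>r<2. f r) = f 0 + f (Suc 0)" for f :: "nat \<Rightarrow> 'w::comm_monoid_add"
  by (simp add: numeral_2_eq_2)

lemma osp_even: "d \<in> osp_homog S 0 \<longleftrightarrow>
    linC d \<and> (\<forall>x y. bf (d x) y = - bf x (d y))"
  unfolding osp_homog_def by (auto simp: less_2_cases_iff linear_rules eq_neg_iff_add_eq_0)

lemma osp_odd: "osp_homog S (Suc 0) = {0}"
proof -
  have "linC (0 :: 'c \<Rightarrow> 'c)"
    unfolding Vector_Spaces.linear_iff using vector_space_axioms by auto
  then show ?thesis unfolding osp_homog_def by (auto simp: less_2_cases_iff fun_eq_iff)
qed

text \<open>
  Pairing the identity with a third vector and moving the operators across the form
  cyclically permutes the three operators.
\<close>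

lemma triality_shift:
  assumes skew: "\<And>i x y. bf (d i x) y = - bf x (d i y)"
    and tri: "\<And>x y. d i (x \<diamondop> y) = d (i + 1) x \<diamondop> y + x \<diamondop> d (i + 2) y"
  shows "d (i + 1) (y \<diamondop> z) = d (i + 2) y \<diamondop> z + y \<diamondop> d i z"
proof (rule bf_eqI)
  fix x
  have "bf (d (i + 1) (y \<diamondop> z)) x = - bf (d (i + 1) x) (y \<diamondop> z)"
    using skew[of "i + 1" x "y \<diamondop> z"] by (simp add: bf_sym)
  also have "\<dots> = - bf (d (i + 1) x \<diamondop> y) z" by (simp add: para_assoc)
  also have "\<dots> = bf (x \<diamondop> d (i + 2) y) z - bf (d i (x \<diamondop> y)) z" by (simp add: tri)
  also have "\<dots> = bf x (d (i + 2) y \<diamondop> z) + bf x (y \<diamondop> d i z)" by (simp add: skew para_assoc)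
  finally show "bf (d (i + 1) (y \<diamondop> z)) x = bf (d (i + 2) y \<diamondop> z + y \<diamondop> d i z) x"
    by (simp add: bf_sym[of x])
qed

lemma trialityI:
  assumes lin: "\<And>i. linC (d i)"
    and skew: "\<And>i x y. bf (d i x) y = - bf x (d i y)"
    and tri: "\<And>x y. d 0 (x \<diamondop> y) = d 1 x \<diamondop> y + x \<diamondop> d 2 y"
  shows "triality d"
proof -
  have 1: "d 1 (y \<diamondop> z) = d 2 y \<diamondop> z + y \<diamondop> d 0 z" for y z
    using triality_shift[of d 0, OF skew] tri by simp
  have idx: "(1 + 1 :: 3) = 2" "(1 + 2 :: 3) = 0" "(2 + 1 :: 3) = 0" "(2 + 2 :: 3) = 1" by simp_all
  have 2: "d 2 (y \<diamondop> z) = d 0 y \<diamondop> z + y \<diamondop> d 1 z" for y z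
    using triality_shift[of d 1, OF skew] 1 unfolding idx by blast
  have "d i (x \<diamondop> y) = d (i + 1) x \<diamondop> y + x \<diamondop> d (i + 2) y" for i x y
    using index3_exhaust[of i]
  proof (elim disjE)
    assume "i = 0" then show ?thesis using tri by simp
  next
    assume i: "i = 1" show ?thesis unfolding i idx by (rule 1)
  next
    assume i: "i = 2" show ?thesis unfolding i idx by (rule 2)
  qed
  then show ?thesis unfolding triality_def using lin skew by blast
qed

lemma tri_homog_even: "tri_homog S 0 = {d. triality d}"
proof -
  have "triality d" if "d \<in> tri_homog S 0" for d
    using that unfolding tri_homog_def osp_even mem_Collect_eq
    by (intro trialityI) (auto simp: less_2_cases_iff)
  moreover have "d \<in> tri_homog S 0" if "triality d" for d
    using that unfolding tri_homog_def osp_even mem_Collect_eq triality_def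
    by (force simp: less_2_cases_iff linear_rules)
  ultimately show ?thesis by blast
qed

lemma tri_homog_odd: "tri_homog S (Suc 0) = {0}"
  unfolding tri_homog_def osp_odd by (auto simp: fun_eq_iff)

lemma tri_para: "tri S = {d. triality d}"
  unfolding tri_def using tri_homog_even tri_homog_odd by simp

lemma triality_linear: "triality d \<Longrightarrow> linC (d i)"
  and triality_skew: "triality d \<Longrightarrow> bf (d i x) y = - bf x (d i y)"
  and triality_mul: "triality d \<Longrightarrow> d i (x \<diamondop> y) = d (i + 1) x \<diamondop> y + x \<diamondop> d (i + 2) y"
  unfolding triality_def by blast+

lemmas triality_rules = linear_rules[OF triality_linear]

lemma triality_0: "triality 0"
  unfolding triality_def by (auto simp: Vector_Spaces.linear_iff vector_space_axioms)

lemma triality_add: "triality d \<Longrightarrow> triality e \<Longrightarrow> triality (d + e)"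
  unfolding triality_def Vector_Spaces.linear_iff by (auto simp: algebra_simps)

lemma triality_scale: "triality d \<Longrightarrow> triality (\<lambda>i x. c \<odot> d i x)"
  unfolding triality_def Vector_Spaces.linear_iff by (auto simp: algebra_simps)

lemma triality_commutator: "triality d \<Longrightarrow> triality e \<Longrightarrow> triality (\<lambda>i x. d i (e i x) - e i (d i x))"
  unfolding triality_def Vector_Spaces.linear_iff by (auto simp: algebra_simps)

lemma triality_theta: "triality d \<Longrightarrow> triality (theta_pow i d)"
  unfolding triality_def theta_pow_def by (auto simp: diff_add_eq[symmetric])

lemma tri_elt_simps:
  "tri_elt S x y 0 z = bf x z \<odot> y - bf y z \<odot> x"
  "tri_elt S x y 1 z = - bf x y \<odot> z - (y \<diamondop> z) \<diamondop> x"
  "tri_elt S x y 2 z = - bf x y \<odot> z - x \<diamondop> (z \<diamondop> y)"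
  unfolding tri_elt_def sigma_def rgt_def lft_def by (simp_all add: sum_lessThan_2)

text \<open>
  The triality identity for \<open>t\<^sub>x\<^sub>,\<^sub>y\<close> follows by moving the three factors of
  \<open>u \<diamondop> (x \<diamondop> (v \<diamondop> y))\<close> past each other with the two composition identities until
  \<open>((y \<diamondop> u) \<diamondop> x) \<diamondop> v\<close> appears.
\<close>

lemma triality_tri_elt: "triality (tri_elt S x y)"
proof (rule trialityI)
  fix i
  show "linC (tri_elt S x y i)"
    using index3_exhaust[of i] vector_space_axioms
    by (auto simp: Vector_Spaces.linear_iff tri_elt_simps algebra_simps)
  fix u v
  have 1: "bf ((y \<diamondop> u) \<diamondop> x) v = bf (y \<diamondop> u) (x \<diamondop> v)" for u v by (simp add: para_assoc)
  have 2: "bf (x \<diamondop> (u \<diamondop> y)) v = bf (u \<diamondop> y) (v \<diamondop> x)" for u v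
    using para_assoc[of v x "u \<diamondop> y"] by (simp add: bf_sym)
  show "bf (tri_elt S x y i u) v = - bf u (tri_elt S x y i v)"
    using index3_exhaust[of i]
  proof (elim disjE)
    assume i: "i = 0"
    show ?thesis unfolding i
      by (simp add: tri_elt_simps bf_sym[of u x] bf_sym[of u y] mult.commute)
  next
    assume i: "i = 1"
    have "bf (tri_elt S x y 1 u) v = - (bf x y * bf u v) - bf (y \<diamondop> u) (x \<diamondop> v)"
      by (simp add: tri_elt_simps 1)
    moreover have "bf u (tri_elt S x y 1 v) = - (bf x y * bf u v) - bf (x \<diamondop> u) (y \<diamondop> v)"
      using 1[of v u] by (simp add: tri_elt_simps bf_sym[of u "_ \<diamondop> _"] bf_sym[of "x \<diamondop> u"])
    ultimately show ?thesis unfolding i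
      using para_comp[of y u x v] double_k(1)[of "bf x y * bf u v"] by algebra
  next
    assume i: "i = 2"
    have "bf (tri_elt S x y 2 u) v = - (bf x y * bf u v) - bf (u \<diamondop> y) (v \<diamondop> x)"
      by (simp add: tri_elt_simps 2)
    moreover have "bf u (tri_elt S x y 2 v) = - (bf x y * bf u v) - bf (v \<diamondop> y) (u \<diamondop> x)"
      using 2[of v u] by (simp add: tri_elt_simps bf_sym[of u "_ \<diamondop> _"])
    ultimately show ?thesis unfolding i
      using para_comp[of u y v x] bf_sym[of y x] bf_sym[of v u] double_k(1)[of "bf x y * bf u v"] by algebra
  qed
next
  fix u v
  \<comment> \<open>These rewrite \<open>u \<diamondop> (x \<diamondop> (v \<diamondop> y))\<close> to \<open>((y \<diamondop> u) \<diamondop> x) \<diamondop> v\<close> and terms with a factor \<open>b\<close>.\<close>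
  have 1: "u \<diamondop> (x \<diamondop> (v \<diamondop> y)) = bf u (v \<diamondop> y) \<odot> x - (v \<diamondop> y) \<diamondop> (x \<diamondop> u)"
    using para_right[of u x "v \<diamondop> y"] by (simp add: eq_diff_eq)
  have 2: "(v \<diamondop> y) \<diamondop> (x \<diamondop> u) = bf v (x \<diamondop> u) \<odot> y - ((x \<diamondop> u) \<diamondop> y) \<diamondop> v"
    using para_left[of v y "x \<diamondop> u"] by (simp add: eq_diff_eq)
  have 3: "(x \<diamondop> u) \<diamondop> y = bf x y \<odot> u - (y \<diamondop> u) \<diamondop> x"
    using para_left[of x u y] by (simp add: eq_diff_eq)
  have 4: "bf u (v \<diamondop> y) = bf y (u \<diamondop> v)" "bf v (x \<diamondop> u) = bf x (u \<diamondop> v)"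
    using para_assoc[of u v y] para_assoc[of v x u] para_assoc[of x u v] bf_sym by metis+
  show "tri_elt S x y 0 (u \<diamondop> v) =
      tri_elt S x y 1 u \<diamondop> v + u \<diamondop> tri_elt S x y 2 v"
    by (simp add: tri_elt_simps 1 2 3 4 algebra_simps double_char3)
qed

lemma endo_prt_C: "d 0 = 0 \<Longrightarrow> endo_prt S p d = (if p = 0 then d else if p = Suc 0 then 0 else endo_prt S p d)"
  unfolding endo_prt_def by (auto simp: sum_lessThan_2 fun_eq_iff)

section \<open>The Jordan algebra in coordinates\<close>

text \<open>
  \<open>jel \<alpha> a\<close> is \<open>\<Sum>\<alpha>\<^sub>i e\<^sub>i + \<Sum>\<iota>\<^sub>i(a\<^sub>i)\<close>. The idempotent \<open>e\<^sub>i\<close> sits at position \<open>(i + 1, i + 1)\<close>, and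
  \<open>\<iota>\<^sub>i(a)\<close> has \<open>2a = -a\<close> at \<open>(i, i + 2)\<close> and its conjugate at \<open>(i + 2, i)\<close>, uniformly in \<open>i\<close>.
\<close>

definition jel :: "(3 \<Rightarrow> 'k) \<Rightarrow> (3 \<Rightarrow> 'c) \<Rightarrow> 'c^3^3" where
  "jel \<alpha> a = (\<chi> r s. if s = r then \<alpha> (r + 2) \<odot> cone else if s = r + 2 then - a r else - cj (a s))"

abbreviation single :: "3 \<Rightarrow> 'w \<Rightarrow> 3 \<Rightarrow> 'w::zero" where
  "single i w \<equiv> (\<lambda>j. if j = i then w else 0)"

abbreviation idem where "idem i \<equiv> jel (single i 1) (\<lambda>_. 0)"
abbreviation off where "off i s \<equiv> jel (\<lambda>_. 0) (single i s)"

lemma jel_entries [simp]: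
  "jel \<alpha> a $ r $ r = \<alpha> (r + 2) \<odot> cone" "jel \<alpha> a $ r $ (r + 2) = - a r" "jel \<alpha> a $ r $ (r + 1) = - cj (a (r + 1))"
  "jel \<alpha> a $ (r + 2) $ r = - cj (a r)" "jel \<alpha> a $ (r + 1) $ r = - a (r + 1)"
  "jel \<alpha> a $ (r + 1) $ (r + 2) = - cj (a (r + 2))" "jel \<alpha> a $ (r + 2) $ (r + 1) = - a (r + 2)"
  unfolding jel_def by simp_all

lemma mat_eqI:
  fixes x y :: "'c^3^3"
  assumes "\<And>r. x $ r $ r = y $ r $ r" "\<And>r. x $ r $ (r + 1) = y $ r $ (r + 1)" "\<And>r. x $ r $ (r + 2) = y $ r $ (r + 2)"
  shows "x = y"
  unfolding vec_eq_iff
proof (intro allI)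
  fix r s :: 3
  show "x $ r $ s = y $ r $ s" using assms by (cases rule: index3_cases[of s r]) auto
qed

lemma jel_inject: "jel \<alpha> a = jel \<beta> b \<longleftrightarrow> \<alpha> = \<beta> \<and> a = b"
proof
  assume eq: "jel \<alpha> a = jel \<beta> b"
  have "\<alpha> i = \<beta> i" for i
    using arg_cong[OF eq, of "\<lambda>x. x $ (i + 1) $ (i + 1)"] by simp
  moreover have "a i = b i" for i using arg_cong[OF eq, of "\<lambda>x. x $ i $ (i + 2)"] by simp
  ultimately show "\<alpha> = \<beta> \<and> a = b" by (auto simp: fun_eq_iff)
qed simp

lemma jel_add: "jel \<alpha> a + jel \<beta> b = jel (\<lambda>i. \<alpha> i + \<beta> i) (\<lambda>i. a i + b i)"
  by (rule mat_eqI) (simp_all add: kc_simps)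

lemma jel_scale: "mat_scale C c (jel \<alpha> a) = jel (\<lambda>i. c * \<alpha> i) (\<lambda>i. c \<odot> a i)"
  by (rule mat_eqI) (simp_all add: mat_scale_def kc_simps)

lemma jel_0: "jel (\<lambda>_. 0) (\<lambda>_. 0) = 0"
  by (rule mat_eqI) simp_all

lemma jel_diff: "jel \<alpha> a - jel \<beta> b = jel (\<lambda>i. \<alpha> i - \<beta> i) (\<lambda>i. a i - b i)"
  by (rule mat_eqI) (simp_all add: kc_simps)

lemma self_conjugate: "cj x = x \<Longrightarrow> x = (- bf x cone) \<odot> cone"
  using double_char3(1)[of x] by (simp add: cj_eq diff_eq_eq)

lemma jordan_iff: "x \<in> jordan C \<longleftrightarrow> (\<exists>\<alpha> a. x = jel \<alpha> a)"
proof
  assume "x \<in> jordan C"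
  then have st: "mat_star C x = x" unfolding jordan_def by simp
  have x: "cj (x $ s $ r) = x $ r $ s" for r s
    using arg_cong[OF st, of "\<lambda>x. x $ r $ s"] by (simp add: mat_star_def)
  have "x = jel (\<lambda>i. - bf (x $ (i + 1) $ (i + 1)) cone) (\<lambda>i. - x $ i $ (i + 2))"
    using x self_conjugate[OF x] by (intro mat_eqI) auto
  then show "\<exists>\<alpha> a. x = jel \<alpha> a" by blast
next
  assume "\<exists>\<alpha> a. x = jel \<alpha> a"
  then show "x \<in> jordan C"
    unfolding jordan_def mat_star_def by (auto intro!: mat_eqI)
qed

lemma jel_in_jordan [simp]: "jel \<alpha> a \<in> jordan C"
  using jordan_iff by blast

lemma cj_mul_sym: "cj x \<cdot> y + cj y \<cdot> x = bf x y \<odot> cone"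
  using para_left[of "cj x" cone "cj y"] para_right[of x cone y]
  by (simp add: para_eq cj_mul)

lemma mul_cj_sym: "x \<cdot> cj y + y \<cdot> cj x = bf x y \<odot> cone"
  using cj_mul_sym[of "cj x" "cj y"] by simp

text \<open>
  The coordinates of the Jordan product, from the rules \<open>e\<^sub>i \<circ> \<iota>\<^sub>i(a) = 0\<close>,
  \<open>e\<^sub>i \<circ> \<iota>\<^sub>j(a) = 1/2 \<iota>\<^sub>j(a)\<close> for \<open>j \<noteq> i\<close>, \<open>\<iota>\<^sub>i(a) \<circ> \<iota>\<^sub>i\<^sub>+\<^sub>1(b) = \<iota>\<^sub>i\<^sub>+\<^sub>2(a \<diamondop> b)\<close> and
  \<open>\<iota>\<^sub>i(a) \<circ> \<iota>\<^sub>i(b) = 2 b(a, b) (e\<^sub>i\<^sub>+\<^sub>1 + e\<^sub>i\<^sub>+\<^sub>2)\<close>, where \<open>1/2 = 2 = -1\<close>.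
\<close>

definition jprod_diag :: "(3 \<Rightarrow> 'k) \<Rightarrow> (3 \<Rightarrow> 'c) \<Rightarrow> (3 \<Rightarrow> 'k) \<Rightarrow> (3 \<Rightarrow> 'c) \<Rightarrow> 3 \<Rightarrow> 'k" where
  "jprod_diag \<alpha> a \<beta> b = (\<lambda>i. \<alpha> i * \<beta> i - bf (a (i + 1)) (b (i + 1)) - bf (a (i + 2)) (b (i + 2)))"

definition jprod_off :: "(3 \<Rightarrow> 'k) \<Rightarrow> (3 \<Rightarrow> 'c) \<Rightarrow> (3 \<Rightarrow> 'k) \<Rightarrow> (3 \<Rightarrow> 'c) \<Rightarrow> 3 \<Rightarrow> 'c" where
  "jprod_off \<alpha> a \<beta> b = (\<lambda>i. a (i + 1) \<diamondop> b (i + 2) + b (i + 1) \<diamondop> a (i + 2)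
     - (\<alpha> (i + 1) + \<alpha> (i + 2)) \<odot> b i - (\<beta> (i + 1) + \<beta> (i + 2)) \<odot> a i)"

lemma jmul_jel: "jmul C (jel \<alpha> a) (jel \<beta> b) = jel (jprod_diag \<alpha> a \<beta> b) (jprod_off \<alpha> a \<beta> b)"
proof (rule mat_eqI)
  fix r :: 3
  have d: "cj (a s) \<cdot> b s + cj (b s) \<cdot> a s = bf (a s) (b s) \<odot> cone"
    "a s \<cdot> cj (b s) + b s \<cdot> cj (a s) = bf (a s) (b s) \<odot> cone" for s
    by (rule cj_mul_sym mul_cj_sym)+
  have "jmul C (jel \<alpha> a) (jel \<beta> b) $ r $ r =
     - ((\<alpha> (r + 2) * \<beta> (r + 2)) \<odot> cone + (\<alpha> (r + 2) * \<beta> (r + 2)) \<odot> cone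
        + (cj (a (r + 1)) \<cdot> b (r + 1) + cj (b (r + 1)) \<cdot> a (r + 1))
        + (a r \<cdot> cj (b r) + b r \<cdot> cj (a r)))"
    by (simp add: jmul_def mat_scale_def mat_mul_def sum_index3[of _ r] kc_simps)
  then show "jmul C (jel \<alpha> a) (jel \<beta> b) $ r $ r = jel (jprod_diag \<alpha> a \<beta> b) (jprod_off \<alpha> a \<beta> b) $ r $ r"
    unfolding d by (simp add: jprod_diag_def double_char3 kc_simps)
  show "jmul C (jel \<alpha> a) (jel \<beta> b) $ r $ (r + 2) = jel (jprod_diag \<alpha> a \<beta> b) (jprod_off \<alpha> a \<beta> b) $ r $ (r + 2)"
    by (simp add: jmul_def mat_scale_def mat_mul_def sum_index3[of _ r] jprod_off_def para_eq kc_simps)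
  show "jmul C (jel \<alpha> a) (jel \<beta> b) $ r $ (r + 1) = jel (jprod_diag \<alpha> a \<beta> b) (jprod_off \<alpha> a \<beta> b) $ r $ (r + 1)"
    by (simp add: jmul_def mat_scale_def mat_mul_def sum_index3[of _ r] jprod_off_def para_eq cj_mul kc_simps)
qed

lemma je_jel: "je C i = idem i"
  unfolding je_def E_def by (rule mat_eqI) auto

lemma jiota_jel: "jiota C i a = off i a"
proof -
  have e: "(2::3) \<noteq> 0" "(1::3) \<noteq> 0" "(2::3) \<noteq> 1" by simp_all
  show ?thesis
    unfolding vec_eq_iff jiota_def E_def mat_scale_def jel_def
    using index3_exhaust[of i] by (simp add: forall_3 e) (elim disjE; simp)
qed

lemma jone_jel: "jone C = jel (\<lambda>_. 1) (\<lambda>_. 0)"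
proof -
  have "jone C = jel (\<lambda>j. if j = 0 \<or> j = 1 \<or> j = 2 then 1 else 0) (\<lambda>_. 0)"
    unfolding jone_def je_jel sum_index3[of _ 0] jel_add jel_inject by auto
  then show ?thesis using index3_exhaust by simp
qed

lemma jtrace_jel: "jtrace C (jel \<alpha> a) = (\<Sum>i\<in>UNIV. \<alpha> i)"
proof -
  have "(\<Sum>i\<in>UNIV. jel \<alpha> a $ i $ i) = (\<Sum>i\<in>UNIV. \<alpha> i) \<odot> cone"
    by (simp add: sum_index3[of _ 0] kc_simps)
  then show ?thesis unfolding jtrace_def by (intro the_equality) auto
qed

lemma jcoord_jel [simp]: "jcoord C i (jel \<alpha> a) = a i"
  unfolding jcoord_def by simp

lemma jordan0_jel: "jel \<alpha> a \<in> jordan0 C \<longleftrightarrow> (\<Sum>i\<in>UNIV. \<alpha> i) = 0"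
  unfolding jordan0_def by (simp add: jtrace_jel)

subsection \<open>The derivations of the Jordan algebra\<close>

text \<open>
  The image of \<open>d + \<Sum>\<iota>\<^sub>i(1 \<otimes> a\<^sub>i)\<close> under the map \<open>\<Phi>\<close> from \<open>g(S\<^sub>1, S)\<close> to the derivations of \<open>J\<close>.
\<close>

definition Phi :: "'c triple \<Rightarrow> (3 \<Rightarrow> 'c) \<Rightarrow> 'c^3^3 \<Rightarrow> 'c^3^3" where
  "Phi d a = D_tri C d + (\<Sum>i\<in>UNIV. D_iota C i (a i))"

lemma D_tri_jel: "D_tri C d (jel \<beta> b) = jel (\<lambda>_. 0) (\<lambda>i. d i (b i))"
proof -
  have "D_tri C d (jel \<beta> b) = jel (\<lambda>_. 0) (\<lambda>j. if j = 0 then d 0 (b 0) else if j = 1 then d 1 (b 1) else if j = 2 then d 2 (b 2) else 0)"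
    unfolding D_tri_def by (simp add: jiota_jel sum_index3[of _ 0] jel_add jel_inject fun_eq_iff)
  also have "\<dots> = jel (\<lambda>_. 0) (\<lambda>i. d i (b i))"
    unfolding jel_inject fun_eq_iff using index3_exhaust by auto
  finally show ?thesis .
qed

lemma D_iota_jel:
  "D_iota C i a (jel \<beta> b) = jel (\<lambda>j. if j = i + 1 then bf a (b i) else if j = i + 2 then - bf a (b i) else 0)
     (\<lambda>j. if j = i then (\<beta> (i + 2) - \<beta> (i + 1)) \<odot> a else if j = i + 1 then b (i + 2) \<diamondop> a else - (a \<diamondop> b (i + 1)))"
  (is "_ = jel ?g ?c")
proof -
  have "D_iota C i a (jel \<beta> b) = mat_scale C 2 (jmul C (jiota C i a) (jmul C (je C (i + 1)) (jel \<beta> b))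
      - jmul C (je C (i + 1)) (jmul C (jiota C i a) (jel \<beta> b)))"
    unfolding D_iota_def commutator_def jL_def by (simp add: jmul_jel jiota_jel je_jel)
  also have "\<dots> = jel ?g ?c"
    unfolding jmul_jel jiota_jel je_jel jel_diff jel_scale jel_inject
  proof (intro conjI ext)
    fix j
    show "2 * (jprod_diag (\<lambda>_. 0) (single i a) (jprod_diag (single (i + 1) 1) (\<lambda>_. 0) \<beta> b) (jprod_off (single (i + 1) 1) (\<lambda>_. 0) \<beta> b) j
      - jprod_diag (single (i + 1) 1) (\<lambda>_. 0) (jprod_diag (\<lambda>_. 0) (single i a) \<beta> b) (jprod_off (\<lambda>_. 0) (single i a) \<beta> b) j) = ?g j"
      by (cases rule: index3_cases[of j i]) (simp_all add: jprod_diag_def jprod_off_def double_k double_char3)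
    show "2 \<odot> (jprod_off (\<lambda>_. 0) (single i a) (jprod_diag (single (i + 1) 1) (\<lambda>_. 0) \<beta> b) (jprod_off (single (i + 1) 1) (\<lambda>_. 0) \<beta> b) j
      - jprod_off (single (i + 1) 1) (\<lambda>_. 0) (jprod_diag (\<lambda>_. 0) (single i a) \<beta> b) (jprod_off (\<lambda>_. 0) (single i a) \<beta> b) j) = ?c j"
      by (cases rule: index3_cases[of j i]) (simp_all add: jprod_diag_def jprod_off_def double_k double_char3 kc_simps)
  qed
  finally show ?thesis .
qed

text \<open>
  The coordinates of \<open>\<Phi>(d, a)\<close> applied to \<open>jel \<beta> b\<close>.
\<close>

definition Phi_diag :: "(3 \<Rightarrow> 'c) \<Rightarrow> (3 \<Rightarrow> 'c) \<Rightarrow> 3 \<Rightarrow> 'k" where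
  "Phi_diag a b = (\<lambda>j. bf (a (j + 2)) (b (j + 2)) - bf (a (j + 1)) (b (j + 1)))"

definition Phi_off :: "'c triple \<Rightarrow> (3 \<Rightarrow> 'c) \<Rightarrow> (3 \<Rightarrow> 'k) \<Rightarrow> (3 \<Rightarrow> 'c) \<Rightarrow> 3 \<Rightarrow> 'c" where
  "Phi_off d a \<beta> b = (\<lambda>j. d j (b j) + (\<beta> (j + 2) - \<beta> (j + 1)) \<odot> a j - a (j + 1) \<diamondop> b (j + 2) + b (j + 1) \<diamondop> a (j + 2))"

lemma Phi_jel: "Phi d a (jel \<beta> b) = jel (Phi_diag a b) (Phi_off d a \<beta> b)"
  unfolding Phi_def plus_fun_apply sum_index3[of _ 0] D_tri_jel D_iota_jel jel_add jel_inject
    Phi_diag_def Phi_off_def fun_eq_iff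
proof (intro conjI allI, goal_cases)
  case (1 j)
  show ?case using index3_exhaust[of j] by (elim disjE) (simp_all add: kc_simps)
next
  case (2 j)
  show ?case using index3_exhaust[of j] by (elim disjE) (simp_all add: kc_simps)
qed

lemma Phi_outside: "x \<notin> jordan C \<Longrightarrow> Phi d a x = 0"
proof -
  assume x: "x \<notin> jordan C"
  have "jel (\<lambda>_. 0) (\<lambda>_. 0) = (0 :: 'c^3^3)" by (rule jel_0)
  have z: "jmul C (jel \<alpha> a) 0 = 0" for \<alpha> a
    by (simp add: jmul_jel jel_inject jprod_diag_def jprod_off_def flip: jel_0)
  show ?thesis
    using x unfolding Phi_def sum_index3[of _ 0] plus_fun_apply D_tri_def D_iota_def commutator_def jL_def
    by (simp add: jiota_jel je_jel z) (simp add: mat_scale_def vec_eq_iff)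
qed

lemma jordanE: "x \<in> jordan C \<Longrightarrow> (\<And>\<alpha> a. x = jel \<alpha> a \<Longrightarrow> P) \<Longrightarrow> P"
  using jordan_iff by blast

lemma para_right_move: "x \<diamondop> (y \<diamondop> z) = bf x z \<odot> y - z \<diamondop> (y \<diamondop> x)"
  using para_right[of x y z] by (simp add: eq_diff_eq)

lemma para_left_move: "(x \<diamondop> y) \<diamondop> z = bf x z \<odot> y - (z \<diamondop> y) \<diamondop> x"
  using para_left[of x y z] by (simp add: eq_diff_eq)

lemma bf_para_flip: "bf x (y \<diamondop> z) = bf (y \<diamondop> z) x"
  by (rule bf_sym)

lemma bf_para_rotate: "bf (p \<diamondop> q) r = bf (r \<diamondop> p) q"
  by (metis para_assoc bf_sym)

text \<open>
  The trilinear form \<open>b(x \<diamondop> y, z)\<close> is invariant under cyclic permutations; these rules bring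
  its arguments with indices \<open>j\<close>, \<open>j + 1\<close>, \<open>j + 2\<close> into a fixed order.
\<close>

lemma bf_para_normalize:
  fixes j :: 3
  shows "bf (p (j + 2) \<diamondop> q j) (r (j + 1)) = bf (r (j + 1) \<diamondop> p (j + 2)) (q j)"
    "bf (p j \<diamondop> q (j + 1)) (r (j + 2)) = bf (q (j + 1) \<diamondop> r (j + 2)) (p j)"
  using bf_para_rotate by metis+

text \<open>
  The Leibniz rule for \<open>\<Phi>(d, a)\<close> is checked on coordinates, the diagonal ones by invariance of the
  trilinear form, the others by the two composition identities.
\<close>

lemma Phi_derivation_diag:
  assumes d: "triality d"
  shows "Phi_diag a (jprod_off \<alpha> x \<beta> y) j =
    jprod_diag (Phi_diag a x) (Phi_off d a \<alpha> x) \<beta> y j + jprod_diag \<alpha> x (Phi_diag a y) (Phi_off d a \<beta> y) j"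
proof -
  have s: "bf (x i) (a i) = bf (a i) (x i)" "bf (y i) (a i) = bf (a i) (y i)" "bf (y i) (x i) = bf (x i) (y i)" for i
    by (rule bf_sym)+
  show ?thesis
    unfolding Phi_diag_def Phi_off_def jprod_diag_def jprod_off_def
    by (simp add: bf_para_flip bf_para_normalize[of _ j] s triality_skew[OF d]) (simp add: kc_simps double_k)
qed

lemma Phi_derivation_off:
  assumes d: "triality d"
  shows "Phi_off d a (jprod_diag \<alpha> x \<beta> y) (jprod_off \<alpha> x \<beta> y) j =
    jprod_off (Phi_diag a x) (Phi_off d a \<alpha> x) \<beta> y j + jprod_off \<alpha> x (Phi_diag a y) (Phi_off d a \<beta> y) j"
proof -
  have s: "bf (x i) (a i) = bf (a i) (x i)" "bf (y i) (a i) = bf (a i) (y i)" "bf (y i) (x i) = bf (x i) (y i)" for i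
    by (rule bf_sym)+
  \<comment> \<open>Each composition identity relates two monomials; the instances rewrite one of them to the other.\<close>
  note r = para_left_move[of "x (j + 2)" "a j" "y (j + 2)"]
    para_left_move[of "a (j + 2)" "x j" "y (j + 2)"] para_left_move[of "a (j + 2)" "y j" "x (j + 2)"]
    para_right_move[of "x (j + 1)" "a j" "y (j + 1)"]
    para_right_move[of "y (j + 1)" "x j" "a (j + 1)"] para_right_move[of "x (j + 1)" "y j" "a (j + 1)"]
  show ?thesis
    unfolding Phi_diag_def Phi_off_def jprod_diag_def jprod_off_def
    by (simp add: r s triality_rules[OF d] triality_mul[OF d]) (simp add: kc_simps double_char3)
qed

lemma Phi_in_der:
  assumes d: "triality d"
  shows "Phi d a \<in> der C"
proof -
  have "Phi d a (jel \<alpha> x + jel \<beta> y) = Phi d a (jel \<alpha> x) + Phi d a (jel \<beta> y)" for \<alpha> x \<beta> y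
    by (simp add: jel_add Phi_jel jel_inject Phi_diag_def Phi_off_def fun_eq_iff triality_rules[OF d])
       (simp add: kc_simps)
  moreover have "Phi d a (mat_scale C c (jel \<alpha> x)) = mat_scale C c (Phi d a (jel \<alpha> x))" for c \<alpha> x
    by (simp add: jel_scale Phi_jel jel_inject Phi_diag_def Phi_off_def fun_eq_iff triality_rules[OF d])
       (simp add: kc_simps)
  moreover have "Phi d a (jmul C (jel \<alpha> x) (jel \<beta> y)) =
      jmul C (Phi d a (jel \<alpha> x)) (jel \<beta> y) + jmul C (jel \<alpha> x) (Phi d a (jel \<beta> y))" for \<alpha> x \<beta> y
    by (simp add: jmul_jel Phi_jel jel_add jel_inject fun_eq_iff Phi_derivation_diag[OF d] Phi_derivation_off[OF d])
  ultimately show ?thesis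
    unfolding der_def by (auto simp: Phi_jel Phi_outside elim!: jordanE)
qed

text \<open>
  The contribution of \<open>[\<Sum>\<iota>\<^sub>i(x \<otimes> a\<^sub>i), \<Sum>\<iota>\<^sub>i(y \<otimes> b\<^sub>i)]\<close> to \<open>tri(S)\<close>, up to the factor \<open>b(x, y)\<close>.
\<close>

definition theta_sum :: "(3 \<Rightarrow> 'c) \<Rightarrow> (3 \<Rightarrow> 'c) \<Rightarrow> 'c triple" where
  "theta_sum a b = (\<Sum>i\<in>UNIV. theta_pow i (tri_elt S (a i) (b i)))"

lemma theta_sum_apply:
  "theta_sum a b j z = bf (a j) z \<odot> b j - bf (b j) z \<odot> a j
     + (- bf (a (j + 1)) (b (j + 1)) \<odot> z - a (j + 1) \<diamondop> (z \<diamondop> b (j + 1)))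
     + (- bf (a (j + 2)) (b (j + 2)) \<odot> z - (b (j + 2) \<diamondop> z) \<diamondop> a (j + 2))"
  unfolding theta_sum_def by (simp add: sum_index3[of _ j] theta_pow_def tri_elt_simps)

lemma triality_sum: "finite A \<Longrightarrow> (\<And>i. i \<in> A \<Longrightarrow> triality (f i)) \<Longrightarrow> triality (\<Sum>i\<in>A. f i)"
  by (induction A rule: finite_induct) (auto intro: triality_0 triality_add)

lemma triality_theta_sum: "triality (theta_sum a b)"
  unfolding theta_sum_def by (intro triality_sum triality_theta triality_tri_elt) simp

lemma commutator_outside:
  assumes "\<And>x. x \<notin> jordan C \<Longrightarrow> f x = 0" "\<And>x. x \<notin> jordan C \<Longrightarrow> g x = 0" "f 0 = 0" "g 0 = 0" "x \<notin> jordan C"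
  shows "commutator f g x = 0"
  using assms unfolding commutator_def by simp

lemma endo_eqI:
  assumes "\<And>x. x \<notin> jordan C \<Longrightarrow> f x = 0" "\<And>x. x \<notin> jordan C \<Longrightarrow> g x = 0"
    and "\<And>\<alpha> a. f (jel \<alpha> a) = g (jel \<alpha> a)"
  shows "f = g"
proof
  fix x show "f x = g x" using assms by (cases "x \<in> jordan C") (auto simp: jordan_iff)
qed

lemma Phi_0: "triality d \<Longrightarrow> Phi d a 0 = 0"
  using triality_rules(5)[of d]
  by (simp add: Phi_jel jel_inject Phi_diag_def Phi_off_def flip: jel_0)

text \<open>
  The structure constants common to both sides. With \<open>F\<close> and \<open>R\<close> as in the introduction,
  \<open>[F(d, a), F(e, b)]\<close> is \<open>F\<close> of \<open>tri_part\<close> and \<open>even_bracket\<close>, where \<open>b(1, 1) = 2 = -1\<close> accounts for the sign of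
  \<open>theta_sum\<close>; \<open>odd_action\<close> gives the tensor components of \<open>[F(d, a), R(u, t, b)]\<close>, and \<open>odd_bracket\<close> those of
  \<open>[R(u, t, b), R(v, t', b')]\<close> up to the factor \<open>\<langle>u|v\<rangle>\<close>.
\<close>

definition even_bracket :: "'c triple \<Rightarrow> (3 \<Rightarrow> 'c) \<Rightarrow> 'c triple \<Rightarrow> (3 \<Rightarrow> 'c) \<Rightarrow> 3 \<Rightarrow> 'c" where
  "even_bracket d a e b =
     (\<lambda>j. d j (b j) - e j (a j) + a (j + 1) \<diamondop> b (j + 2) - b (j + 1) \<diamondop> a (j + 2))"

definition tri_part :: "'c triple \<Rightarrow> 'c triple \<Rightarrow> (3 \<Rightarrow> 'c) \<Rightarrow> (3 \<Rightarrow> 'c) \<Rightarrow> 'c triple" where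
  "tri_part d e a b = (\<lambda>i z. d i (e i z) - e i (d i z) - theta_sum a b i z)"

definition odd_action :: "'c triple \<Rightarrow> (3 \<Rightarrow> 'c) \<Rightarrow> 'k \<Rightarrow> (3 \<Rightarrow> 'c) \<Rightarrow> 3 \<Rightarrow> 'c" where
  "odd_action d a t b =
     (\<lambda>j. d j (b j) + t \<odot> a j - a (j + 1) \<diamondop> b (j + 2) + b (j + 1) \<diamondop> a (j + 2))"

definition odd_bracket :: "'k \<Rightarrow> (3 \<Rightarrow> 'c) \<Rightarrow> 'k \<Rightarrow> (3 \<Rightarrow> 'c) \<Rightarrow> 3 \<Rightarrow> 'c" where
  "odd_bracket t b t' b' =
     (\<lambda>j. b (j + 1) \<diamondop> b' (j + 2) - b' (j + 1) \<diamondop> b (j + 2) + t' \<odot> b j - t \<odot> b' j)"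

lemma commutator_Phi_diag:
  fixes j :: 3
  assumes d: "triality d" and e: "triality e"
  shows "Phi_diag a (Phi_off e b \<beta> x) j - Phi_diag b (Phi_off d a \<beta> x) j =
    Phi_diag (even_bracket d a e b) x j"
proof -
  have s: "bf (x i) (a i) = bf (a i) (x i)" "bf (x i) (b i) = bf (b i) (x i)" "bf (b i) (a i) = bf (a i) (b i)" for i
    by (rule bf_sym)+
  show ?thesis
    unfolding Phi_diag_def Phi_off_def even_bracket_def
    by (simp add: bf_para_flip bf_para_normalize[of _ j] s triality_skew[OF d] triality_skew[OF e])
qed

lemma commutator_Phi_off:
  fixes j :: 3
  assumes d: "triality d" and e: "triality e"
  shows "Phi_off d a (Phi_diag b x) (Phi_off e b \<beta> x) j - Phi_off e b (Phi_diag a x) (Phi_off d a \<beta> x) j =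
    Phi_off (tri_part d e a b)
      (even_bracket d a e b) \<beta> x j"
proof -
  have s: "bf (x i) (a i) = bf (a i) (x i)" "bf (x i) (b i) = bf (b i) (x i)" "bf (b i) (a i) = bf (a i) (b i)" for i
    by (rule bf_sym)+
  \<comment> \<open>Each composition identity relates two monomials; the instances rewrite one of them to the other.\<close>
  note r = para_right_move[of "b (j + 1)" "x j" "a (j + 1)"] para_left_move[of "a (j + 2)" "x j" "b (j + 2)"]
    para_right_move[of "a (j + 1)" "b j" "x (j + 1)"] para_right_move[of "b (j + 1)" "a j" "x (j + 1)"]
    para_left_move[of "x (j + 2)" "b j" "a (j + 2)"] para_left_move[of "x (j + 2)" "a j" "b (j + 2)"]
  show ?thesis
    unfolding Phi_diag_def Phi_off_def even_bracket_def tri_part_def theta_sum_apply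
    by (simp add: r s triality_rules[OF d] triality_rules[OF e] triality_mul[OF d] triality_mul[OF e])
       (simp add: kc_simps double_char3)
qed

text \<open>
  Hence \<open>\<Phi>\<close> is a homomorphism on \<open>g(S\<^sub>1, S)\<close>.
\<close>

lemma commutator_Phi:
  assumes d: "triality d" and e: "triality e"
  shows "commutator (Phi d a) (Phi e b) = Phi (tri_part d e a b)
      (even_bracket d a e b)"
proof (rule endo_eqI)
  show "commutator (Phi d a) (Phi e b) x = 0" if "x \<notin> jordan C" for x
    using that by (intro commutator_outside) (auto simp: Phi_outside Phi_0 d e)
qed (simp_all add: Phi_outside commutator_def Phi_jel jel_diff jel_inject fun_eq_iff
    commutator_Phi_diag[OF d e] commutator_Phi_off[OF d e])

lemma commutator_jL_diag:
  "jprod_diag \<xi> x (jprod_diag \<eta> y \<zeta> z) (jprod_off \<eta> y \<zeta> z) j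
    - jprod_diag \<eta> y (jprod_diag \<xi> x \<zeta> z) (jprod_off \<xi> x \<zeta> z) j =
   Phi_diag (\<lambda>j. x (j + 1) \<diamondop> y (j + 2) - y (j + 1) \<diamondop> x (j + 2) + (\<eta> (j + 2) - \<eta> (j + 1)) \<odot> x j
      - (\<xi> (j + 2) - \<xi> (j + 1)) \<odot> y j) z j"
proof -
  have s: "bf (z i) (x i) = bf (x i) (z i)" "bf (z i) (y i) = bf (y i) (z i)" "bf (y i) (x i) = bf (x i) (y i)" for i
    by (rule bf_sym)+
  show ?thesis
    unfolding Phi_diag_def jprod_diag_def jprod_off_def
    by (simp add: bf_para_flip bf_para_normalize[of _ j] s) (simp add: kc_simps double_k)
qed

lemma commutator_jL_off:
  "jprod_off \<xi> x (jprod_diag \<eta> y \<zeta> z) (jprod_off \<eta> y \<zeta> z) j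
    - jprod_off \<eta> y (jprod_diag \<xi> x \<zeta> z) (jprod_off \<xi> x \<zeta> z) j =
   Phi_off (theta_sum x y) (\<lambda>j. x (j + 1) \<diamondop> y (j + 2) - y (j + 1) \<diamondop> x (j + 2) + (\<eta> (j + 2) - \<eta> (j + 1)) \<odot> x j
      - (\<xi> (j + 2) - \<xi> (j + 1)) \<odot> y j) \<zeta> z j"
proof -
  have s: "bf (z i) (x i) = bf (x i) (z i)" "bf (z i) (y i) = bf (y i) (z i)" "bf (y i) (x i) = bf (x i) (y i)" for i
    by (rule bf_sym)+
  \<comment> \<open>Each composition identity relates two monomials; the instances rewrite one of them to the other.\<close>
  note r = para_right_move[of "y (j + 1)" "z j" "x (j + 1)"] para_left_move[of "x (j + 2)" "z j" "y (j + 2)"]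
    para_right_move[of "x (j + 1)" "y j" "z (j + 1)"] para_right_move[of "y (j + 1)" "x j" "z (j + 1)"]
    para_left_move[of "z (j + 2)" "y j" "x (j + 2)"] para_left_move[of "z (j + 2)" "x j" "y (j + 2)"]
  show ?thesis
    unfolding Phi_off_def jprod_diag_def jprod_off_def theta_sum_apply
    by (simp add: r s) (simp add: kc_simps double_char3)
qed

lemma jL_outside: "x \<notin> jordan C \<Longrightarrow> jL C y x = 0"
  by (simp add: jL_def)

text \<open>
  The coordinates of \<open>[L\<^sub>x, L\<^sub>y]\<close> as an inner derivation; this gives the odd bracket of \<open>g(J)\<close>.
\<close>

lemma commutator_jL:
  "commutator (jL C (jel \<xi> x)) (jL C (jel \<eta> y)) =
   Phi (theta_sum x y) (\<lambda>j. x (j + 1) \<diamondop> y (j + 2) - y (j + 1) \<diamondop> x (j + 2) + (\<eta> (j + 2) - \<eta> (j + 1)) \<odot> x j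
      - (\<xi> (j + 2) - \<xi> (j + 1)) \<odot> y j)"
proof (rule endo_eqI)
  have z: "jL C (jel \<alpha> a) 0 = 0" for \<alpha> a
    by (simp add: jL_def jmul_jel jel_inject jprod_diag_def jprod_off_def flip: jel_0)
  show "commutator (jL C (jel \<xi> x)) (jL C (jel \<eta> y)) w = 0" if "w \<notin> jordan C" for w
    using that by (intro commutator_outside) (auto simp: z jL_outside)
qed (simp_all add: Phi_outside commutator_def jL_def jmul_jel Phi_jel jel_diff jel_inject fun_eq_iff
    commutator_jL_diag commutator_jL_off)

lemma der_jordan: "D \<in> der C \<Longrightarrow> x \<in> jordan C \<Longrightarrow> D x \<in> jordan C"
  and der_outside: "D \<in> der C \<Longrightarrow> x \<notin> jordan C \<Longrightarrow> D x = 0"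
  and der_add: "D \<in> der C \<Longrightarrow> x \<in> jordan C \<Longrightarrow> y \<in> jordan C \<Longrightarrow> D (x + y) = D x + D y"
  and der_scale: "D \<in> der C \<Longrightarrow> x \<in> jordan C \<Longrightarrow> D (mat_scale C c x) = mat_scale C c (D x)"
  and der_jmul: "D \<in> der C \<Longrightarrow> x \<in> jordan C \<Longrightarrow> y \<in> jordan C \<Longrightarrow> D (jmul C x y) = jmul C (D x) y + jmul C x (D y)"
  unfolding der_def by blast+

lemma jordan_add: "x \<in> jordan C \<Longrightarrow> y \<in> jordan C \<Longrightarrow> x + y \<in> jordan C"
  by (auto simp: jel_add elim!: jordanE)

lemma jordan_diff: "x \<in> jordan C \<Longrightarrow> y \<in> jordan C \<Longrightarrow> x - y \<in> jordan C"
  by (auto simp: jel_diff elim!: jordanE)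

lemma jordan_scale: "x \<in> jordan C \<Longrightarrow> mat_scale C c x \<in> jordan C"
  by (auto simp: jel_scale elim!: jordanE)

lemma jordan_0: "0 \<in> jordan C"
  using jel_in_jordan jel_0 by metis

lemma mat_scale_add: "mat_scale C c (x + y) = mat_scale C c x + mat_scale C c y"
  and mat_scale_diff: "mat_scale C c (x - y) = mat_scale C c x - mat_scale C c y"
  and mat_scale_add_left: "mat_scale C (c + c') x = mat_scale C c x + mat_scale C c' x"
  and mat_scale_mat_scale: "mat_scale C c (mat_scale C c' x) = mat_scale C (c * c') x"
  and mat_scale_1: "mat_scale C 1 x = x"
  and mat_scale_zero: "mat_scale C c 0 = 0"
  by (simp_all add: mat_scale_def vec_eq_iff scale_right_distrib scale_left_distrib scale_right_diff_distrib)

lemma vector_space_mat: "vector_space (mat_scale C)"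
  by unfold_locales (simp_all add: mat_scale_add mat_scale_add_left mat_scale_mat_scale mat_scale_1)

lemma jmul_add:
  assumes "x \<in> jordan C" "y \<in> jordan C" "z \<in> jordan C"
  shows "jmul C (x + y) z = jmul C x z + jmul C y z" "jmul C x (y + z) = jmul C x y + jmul C x z"
    "jmul C (x - y) z = jmul C x z - jmul C y z" "jmul C x (y - z) = jmul C x y - jmul C x z"
  using assms
  by (auto simp: jel_add jel_diff jmul_jel jel_inject jprod_diag_def jprod_off_def fun_eq_iff kc_simps elim!: jordanE)

lemma jmul_scale:
  assumes "x \<in> jordan C" "y \<in> jordan C"
  shows "jmul C (mat_scale C c x) y = mat_scale C c (jmul C x y)" "jmul C x (mat_scale C c y) = mat_scale C c (jmul C x y)"
  using assms
  by (auto simp: jel_scale jmul_jel jel_inject jprod_diag_def jprod_off_def fun_eq_iff kc_simps elim!: jordanE)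

lemma jmul_jordan: "x \<in> jordan C \<Longrightarrow> y \<in> jordan C \<Longrightarrow> jmul C x y \<in> jordan C"
  by (auto simp: jmul_jel elim!: jordanE)

lemma der_diff:
  assumes D: "D \<in> der C" and D': "D' \<in> der C"
  shows "(\<lambda>x. D x - D' x) \<in> der C"
  unfolding der_def
  by (auto simp: jordan_diff der_jordan[OF D] der_jordan[OF D'] der_outside[OF D] der_outside[OF D']
      der_add[OF D] der_add[OF D'] der_scale[OF D] der_scale[OF D'] der_jmul[OF D] der_jmul[OF D'] mat_scale_diff jmul_add jmul_jordan)

lemma der_zero: "D \<in> der C \<Longrightarrow> D 0 = 0"
  using der_add[of D 0 0] jordan_0 by simp

lemma jel_decompose:
  "jel \<alpha> a = jel (single i (\<alpha> i)) (\<lambda>_. 0) + jel (single (i + 1) (\<alpha> (i + 1))) (\<lambda>_. 0) + jel (single (i + 2) (\<alpha> (i + 2))) (\<lambda>_. 0)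
     + off i (a i) + off (i + 1) (a (i + 1)) + off (i + 2) (a (i + 2))"
  unfolding jel_add jel_inject fun_eq_iff
proof (intro conjI allI, goal_cases)
  case (1 j) then show ?case by (cases rule: index3_cases[of j i]) simp_all
next
  case (2 j) then show ?case by (cases rule: index3_cases[of j i]) simp_all
qed

text \<open>
  From \<open>e \<circ> e = e\<close> follows \<open>De = 2 e \<circ> De\<close>, so \<open>De\<close> lies in the half-eigenspace of \<open>L\<^sub>e\<close>.
\<close>

lemma der_idempotent:
  assumes D: "D \<in> der C" and x: "D (idem i) = jel \<xi> x"
  shows "\<xi> = (\<lambda>_. 0)" "x i = 0"
proof -
  have "jmul C (idem i) (idem i) = idem i"
    by (auto simp: jmul_jel jel_inject jprod_diag_def jprod_off_def)
  from arg_cong[OF this, of D] have "(\<lambda>j. jprod_diag \<xi> x (single i 1) (\<lambda>_. 0) j + jprod_diag (single i 1) (\<lambda>_. 0) \<xi> x j) = \<xi> \<and>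
    (\<lambda>j. jprod_off \<xi> x (single i 1) (\<lambda>_. 0) j + jprod_off (single i 1) (\<lambda>_. 0) \<xi> x j) = x"
    unfolding der_jmul[OF D jel_in_jordan jel_in_jordan] unfolding x jmul_jel jel_add jel_inject .
  then have eq: "jprod_diag \<xi> x (single i 1) (\<lambda>_. 0) j + jprod_diag (single i 1) (\<lambda>_. 0) \<xi> x j = \<xi> j"
    "jprod_off \<xi> x (single i 1) (\<lambda>_. 0) j + jprod_off (single i 1) (\<lambda>_. 0) \<xi> x j = x j" for j
    by (auto simp: fun_eq_iff)
  have \<xi>: "\<xi> i = - \<xi> i" "\<xi> (i + 1) = 0" "\<xi> (i + 2) = 0"
    using eq(1)[of i] eq(1)[of "i + 1"] eq(1)[of "i + 2"]
    by (simp_all add: jprod_diag_def double_k)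
  then have "\<xi> i = 0" using double_k(1)[of "\<xi> i"] by simp
  with \<xi> have "\<xi> j = 0" for j by (cases rule: index3_cases[of j i]) simp_all
  then show "\<xi> = (\<lambda>_. 0)" by blast
  show "x i = 0" using eq(2)[of i] by (simp add: jprod_off_def)
qed

text \<open>
  The space \<open>\<iota>\<^sub>i(S)\<close> is cut out by the eigenvalue \<open>0\<close> of \<open>e\<^sub>i\<close> and the eigenvalue \<open>1/2\<close> of \<open>e\<^sub>i\<^sub>+\<^sub>1\<close>, and \<open>D\<close> commutes
  with both multiplications.
\<close>

lemma der_fixing_idempotents:
  assumes D: "D \<in> der C" and e: "\<And>i. D (idem i) = 0"
  shows "D (off i s) = jel (\<lambda>_. 0) (single i (jcoord C i (D (off i s))))"
proof -
  obtain \<xi> x where x: "D (off i s) = jel \<xi> x"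
    using der_jordan[OF D jel_in_jordan] jordan_iff by blast
  have "jmul C (idem i) (off i s) = 0"
    by (auto simp: jmul_jel jel_inject jprod_diag_def jprod_off_def simp flip: jel_0)
  from arg_cong[OF this, of D] have "jmul C (idem i) (jel \<xi> x) = jel (\<lambda>_. 0) (\<lambda>_. 0)"
    unfolding der_jmul[OF D jel_in_jordan jel_in_jordan] x e der_zero[OF D]
    by (simp add: jmul_jel jel_inject jprod_diag_def jprod_off_def jel_add fun_eq_iff flip: jel_0)
  then have 1: "jprod_diag (single i 1) (\<lambda>_. 0) \<xi> x j = 0" "jprod_off (single i 1) (\<lambda>_. 0) \<xi> x j = 0" for j
    unfolding jmul_jel jel_inject by (simp_all add: fun_eq_iff)
  have "mat_scale C 2 (jmul C (idem (i + 1)) (off i s)) = off i s"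
    by (auto simp: jmul_jel jel_scale jel_inject jprod_diag_def jprod_off_def)
  from arg_cong[OF this, of D] have "mat_scale C 2 (jmul C (idem (i + 1)) (jel \<xi> x)) = jel \<xi> x"
    unfolding der_scale[OF D jmul_jordan[OF jel_in_jordan jel_in_jordan]] der_jmul[OF D jel_in_jordan jel_in_jordan] x e
    by (simp add: jmul_jel jel_inject jprod_diag_def jprod_off_def jel_add fun_eq_iff flip: jel_0)
  then have 2: "- jprod_diag (single (i + 1) 1) (\<lambda>_. 0) \<xi> x j = \<xi> j" for j
    unfolding jmul_jel jel_scale jel_inject by (simp add: fun_eq_iff)
  have "\<xi> i = 0" "\<xi> (i + 2) = 0" "- \<xi> (i + 1) = \<xi> (i + 1)" "x (i + 1) = 0" "x (i + 2) = 0"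
    using 1[of i] 1[of "i + 1"] 1[of "i + 2"] 2[of i] 2[of "i + 1"] 2[of "i + 2"]
    by (simp_all add: jprod_diag_def jprod_off_def)
  moreover from this have "\<xi> (i + 1) = 0" using double_k(1)[of "\<xi> (i + 1)"] by simp
  ultimately have "\<xi> j = 0" "x j = single i (x i) j" for j
    by (cases rule: index3_cases[of j i]; simp)+
  then show ?thesis unfolding x jel_inject jcoord_jel by (simp add: fun_eq_iff)
qed

lemma der_fixing_idempotents_D_tri:
  assumes D: "D \<in> der C" and e: "\<And>i. D (idem i) = 0"
  shows "\<exists>d. triality d \<and> D = Phi d (\<lambda>_. 0)"
proof -
  define d where "d i s = jcoord C i (D (off i s))" for i s
  have Di: "D (off i s) = off i (d i s)" for i s
    unfolding d_def by (rule der_fixing_idempotents[OF D e])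
  have lin: "linC (d i)" for i
    unfolding Vector_Spaces.linear_iff
  proof (intro conjI allI vector_space_axioms)
    fix x y c
    have "D (off i x + off i y) = off i (d i x) + off i (d i y)"
      by (simp add: der_add[OF D] Di)
    moreover have "off i x + off i y = off i (x + y)" for x y
      by (auto simp: jel_add jel_inject)
    ultimately show "d i (x + y) = d i x + d i y" by (simp add: Di jel_inject fun_eq_iff) (metis (full_types))
    have "D (mat_scale C c (off i x)) = mat_scale C c (off i (d i x))"
      by (simp add: der_scale[OF D] Di)
    moreover have "mat_scale C c (off i x) = off i (c \<odot> x)" for x
      by (auto simp: jel_scale jel_inject)
    ultimately show "d i (c \<odot> x) = c \<odot> d i x" by (simp add: Di jel_inject fun_eq_iff) (metis (full_types))
  qed
  have Dc: "D (jel (single i c) (\<lambda>_. 0)) = 0" for i c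
  proof -
    have "jel (single i c) (\<lambda>_. 0) = mat_scale C c (idem i)"
      by (auto simp: jel_scale jel_inject)
    then show ?thesis by (simp add: der_scale[OF D] e mat_scale_zero)
  qed
  have D0: "D (jel \<alpha> a) = jel (\<lambda>_. 0) (\<lambda>i. d i (a i))" for \<alpha> a
    unfolding jel_decompose[of \<alpha> a 0] jel_decompose[of "\<lambda>_. 0" "\<lambda>i. d i (a i)" 0]
    by (simp add: der_add[OF D] jordan_add Dc Di jel_0 cong: if_cong)
  have skew: "bf (d i x) y = - bf x (d i y)" for i x y
  proof -
    have "jprod_off (\<lambda>_. 0) (single i x) (\<lambda>_. 0) (single i y) j = 0" for j
      by (cases rule: index3_cases[of j i]) (simp_all add: jprod_off_def)
    then have "D (jmul C (off i x) (off i y)) = 0"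
      by (simp add: jmul_jel D0 linear_rules[OF lin] jel_0)
    then have "jel (\<lambda>j. jprod_diag (\<lambda>_. 0) (single i (d i x)) (\<lambda>_. 0) (single i y) j
        + jprod_diag (\<lambda>_. 0) (single i x) (\<lambda>_. 0) (single i (d i y)) j)
       (\<lambda>j. jprod_off (\<lambda>_. 0) (single i (d i x)) (\<lambda>_. 0) (single i y) j
        + jprod_off (\<lambda>_. 0) (single i x) (\<lambda>_. 0) (single i (d i y)) j) = jel (\<lambda>_. 0) (\<lambda>_. 0)"
      unfolding der_jmul[OF D jel_in_jordan jel_in_jordan] unfolding Di jmul_jel jel_add jel_0 .
    then have "jprod_diag (\<lambda>_. 0) (single i (d i x)) (\<lambda>_. 0) (single i y) (i + 1)
        + jprod_diag (\<lambda>_. 0) (single i x) (\<lambda>_. 0) (single i (d i y)) (i + 1) = 0"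
      unfolding jel_inject by (intro fun_cong[of _ "\<lambda>_. 0" "i + 1"]) blast
    then show ?thesis by (simp add: jprod_diag_def kc_simps)
  qed
  have tri: "d 0 (x \<diamondop> y) = d 1 x \<diamondop> y + x \<diamondop> d 2 y" for x y
  proof -
    have "jmul C (off 1 x) (off 2 y) = off 0 (x \<diamondop> y)" for x y
      unfolding jmul_jel jel_inject fun_eq_iff jprod_diag_def jprod_off_def
    proof (intro conjI allI, goal_cases)
      case (1 i) then show ?case using index3_exhaust[of i] by auto
    next
      case (2 i) then show ?case using index3_exhaust[of i] by auto
    qed
    note m = this
    have "D (jmul C (off 1 x) (off 2 y)) =
        off 0 (d 1 x \<diamondop> y) + off 0 (x \<diamondop> d 2 y)"
      unfolding der_jmul[OF D jel_in_jordan jel_in_jordan] unfolding Di m ..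
    then have "off 0 (d 0 (x \<diamondop> y)) =
        jel (\<lambda>_. 0) (\<lambda>i. single 0 (d 1 x \<diamondop> y) i + single 0 (x \<diamondop> d 2 y) i)"
      unfolding m unfolding Di jel_add by simp
    then show ?thesis unfolding jel_inject by (auto dest: fun_cong[of _ _ 0])
  qed
  have "triality d" using lin skew tri by (rule trialityI)
  moreover have "D = Phi d (\<lambda>_. 0)"
    by (rule endo_eqI) (simp_all add: der_outside[OF D] Phi_outside D0 Phi_jel Phi_diag_def Phi_off_def)
  ultimately show ?thesis by blast
qed

lemma Phi_add: "triality d \<Longrightarrow> triality e \<Longrightarrow> Phi (d + e) (\<lambda>i. a i + b i) = Phi d a + Phi e b"
  by (rule endo_eqI) (auto simp: Phi_outside Phi_jel jel_add jel_inject Phi_diag_def Phi_off_def kc_simps)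

text \<open>
  The idempotents \<open>e\<^sub>i\<close> have derivatives in the half-eigenspaces, and orthogonality of the
  \<open>e\<^sub>i\<close> leaves one vector \<open>a\<^sub>j\<close> free in each \<open>\<iota>\<^sub>j\<close>. Subtracting the corresponding \<open>D\<^sub>j(a\<^sub>j)\<close>
  gives a derivation killing the idempotents, which therefore preserves every \<open>\<iota>\<^sub>j\<close>, and the
  multiplication rules turn its restrictions into a related triple.
\<close>

lemma der_is_Phi:
  assumes D: "D \<in> der C"
  shows "\<exists>d a. triality d \<and> D = Phi d a"
proof -
  define e where "e i = idem i" for i :: 3
  have ej: "e i \<in> jordan C" for i by (simp add: e_def)
  define x where "x i = (\<lambda>j. jcoord C j (D (e i)))" for i
  have De: "D (e i) = jel (\<lambda>_. 0) (x i)" and xi: "x i i = 0" for i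
  proof -
    obtain \<xi> y where y: "D (e i) = jel \<xi> y" using der_jordan[OF D ej] jordan_iff by blast
    from der_idempotent[OF D this[unfolded e_def]] show "D (e i) = jel (\<lambda>_. 0) (x i)" "x i i = 0"
      unfolding x_def y by simp_all
  qed
  have sw: "x i (i + 2) = - x (i + 1) (i + 2)" for i
  proof -
    have "jmul C (e i) (e (i + 1)) = 0"
      unfolding e_def by (auto simp: jmul_jel jel_inject jprod_diag_def jprod_off_def simp flip: jel_0)
    from arg_cong[OF this, of D] have "jmul C (D (e i)) (e (i + 1)) + jmul C (e i) (D (e (i + 1))) = 0"
      by (simp add: der_jmul[OF D ej ej] der_zero[OF D])
    then have "jprod_off (\<lambda>_. 0) (x i) (single (i + 1) 1) (\<lambda>_. 0) (i + 2) + jprod_off (single i 1) (\<lambda>_. 0) (\<lambda>_. 0) (x (i + 1)) (i + 2) = 0"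
      unfolding De unfolding e_def jmul_jel jel_add jel_0[symmetric] jel_inject by meson
    then have "- x i (i + 2) = x (i + 1) (i + 2)" by (simp add: jprod_off_def)
    then show ?thesis by (metis minus_minus)
  qed
  \<comment> \<open>The derivation \<open>D\<^sub>j(a\<^sub>j)\<close> maps \<open>e\<^sub>j\<^sub>+\<^sub>2\<close> to \<open>\<iota>\<^sub>j(a\<^sub>j)\<close>, \<open>e\<^sub>j\<^sub>+\<^sub>1\<close> to \<open>-\<iota>\<^sub>j(a\<^sub>j)\<close> and \<open>e\<^sub>j\<close> to 0.\<close>
  define a where "a j = x (j + 2) j" for j
  define D' where "D' = (\<lambda>x. D x - Phi 0 a x)"
  have D': "D' \<in> der C" unfolding D'_def by (rule der_diff[OF D Phi_in_der[OF triality_0]])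
  have "D' (e i) = 0" for i
  proof -
    have "x i = Phi_off 0 a (single i 1) (\<lambda>_. 0)"
    proof
      fix j
      show "x i j = Phi_off 0 a (single i 1) (\<lambda>_. 0) j"
        using sw[of i] xi[of i]
        by (cases rule: index3_cases[of j i]) (simp_all add: Phi_off_def a_def)
    qed
    then show ?thesis
      unfolding D'_def De unfolding e_def Phi_jel
      by (simp add: Phi_diag_def)
  qed
  then obtain d where d: "triality d" "D' = Phi d (\<lambda>_. 0)"
    using der_fixing_idempotents_D_tri[OF D'] unfolding e_def by blast
  have "D = D' + Phi 0 a" unfolding D'_def by (simp add: fun_eq_iff)
  also have "\<dots> = Phi (d + 0) (\<lambda>i. 0 + a i)" unfolding d(2) by (rule Phi_add[OF d(1) triality_0, symmetric])
  finally show ?thesis using d(1) by auto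
qed

section \<open>The module of trace zero elements modulo the unit\<close>

text \<open>
  The representative \<open>t (e\<^sub>0 - e\<^sub>1) + \<Sum>\<iota>\<^sub>i(b\<^sub>i)\<close>; by \<open>vcar_TJ\<close> and \<open>TJel_inject\<close> each class has exactly one.
\<close>

definition jvec :: "'k \<Rightarrow> (3 \<Rightarrow> 'c) \<Rightarrow> 'c^3^3" where
  "jvec t b = jel (\<lambda>i. if i = 0 then t else if i = 1 then - t else 0) b"

definition TJel :: "'k \<Rightarrow> (3 \<Rightarrow> 'c) \<Rightarrow> ('c^3^3) set" where
  "TJel t b = hat C (jvec t b)"

lemma jvec_jordan [simp]: "jvec t b \<in> jordan C"
  unfolding jvec_def by simp

lemma jvec_jordan0 [simp]: "jvec t b \<in> jordan0 C"
  unfolding jvec_def jordan0_jel by (simp add: sum_index3[of _ 0])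

lemma jordan0_jordan: "x \<in> jordan0 C \<Longrightarrow> x \<in> jordan C"
  unfolding jordan0_def by simp

lemma jone_jordan [simp]: "jone C \<in> jordan C"
  by (simp add: jone_jel)

lemma hat_shift: "hat C (x + mat_scale C c (jone C)) = hat C x"
proof (intro set_eqI iffI)
  fix z
  assume "z \<in> hat C (x + mat_scale C c (jone C))"
  then obtain m where "z = x + mat_scale C c (jone C) + mat_scale C m (jone C)" unfolding hat_def by blast
  then have "z = x + mat_scale C (c + m) (jone C)" by (simp add: mat_scale_add_left)
  then show "z \<in> hat C x" unfolding hat_def by blast
next
  fix z
  assume "z \<in> hat C x"
  then obtain m where "z = x + mat_scale C (c + (m - c)) (jone C)" unfolding hat_def by auto
  then have "z = x + mat_scale C c (jone C) + mat_scale C (m - c) (jone C)"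
    unfolding mat_scale_add_left by (simp only: add.assoc)
  then show "z \<in> hat C (x + mat_scale C c (jone C))" unfolding hat_def by blast
qed

lemma rep_hat: "\<exists>c. rep (hat C x) = x + mat_scale C c (jone C)"
proof -
  have "x + mat_scale C 0 (jone C) \<in> hat C x" unfolding hat_def by blast
  then have "rep (hat C x) \<in> hat C x" unfolding rep_def by (rule someI)
  then show ?thesis unfolding hat_def by blast
qed

lemma jmul_jone: "x \<in> jordan C \<Longrightarrow> jmul C (jone C) x = x" "x \<in> jordan C \<Longrightarrow> jmul C x (jone C) = x"
  by (auto elim!: jordanE simp: jone_jel jmul_jel jel_inject jprod_diag_def jprod_off_def fun_eq_iff kc_simps double_char3)

lemma jtrace_linear:
  "x \<in> jordan C \<Longrightarrow> y \<in> jordan C \<Longrightarrow> jtrace C (x + y) = jtrace C x + jtrace C y"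
  "x \<in> jordan C \<Longrightarrow> jtrace C (mat_scale C c x) = c * jtrace C x"
  by (auto elim!: jordanE simp: jel_add jel_scale jtrace_jel sum.distrib sum_distrib_left)

lemma jtrace_jone: "jtrace C (jone C) = 0"
  by (simp add: jone_jel jtrace_jel sum_index3[of _ 0])

text \<open>
  The unit is orthogonal to the elements of trace zero, itself included, since its trace is \<open>3 = 0\<close>.
\<close>

lemma TJ_form_hat:
  assumes "x \<in> jordan0 C" "y \<in> jordan0 C"
  shows "TJ_form C (hat C x) (hat C y) = jtrace C (jmul C x y)"
proof -
  obtain c where c: "rep (hat C x) = x + mat_scale C c (jone C)" using rep_hat by blast
  obtain m where m: "rep (hat C y) = y + mat_scale C m (jone C)" using rep_hat by blast
  show ?thesis
    using assms unfolding TJ_form_def c m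
    by (simp add: jmul_add jmul_scale jmul_jone jordan_add jordan_scale jmul_jordan jordan0_def jtrace_linear jtrace_jone)
qed

lemma jL_add_unit: "x \<in> jordan C \<Longrightarrow> z \<in> jordan C \<Longrightarrow> jL C (x + mat_scale C c (jone C)) z = jmul C x z + mat_scale C c z"
  unfolding jL_def by (simp add: jmul_add jmul_scale jmul_jone jordan_scale)

lemma mat_scale_0: "mat_scale C 0 x = 0"
  by (simp add: mat_scale_def vec_eq_iff)

lemma jL_zero: "x \<in> jordan C \<Longrightarrow> jL C x 0 = 0"
  using jmul_scale(2)[of x 0 0] by (simp add: jL_def jordan_0 mat_scale_0)

lemma TJ_comm_hat:
  assumes "x \<in> jordan C" "y \<in> jordan C"
  shows "TJ_comm C (hat C x) (hat C y) = commutator (jL C x) (jL C y)"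
proof (rule endo_eqI)
  obtain c where c: "rep (hat C x) = x + mat_scale C c (jone C)" using rep_hat by blast
  obtain m where m: "rep (hat C y) = y + mat_scale C m (jone C)" using rep_hat by blast
  show "TJ_comm C (hat C x) (hat C y) z = 0" if "z \<notin> jordan C" for z
    unfolding TJ_comm_def c m
    using that assms by (intro commutator_outside jL_outside jL_zero jordan_add jordan_scale jone_jordan)
  show "commutator (jL C x) (jL C y) z = 0" if "z \<notin> jordan C" for z
    using that assms by (intro commutator_outside jL_outside jL_zero)
  fix \<alpha> a
  show "TJ_comm C (hat C x) (hat C y) (jel \<alpha> a) = commutator (jL C x) (jL C y) (jel \<alpha> a)"
    unfolding TJ_comm_def c m commutator_def using assms
    by (simp add: jL_add_unit jmul_jordan jordan_add jordan_scale jmul_add jmul_scale mat_scale_add mat_scale_mat_scale mult.commute)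
       (simp add: jL_def jmul_jordan)
qed

lemma der_jone: "D \<in> der C \<Longrightarrow> D (jone C) = 0"
  using der_jmul[of D "jone C" "jone C"] by (simp add: jmul_jone der_jordan)

lemma TJ_act_hat:
  assumes D: "D \<in> der C" and x: "x \<in> jordan C"
  shows "TJ_act C D (hat C x) = hat C (D x)"
proof -
  obtain c where c: "rep (hat C x) = x + mat_scale C c (jone C)" using rep_hat by blast
  show ?thesis unfolding TJ_act_def c
    using x by (simp add: der_add[OF D] der_scale[OF D] der_jone[OF D] mat_scale_zero jordan_scale)
qed

lemma vadd_TJ: "vadd (TJ C) (hat C x) (hat C y) = hat C (x + y)"
proof (intro set_eqI iffI)
  fix z
  assume "z \<in> vadd (TJ C) (hat C x) (hat C y)"
  then obtain c m where "z = x + mat_scale C c (jone C) + (y + mat_scale C m (jone C))"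
    unfolding TJ_def hat_def by auto
  then have "z = x + y + mat_scale C (c + m) (jone C)" by (simp add: mat_scale_add_left)
  then show "z \<in> hat C (x + y)" unfolding hat_def by blast
next
  fix z
  assume "z \<in> hat C (x + y)"
  then obtain c where "z = x + y + mat_scale C (0 + c) (jone C)" unfolding hat_def by auto
  then have "z = x + mat_scale C 0 (jone C) + (y + mat_scale C c (jone C))"
    unfolding mat_scale_add_left by (simp only: ac_simps)
  then show "z \<in> vadd (TJ C) (hat C x) (hat C y)" unfolding TJ_def hat_def by auto
qed

lemma vscl_TJ: "vscl (TJ C) c (hat C x) = hat C (mat_scale C c x)"
proof (intro set_eqI iffI)
  fix z
  assume "z \<in> vscl (TJ C) c (hat C x)"
  then obtain m m' where "z = mat_scale C c (x + mat_scale C m (jone C)) + mat_scale C m' (jone C)"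
    unfolding TJ_def hat_def by auto
  then have "z = mat_scale C c x + mat_scale C (c * m + m') (jone C)"
    by (simp add: mat_scale_add_left mat_scale_add mat_scale_mat_scale)
  then show "z \<in> hat C (mat_scale C c x)" unfolding hat_def by blast
next
  fix z
  assume "z \<in> hat C (mat_scale C c x)"
  then obtain m where "z = mat_scale C c x + mat_scale C (c * 0 + m) (jone C)" unfolding hat_def by auto
  then have "z = mat_scale C c (x + mat_scale C 0 (jone C)) + mat_scale C m (jone C)"
    unfolding mat_scale_add_left mat_scale_add mat_scale_mat_scale by (simp only: add.assoc)
  then show "z \<in> vscl (TJ C) c (hat C x)" unfolding TJ_def hat_def by auto
qed

text \<open>
  If the entries of \<open>\<alpha>\<close> sum to zero, then \<open>\<alpha>\<^sub>1 - \<alpha>\<^sub>2 = -(\<alpha>\<^sub>0 - \<alpha>\<^sub>2)\<close> because \<open>3\<alpha>\<^sub>2 = 0\<close>. So subtracting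
  \<open>\<alpha>\<^sub>2\<close> times the unit leaves a multiple of \<open>e\<^sub>0 - e\<^sub>1\<close> on the diagonal.
\<close>

lemma hat_jel: "(\<Sum>i\<in>UNIV. \<alpha> i) = 0 \<Longrightarrow> hat C (jel \<alpha> b) = TJel (\<alpha> 0 - \<alpha> 2) b"
proof -
  assume s: "(\<Sum>i\<in>UNIV. \<alpha> i) = 0"
  have "\<alpha> 0 + \<alpha> 1 + \<alpha> 2 = 0" using s by (simp add: sum_index3[of _ 0])
  then have \<alpha>1: "\<alpha> 1 = - \<alpha> 2 - \<alpha> 0" by algebra
  have "jel \<alpha> b = jvec (\<alpha> 0 - \<alpha> 2) b + mat_scale C (\<alpha> 2) (jone C)"
    unfolding jvec_def jone_jel jel_scale jel_add jel_inject fun_eq_iff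
  proof (intro conjI allI, goal_cases)
    case (1 i)
    show ?case using index3_exhaust[of i]
    proof (elim disjE)
      assume "i = 1" then show ?thesis using \<alpha>1 by simp
    qed simp_all
  qed simp
  then show ?thesis unfolding TJel_def by (simp add: hat_shift)
qed

lemma vcar_TJ: "vcar (TJ C) = {TJel t b | t b. True}"
proof -
  have "hat C x \<in> {TJel t b | t b. True}" if x0: "x \<in> jordan0 C" for x
  proof -
    obtain \<alpha> a where x: "x = jel \<alpha> a" using jordan0_jordan[OF x0] by (rule jordanE)
    have "(\<Sum>i\<in>UNIV. \<alpha> i) = 0" using x0 unfolding x jordan0_jel .
    from hat_jel[OF this] show ?thesis unfolding x by blast
  qed
  moreover have "TJel t b \<in> hat C ` jordan0 C" for t b unfolding TJel_def by simp
  ultimately show ?thesis unfolding TJ_def by auto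
qed

lemma TJel_vcar [simp]: "TJel t b \<in> vcar (TJ C)"
  using vcar_TJ by blast

lemma TJel_add: "vadd (TJ C) (TJel t b) (TJel t' b') = TJel (t + t') (\<lambda>i. b i + b' i)"
  unfolding TJel_def vadd_TJ jvec_def jel_add by (rule arg_cong[of _ _ "hat C"]) (auto simp: jel_inject)

lemma TJel_scale: "vscl (TJ C) c (TJel t b) = TJel (c * t) (\<lambda>i. c \<odot> b i)"
  unfolding TJel_def vscl_TJ jvec_def jel_scale by (rule arg_cong[of _ _ "hat C"]) (auto simp: jel_inject)

lemma TJel_inject: "TJel t b = TJel t' b' \<longleftrightarrow> t = t' \<and> b = b'"
proof
  assume eq: "TJel t b = TJel t' b'"
  have "jvec t b + mat_scale C 0 (jone C) \<in> TJel t b" unfolding TJel_def hat_def by blast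
  then obtain c where "jvec t b + mat_scale C 0 (jone C) = jvec t' b' + mat_scale C c (jone C)"
    unfolding eq unfolding TJel_def hat_def by blast
  then have e: "(\<lambda>i::3. if i = 0 then t else if i = 1 then - t else 0) = (\<lambda>i. (if i = 0 then t' else if i = 1 then - t' else 0) + c)"
    and b: "b = b'"
    unfolding jvec_def jone_jel jel_scale jel_add jel_inject by simp_all
  show "t = t' \<and> b = b'" using fun_cong[OF e, of 0] fun_cong[OF e, of 2] b by simp
qed simp

lemma TJ_form_TJel: "TJ_form C (TJel t b) (TJel t' b') = (\<Sum>i\<in>UNIV. bf (b i) (b' i)) - t * t'"
  unfolding TJel_def
  by (simp add: TJ_form_hat) (simp add: jvec_def jmul_jel jtrace_jel jprod_diag_def sum_index3[of _ 0] kc_simps double_k)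

lemma TJ_comm_TJel: "TJ_comm C (TJel t b) (TJel t' b') =
    Phi (theta_sum b b') (odd_bracket t b t' b')"
proof -
  have "(if j + 2 = (0::3) then x else if j + 2 = 1 then - x else 0) - (if j + 1 = 0 then x else if j + 1 = 1 then - x else 0) = x"
    for j :: 3 and x :: 'k
    using index3_exhaust[of j] by (elim disjE) (simp_all add: double_k)
  then show ?thesis
    unfolding TJel_def by (simp add: TJ_comm_hat) (simp add: jvec_def commutator_jL odd_bracket_def)
qed

lemma TJ_act_TJel:
  assumes d: "triality d"
  shows "TJ_act C (Phi d a) (TJel t b) =
    TJel (\<Sum>i\<in>UNIV. bf (a i) (b i)) (odd_action d a t b)"
proof -
  have t: "(if j + 2 = (0::3) then x else if j + 2 = 1 then - x else 0) - (if j + 1 = 0 then x else if j + 1 = 1 then - x else 0) = x"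
    for j :: 3 and x :: 'k
    using index3_exhaust[of j] by (elim disjE) (simp_all add: double_k)
  have s: "(\<Sum>i\<in>UNIV. Phi_diag a b i) = 0" by (simp add: sum_index3[of _ 0] Phi_diag_def)
  have e: "Phi_diag a b 0 - Phi_diag a b 2 = (\<Sum>i\<in>UNIV. bf (a i) (b i))"
    by (simp add: sum_index3[of _ 0] Phi_diag_def kc_simps double_k)
  show ?thesis
    unfolding TJel_def[of t] TJ_act_hat[OF Phi_in_der[OF d] jvec_jordan]
    unfolding jvec_def Phi_jel hat_jel[OF s] e Phi_off_def odd_action_def t ..
qed

lemma hat_iota1_TJel: "hat_iota1 C = TJel 1 (\<lambda>_. 0)"
  unfolding hat_iota1_def TJel_def je_jel jel_diff jvec_def
  by (rule arg_cong[of _ _ "hat C"]) (auto simp: jel_inject)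

lemma hat_iota_TJel: "hat_iota C i s = TJel 0 (single i s)"
  unfolding hat_iota_def TJel_def jiota_jel jvec_def
  by (rule arg_cong[of _ _ "hat C"]) (auto simp: jel_inject)

end

section \<open>The symplectic plane and the superalgebra S(1,2)\<close>

locale hurwitz_plane = hurwitz_char3 C
  for C :: "('k::field, 'c::ab_group_add) superalg" +
  fixes V :: "('k, 'v::ab_group_add) plane"
  assumes symplectic: "symplectic_plane V"
begin

abbreviation vscale (infixr "\<otimes>" 75) where "c \<otimes> v \<equiv> pscl V c v"
abbreviation form where "form u v \<equiv> alt V u v"
abbreviation B where "B \<equiv> S12 V"

sublocale plane: vector_space "pscl V"
  using symplectic unfolding symplectic_plane_def by simp

lemma linear_form: "Vector_Spaces.linear (pscl V) (*) (alt V u)" "Vector_Spaces.linear (pscl V) (*) (\<lambda>u. alt V u v)"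
  using symplectic unfolding symplectic_plane_def by auto

lemmas form_linear [simp] = linear_rules[OF linear_form(1)] linear_rules[OF linear_form(2)]

lemma form_self [simp]: "form u u = 0"
  using symplectic unfolding symplectic_plane_def by simp

lemma form_swap: "form u v = - form v u"
  using form_self[of "u + v"] by (simp del: form_self add: eq_neg_iff_add_eq_0) (simp add: add.commute)

text \<open>
  Two vectors with \<open>\<langle>a|c\<rangle> = 1\<close> are independent, hence span the plane, and pairing with them reads off
  the coefficients.
\<close>

lemma symplectic_basis: "\<exists>v1 v2. form v1 v2 = 1 \<and> (\<forall>w. w = form w v2 \<otimes> v1 + form v1 w \<otimes> v2)"
proof -
  obtain a b where ab: "form a b \<noteq> 0" using symplectic unfolding symplectic_plane_def by blast
  define c where "c = inverse (form a b) \<otimes> b"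
  have ac: "form a c = 1" unfolding c_def using ab by simp
  have ne: "a \<noteq> c" using ac by auto
  have "w \<in> plane.span {a, c}" for w
  proof (rule ccontr)
    assume w: "w \<notin> plane.span {a, c}"
    have "c \<noteq> 0" using ac by auto
    have "a \<notin> plane.span {c}"
    proof
      assume "a \<in> plane.span {c}"
      then obtain m where "a = m \<otimes> c" using plane.span_singleton by blast
      then have "form a c = 0" by simp
      then show False using ac by simp
    qed
    then have "\<not> plane.dependent {a, c}" using ne \<open>c \<noteq> 0\<close> plane.independent_insert[of a "{c}"] by simp
    then have ind: "\<not> plane.dependent {w, a, c}" using w plane.independent_insert[of w "{a, c}"] plane.span_base by auto
    have "w \<noteq> a" "w \<noteq> c" using w plane.span_base by blast+
    then have c3: "card {w, a, c} = 3" using ne by simp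
    obtain S where S: "UNIV \<subseteq> plane.span S" "card S = plane.dim (UNIV :: 'v set)"
      using plane.basis_exists by metis
    then have cS: "card S = 2" using symplectic unfolding symplectic_plane_def by simp
    then have "finite S" by (metis card.infinite zero_neq_numeral)
    with plane.independent_span_bound[OF this ind] S(1) cS c3 show False by auto
  qed
  then have "\<exists>k m. w = k \<otimes> a + m \<otimes> c" for w
    unfolding plane.span_breakdown_eq[of _ a "{c}"] plane.span_singleton
    by (metis (no_types, lifting) UNIV_I add.commute diff_add_cancel imageE rangeE)
  have "w = form w c \<otimes> a + form a w \<otimes> c" for w
  proof -
    obtain k m where w: "w = k \<otimes> a + m \<otimes> c" using \<open>\<And>w. \<exists>k m. w = k \<otimes> a + m \<otimes> c\<close> by blast
    show ?thesis unfolding w by (simp add: ac)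
  qed
  then show ?thesis using ac by blast
qed

definition v1 where "v1 = (SOME v1. \<exists>v2. form v1 v2 = 1 \<and> (\<forall>w. w = form w v2 \<otimes> v1 + form v1 w \<otimes> v2))"
definition v2 where "v2 = (SOME v2. form v1 v2 = 1 \<and> (\<forall>w. w = form w v2 \<otimes> v1 + form v1 w \<otimes> v2))"

lemma basis_form [simp]: "form v1 v2 = 1" "form v2 v1 = -1" and basis_expand: "w = form w v2 \<otimes> v1 + form v1 w \<otimes> v2"
proof -
  have "\<exists>v2. form v1 v2 = 1 \<and> (\<forall>w. w = form w v2 \<otimes> v1 + form v1 w \<otimes> v2)"
    unfolding v1_def by (rule someI_ex) (rule symplectic_basis)
  then have "form v1 v2 = 1 \<and> (\<forall>w. w = form w v2 \<otimes> v1 + form v1 w \<otimes> v2)"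
    unfolding v2_def by (rule someI_ex)
  then show "form v1 v2 = 1" "w = form w v2 \<otimes> v1 + form v1 w \<otimes> v2" by auto
  then show "form v2 v1 = -1" using form_swap[of v2 v1] by simp
qed

lemma plane_eqI: "form u v2 = form w v2 \<Longrightarrow> form v1 u = form v1 w \<Longrightarrow> u = w"
  using basis_expand by metis

lemma form_coordinates: "form u w = form u v2 * form v1 w - form v1 u * form w v2"
proof -
  have "form u w = form u (form w v2 \<otimes> v1 + form v1 w \<otimes> v2)" using basis_expand[of w] by simp
  also have "\<dots> = form w v2 * form u v1 + form v1 w * form u v2" by simp
  finally show ?thesis using form_swap[of u v1] by (simp add: mult.commute)
qed

text \<open>The Plucker relation: three vectors of a plane are dependent, with the areas as coefficients.\<close>

lemma plane_identity: "form u v \<otimes> w + form v w \<otimes> u + form w u \<otimes> v = 0"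
proof (rule plane_eqI)
  show "form (form u v \<otimes> w + form v w \<otimes> u + form w u \<otimes> v) v2 = form 0 v2"
    by (simp add: form_coordinates[of u v] form_coordinates[of v w] form_coordinates[of w u]) algebra
  show "form v1 (form u v \<otimes> w + form v w \<otimes> u + form w u \<otimes> v) = form v1 0"
    by (simp add: form_coordinates[of u v] form_coordinates[of v w] form_coordinates[of w u]) algebra
qed

lemma double_plane: "x + x = - x" "x + (x + y) = y - x" for x y :: 'v
proof -
  have "x + x = 2 \<otimes> x" by (simp only: plane.scale_left_distrib[of 1 1] flip: one_add_one) simp
  then show "x + x = - x" by simp
  then show "x + (x + y) = y - x" by (simp flip: add.assoc)
qed

subsection \<open>Structure of S(1,2)\<close>

lemma unit_B12: "unit_elt (B12 V) = (1, 0)"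
proof -
  have "is_unit_elt (B12 V) (1, 0)" unfolding is_unit_elt_def B12_def by auto
  moreover have "e = (1, 0)" if "is_unit_elt (B12 V) e" for e
    using that[unfolded is_unit_elt_def, rule_format, of "(1, 0)"] by (cases e) (auto simp: B12_def)
  ultimately show ?thesis unfolding unit_elt_def by (intro the_equality) blast+
qed

lemma B_simps [simp]:
  "scl B c (a, u) = (c * a, c \<otimes> u)"
  "prt B p (a, u) = (if p = 0 then (a, 0) else (0, u))"
  "pol B (a, u) (b, v) = form u v - a * b"
  "mul B (a, u) (b, v) = (a * b + form u v, - (a \<otimes> v) - b \<otimes> u)"
proof -
  have "std_inv (B12 V) (a, u) = (a, - u)" for a u
    using double_k(1)[of "- a"] unfolding std_inv_def unit_B12 by (simp add: B12_def)
  then show "mul B (a, u) (b, v) = (a * b + form u v, - (a \<otimes> v) - b \<otimes> u)"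
    unfolding S12_def para_hurwitz_def by (simp add: B12_def)
qed (simp_all add: S12_def para_hurwitz_def B12_def)

lemma scl_B: "scl B c x = (c * fst x, c \<otimes> snd x)" by (cases x) simp
lemma prt_B: "prt B p x = (if p = 0 then (fst x, 0) else (0, snd x))" by (cases x) simp
lemma pol_B: "pol B x y = form (snd x) (snd y) - fst x * fst y" by (cases x; cases y) simp
lemma mul_B: "mul B x y = (fst x * fst y + form (snd x) (snd y), - (fst x \<otimes> snd y) - fst y \<otimes> snd x)"
  by (cases x; cases y) simp

lemma vector_space_B: "vector_space (scl B)"
  by unfold_locales (auto simp: scl_B plane.scale_right_distrib plane.scale_left_distrib distrib_left distrib_right mult.assoc)

lemma homog_B [simp]: "homog B 0 = {(a, 0) | a. True}" "homog B (Suc 0) = {(0, u) | u. True}"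
  unfolding homog_def by auto

text \<open>
  The homogeneous elements of \<open>osp(S(1,2))\<close>: \<open>ev s\<close> is \<open>s\<close> acting on the odd part, and \<open>od u\<close> is
  \<open>\<sigma>\<^sub>1\<^sub>,\<^sub>u\<close> (lemma \<open>sigma_B\<close>), where \<open>2u\<close> is written \<open>-u\<close>.
\<close>

definition ev :: "('v \<Rightarrow> 'v) \<Rightarrow> 'k \<times> 'v \<Rightarrow> 'k \<times> 'v" where
  "ev s = (\<lambda>x. (0, s (snd x)))"

definition od :: "'v \<Rightarrow> 'k \<times> 'v \<Rightarrow> 'k \<times> 'v" where
  "od u = (\<lambda>x. (- form u (snd x), - (fst x \<otimes> u)))"

lemma linear_B_iff: "Vector_Spaces.linear (scl B) (scl B) d \<longleftrightarrow>
    (\<forall>x y. d (x + y) = d x + d y) \<and> (\<forall>c x. d (scl B c x) = scl B c (d x))"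
  unfolding Vector_Spaces.linear_iff using vector_space_B by simp

lemma linear_V_iff: "Vector_Spaces.linear (pscl V) (pscl V) s \<longleftrightarrow>
    (\<forall>x y. s (x + y) = s x + s y) \<and> (\<forall>c x. s (c \<otimes> x) = c \<otimes> s x)"
  unfolding Vector_Spaces.linear_iff using plane.vector_space_axioms by simp

lemma sp_linear: "s \<in> sp V \<Longrightarrow> Vector_Spaces.linear (pscl V) (pscl V) s"
  and sp_skew: "s \<in> sp V \<Longrightarrow> form (s u) v = - form u (s v)"
  unfolding sp_def by (auto simp: eq_neg_iff_add_eq_0)

lemmas sp_rules = linear_rules[OF sp_linear]

lemma ev_osp: "s \<in> sp V \<Longrightarrow> ev s \<in> osp_homog B 0"
  unfolding osp_homog_def linear_B_iff
  by (auto simp: less_2_cases_iff ev_def pol_B scl_B sp_rules sp_skew)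

lemma od_osp: "od u \<in> osp_homog B (Suc 0)"
  unfolding osp_homog_def linear_B_iff
  by (auto simp: less_2_cases_iff od_def pol_B scl_B plane.scale_left_distrib form_swap[of _ u] algebra_simps)

lemma osp_even_B:
  assumes "d \<in> osp_homog B 0"
  shows "\<exists>s \<in> sp V. d = ev s"
proof -
  have lin: "d (x + y) = d x + d y" "d (scl B c x) = scl B c (d x)" for x y c
    using assms unfolding osp_homog_def linear_B_iff by blast+
  have hom: "r < 2 \<Longrightarrow> x \<in> homog B r \<Longrightarrow> d x \<in> homog B ((0 + r) mod 2)" for r x
    using assms unfolding osp_homog_def by blast
  have skew: "r < 2 \<Longrightarrow> x \<in> homog B r \<Longrightarrow> pol B (d x) y + (-1) ^ (0 * r) * pol B x (d y) = 0" for r x y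
    using assms unfolding osp_homog_def by blast
  obtain c where c: "d (1, 0) = (c, 0)" using hom[of 0 "(1, 0)"] by auto
  have "c = 0" using skew[of 0 "(1, 0)" "(1, 0)"] double_k(1)[of "-c"] by (simp add: c)
  define s where "s u = snd (d (0, u))" for u
  have ds: "d (0, u) = (0, s u)" for u using hom[of 1 "(0, u)"] by (auto simp: s_def)
  have da: "d (a, 0) = 0" for a
    using lin(2)[of a "(1, 0)"] c \<open>c = 0\<close> by (simp add: zero_prod_def)
  have "d = ev s"
  proof
    fix x :: "'k \<times> 'v"
    obtain a u where x: "x = (a, u)" by (cases x)
    show "d x = ev s x" using lin(1)[of "(a, 0)" "(0, u)"] da ds unfolding x ev_def by simp
  qed
  moreover have "s \<in> sp V"
    unfolding sp_def linear_V_iff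
    using lin(1)[of "(0, _)" "(0, _)"] lin(2)[of _ "(0, _)"] skew[of 1 "(0, _)" "(0, _)"] by (simp add: ds)
  ultimately show ?thesis by blast
qed

lemma osp_odd_B:
  assumes "d \<in> osp_homog B (Suc 0)"
  shows "\<exists>u. d = od u"
proof -
  have lin: "d (x + y) = d x + d y" "d (scl B c x) = scl B c (d x)" for x y c
    using assms unfolding osp_homog_def linear_B_iff by blast+
  have hom: "r < 2 \<Longrightarrow> x \<in> homog B r \<Longrightarrow> d x \<in> homog B ((Suc 0 + r) mod 2)" for r x
    using assms unfolding osp_homog_def by blast
  have skew: "r < 2 \<Longrightarrow> x \<in> homog B r \<Longrightarrow> pol B (d x) y + (-1) ^ (Suc 0 * r) * pol B x (d y) = 0" for r x y
    using assms unfolding osp_homog_def by blast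
  obtain w where w: "d (1, 0) = (0, w)" using hom[of 0 "(1, 0)"] by auto
  define u where "u = - w"
  have da: "d (a, 0) = (0, - (a \<otimes> u))" for a
    using lin(2)[of a "(1, 0)"] w by (simp add: u_def)
  have dv: "d (0, v) = (- form u v, 0)" for v
  proof -
    obtain c where c: "d (0, v) = (c, 0)" using hom[of 1 "(0, v)"] by auto
    then show ?thesis using skew[of 0 "(1, 0)" "(0, v)"] by (simp add: w u_def)
  qed
  have "d = od u"
  proof
    fix x :: "'k \<times> 'v"
    obtain a v where x: "x = (a, v)" by (cases x)
    show "d x = od u x" using lin(1)[of "(a, 0)" "(0, v)"] da dv unfolding x od_def by simp
  qed
  then show ?thesis by blast
qed

text \<open>
  The triality identity with one argument equal to \<open>1\<close> forces the three entries to agree.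
\<close>

lemma tri_homog_B_even: "tri_homog B 0 = {\<lambda>_. ev s | s. s \<in> sp V}"
proof (intro set_eqI iffI)
  fix d
  assume d: "d \<in> tri_homog B 0"
  then have "\<exists>s \<in> sp V. d i = ev s" for i by (intro osp_even_B) (auto simp: tri_homog_def)
  then obtain s where s: "\<And>i. s i \<in> sp V" "\<And>i. d i = ev (s i)" by metis
  have tri: "\<lbrakk>r < 2; x \<in> homog B r\<rbrakk> \<Longrightarrow> d 0 (mul B x y) = mul B (d 1 x) y + scl B ((-1) ^ (0 * r)) (mul B x (d 2 y))" for r x y
    using d unfolding tri_homog_def by blast
  have "s 0 u = s 2 u" for u
    using tri[of 0 "(1, 0)" "(0, u)"] by (simp add: s ev_def sp_rules[OF s(1)])
  moreover have "s 0 u = s 1 u" for u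
    using tri[of 1 "(0, u)" "(1, 0)"] by (simp add: s ev_def sp_rules[OF s(1)])
  ultimately have "d i = ev (s 0)" for i
    using index3_exhaust[of i] s(2) by (metis ext)
  then show "d \<in> {\<lambda>_. ev s | s. s \<in> sp V}" using s(1) by blast
next
  fix d :: "3 \<Rightarrow> 'k \<times> 'v \<Rightarrow> 'k \<times> 'v"
  assume "d \<in> {\<lambda>_. ev s | s. s \<in> sp V}"
  then obtain s where s: "s \<in> sp V" "d = (\<lambda>_. ev s)" by blast
  show "d \<in> tri_homog B 0"
    unfolding tri_homog_def s(2) using ev_osp[OF s(1)]
    by (auto simp: less_2_cases_iff ev_def sp_rules[OF s(1)] sp_skew[OF s(1)])
qed

text \<open>
  With entries \<open>\<sigma>\<^sub>1\<^sub>,\<^sub>u\<close> for vectors \<open>u\<^sub>0\<close>, \<open>u\<^sub>1\<close>, \<open>u\<^sub>2\<close>, the triality identity at \<open>(1, 1)\<close> gives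
  \<open>u\<^sub>0 = -u\<^sub>1 - u\<^sub>2\<close> and at \<open>(v, v)\<close> gives \<open>u\<^sub>1 = u\<^sub>2\<close>, so all three agree as \<open>-2 = 1\<close>. For equal vectors the
  identity on odd arguments is the Plucker relation.
\<close>

lemma tri_homog_B_odd: "tri_homog B (Suc 0) = {\<lambda>_. od u | u. True}"
proof (intro set_eqI iffI)
  fix d
  assume d: "d \<in> tri_homog B (Suc 0)"
  then have "\<exists>u. d i = od u" for i by (intro osp_odd_B) (auto simp: tri_homog_def)
  then obtain u where u: "\<And>i. d i = od (u i)" by metis
  have tri: "\<lbrakk>r < 2; x \<in> homog B r\<rbrakk> \<Longrightarrow> d 0 (mul B x y) = mul B (d 1 x) y + scl B ((-1) ^ (Suc 0 * r)) (mul B x (d 2 y))" for r x y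
    using d unfolding tri_homog_def by blast
  have "- u 0 = u 1 + u 2"
    using tri[of 0 "(1, 0)" "(1, 0)"] by (simp add: u od_def)
  then have 0: "u 0 = - u 1 - u 2" by (metis minus_add_distrib minus_minus diff_conv_add_uminus)
  have "form (u 1) v = form (u 2) v" for v
  proof (cases "v = 0")
    case False
    have "form (u 1) v \<otimes> v = form (u 2) v \<otimes> v"
      using tri[of 1 "(0, v)" "(0, v)"] by (simp add: u od_def form_swap[of v])
    then show ?thesis using False by simp
  qed simp
  then have 12: "u 1 = u 2" by (intro plane_eqI) (simp_all add: form_swap[of v1])
  then have "u 0 = u 2" using 0 double_plane(1)[of "- u 2"] by simp
  then have "d i = od (u 2)" for i using index3_exhaust[of i] u 12 by auto
  then show "d \<in> {\<lambda>_. od u | u. True}" by blast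
next
  fix d :: "3 \<Rightarrow> 'k \<times> 'v \<Rightarrow> 'k \<times> 'v"
  assume "d \<in> {\<lambda>_. od u | u. True}"
  then obtain u where u: "d = (\<lambda>_. od u)" by blast
  have "form v w \<otimes> u = - (form u v \<otimes> w) - form w u \<otimes> v" for v w
    using plane_identity[of v w u] by (simp add: eq_diff_eq eq_neg_iff_add_eq_0 algebra_simps)
  then show "d \<in> tri_homog B (Suc 0)"
    unfolding tri_homog_def u using od_osp
    by (auto simp: less_2_cases_iff od_def form_swap[of _ u] plane.scale_left_distrib plane.scale_right_distrib algebra_simps double_plane double_k)
qed

lemma sigma_B: "sigma B (1, 0) (0, u) = od u"
  unfolding sigma_def od_def by (auto simp: sum_lessThan_2 fun_eq_iff)

section \<open>The bracket of g(S(1,2), S)\<close>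

declare split_paired_All [simp del] split_paired_Ex [simp del]

abbreviation tt where "tt x a \<equiv> tn B S x a"
abbreviation TT where "TT \<equiv> tensor_space (vs_of B) (vs_of S)"
abbreviation lift where "lift f t \<equiv> tensor_lift (vs_of B) (vs_of S) f t"
abbreviation lift2 where "lift2 F t u \<equiv> tensor_lift2 (vs_of B) (vs_of S) F t u"

lemma vs_of_simps [simp]: "vcar (vs_of X) = UNIV" "vadd (vs_of X) = (+)" "vscl (vs_of X) = scl X"
  by (simp_all add: vs_of_def)

lemma bilinear_BSI:
  assumes "vector_space sc" "\<And>x y a. f (x + y) a = f x a + f y a" "\<And>x a b. f x (a + b) = f x a + f x b"
    "\<And>c x a. f (scl B c x) a = sc c (f x a)" "\<And>c x a. f x (c \<odot> a) = sc c (f x a)"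
  shows "bilinear_map (vs_of B) (vs_of S) sc f"
  using assms unfolding bilinear_map_def by simp

lemma tt_bilinear: "bilinear_map (vs_of B) (vs_of S) tensor_scale (\<lambda>x a. tt x a)"
  unfolding tn_def by (rule bilinear_map_tens)

lemma tt_add: "tt (x + y) a = tt x a + tt y a" "tt x (a + b) = tt x a + tt x b"
  and tt_scale: "tt (scl B c x) a = tensor_scale c (tt x a)" "tt x (c \<odot> a) = tensor_scale c (tt x a)"
  using tt_bilinear unfolding bilinear_map_def by simp_all

lemma tt_0 [simp]: "tt 0 a = 0" "tt x 0 = 0"
  using tt_add(1)[of 0 0 a] tt_add(2)[of x 0 0] by simp_all

lemma tt_minus: "tt (- x) a = - tt x a" "tt x (- a) = - tt x a"
  using tt_add(1)[of "- x" x a] tt_add(2)[of x "- a" a] by (simp_all add: eq_neg_iff_add_eq_0 flip: tt_add)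

lemma tt_diff: "tt (x - y) a = tt x a - tt y a" "tt x (a - b) = tt x a - tt x b"
  using tt_add(1)[of x "- y" a] tt_add(2)[of x a "- b"] by (simp_all add: tt_minus)

lemma tt_TT [simp]: "tt x a \<in> TT"
  unfolding tn_def by (rule tensor_space_tens) simp_all

lemma TT_add [simp]: "s \<in> TT \<Longrightarrow> t \<in> TT \<Longrightarrow> s + t \<in> TT" and TT_0 [simp]: "0 \<in> TT"
  unfolding tensor_space_def by (rule tensor_span_add tensor_span_0; assumption)+

lemma TT_induct [consumes 1, case_names zero add]:
  assumes "t \<in> TT" "P 0" "\<And>x a s. s \<in> TT \<Longrightarrow> P s \<Longrightarrow> P (tt x a + s)"
  shows "P t"
  using assms(1) unfolding tensor_space_def
proof (induction rule: tensor_span_induct)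
  case (add x a s) then show ?case using assms(3)[of s x a] unfolding tensor_space_def tn_def by blast
qed (rule assms(2))

lemma lift_tt: "bilinear_map (vs_of B) (vs_of S) sc f \<Longrightarrow> lift f (tt x a) = f x a"
  unfolding tn_def by (rule tensor_lift_tens) simp_all

lemma lift2_tt: "quadrilinear_map (vs_of B) (vs_of S) sc F \<Longrightarrow> lift2 F (tt x a) (tt y b) = F x a y b"
  unfolding tn_def by (rule tensor_lift2_tens) simp_all

lemma tensor_scale_linear: "tensor_scale c (s + t) = tensor_scale c s + tensor_scale c t"
  "tensor_scale c 0 = 0" "tensor_scale 1 s = s" "tensor_scale (-1) s = - s"
  unfolding tensor_scale_def by (auto simp: fun_eq_iff distrib_left)

lemma TT_scale [simp]: "t \<in> TT \<Longrightarrow> tensor_scale c t \<in> TT"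
proof (induction t rule: TT_induct)
  case zero then show ?case unfolding tensor_scale_linear by (rule TT_0)
next
  case (add x a s) then show ?case unfolding tensor_scale_linear tt_scale(1)[symmetric] by (intro TT_add tt_TT)
qed

subsection \<open>Simplified kernels\<close>

text \<open>Since \<open>S\<close> is even, all signs in the kernels that involve a parity of \<open>S\<close> disappear.\<close>

lemma prt_B_linear: "prt B p (x + y) = prt B p x + prt B p y" "prt B p (scl B c x) = scl B c (prt B p x)"
  by (simp_all add: prt_B scl_B)

lemma tensor_prt_kernel: "p < 2 \<Longrightarrow> tensor_prt B S p = lift (\<lambda>x a. tt (prt B p x) a)"
  unfolding tensor_prt_def tlift_def by (auto simp: less_2_cases_iff sum_lessThan_2)

lemma tensor_prt_bilinear: "bilinear_map (vs_of B) (vs_of S) tensor_scale (\<lambda>x a. tt (prt B p x) a)"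
  by (rule bilinear_BSI) (simp_all add: vector_space_tensor_scale prt_B_linear tt_add tt_scale)

abbreviation linB where "linB d \<equiv> Vector_Spaces.linear (scl B) (scl B) d"

lemma act1_kernel: "act1 B S d = lift (\<lambda>x a. tt (d x) a)"
  unfolding act1_def tlift_def ..

lemma act1_bilinear: "linB d \<Longrightarrow> bilinear_map (vs_of B) (vs_of S) tensor_scale (\<lambda>x a. tt (d x) a)"
  by (rule bilinear_BSI) (simp_all add: vector_space_tensor_scale linear_B_iff tt_add tt_scale)

lemma act2_kernel:
  assumes "linC d" shows "act2 B S d = lift (\<lambda>x a. tt x (d a))"
proof -
  have 0: "d 0 = 0" using assms by (rule linear_rules)
  have "tt (fst x, 0) y + tt (0, snd x) y = tt x y" for x y
    using tt_add(1)[of "(fst x, 0)" "(0, snd x)" y] by simp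
  then show ?thesis
    unfolding act2_def tlift_def
    by (simp add: sum_lessThan_2 endo_prt_C[of d, OF 0] tensor_scale_linear prt_B)
qed

lemma act2_bilinear: "linC d \<Longrightarrow> bilinear_map (vs_of B) (vs_of S) tensor_scale (\<lambda>x a. tt x (d a))"
  by (rule bilinear_BSI) (simp_all add: vector_space_tensor_scale linear_rules[of "scl C" tensor_scale] linear_rules[where f=d] tt_add tt_scale)

lemma mul_B_linear: "mul B (x + y) z = mul B x z + mul B y z" "mul B z (x + y) = mul B z x + mul B z y"
  "mul B (scl B c x) z = scl B c (mul B x z)" "mul B z (scl B c x) = scl B c (mul B z x)"
  by (simp_all add: mul_B scl_B plane.scale_left_distrib plane.scale_right_distrib algebra_simps
     plane.scale_right_diff_distrib mult.commute)

lemma tmul_kernel: "tmul B S = lift2 (\<lambda>x a y b. tt (mul B x y) (a \<diamondop> b))"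
proof -
  have "tt (mul B x (fst y, 0)) a + tt (mul B x (0, snd y)) a = tt (mul B x y) a" for x y a
    using mul_B_linear(2)[of x "(fst y, 0)" "(0, snd y)"] by (simp flip: tt_add)
  then show ?thesis
    unfolding tmul_def tlift_def tensor_lift2_def
    by (intro ext) (simp add: sum_lessThan_2 tensor_scale_linear prt_B)
qed

lemma tmul_quadrilinear: "quadrilinear_map (vs_of B) (vs_of S) tensor_scale (\<lambda>x a y b. tt (mul B x y) (a \<diamondop> b))"
  unfolding quadrilinear_map_def
  by (intro conjI ballI bilinear_BSI vector_space_tensor_scale) (simp_all add: mul_B_linear tt_add tt_scale)

text \<open>\<open>t12 x y\<close> is the common entry of the triple \<open>t\<^sub>x\<^sub>,\<^sub>y\<close> of S(1,2), for arbitrary \<open>x\<close> and \<open>y\<close>.\<close>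

definition t12 :: "'k \<times> 'v \<Rightarrow> 'k \<times> 'v \<Rightarrow> 'k \<times> 'v \<Rightarrow> 'k \<times> 'v" where
  "t12 x y z = od (fst x \<otimes> snd y - fst y \<otimes> snd x) z - (0, gam V (snd x) (snd y) (snd z))"

lemma gam_linear: "gam V (u + u') v w = gam V u v w + gam V u' v w" "gam V u (v + v') w = gam V u v w + gam V u v' w"
  "gam V (c \<otimes> u) v w = c \<otimes> gam V u v w" "gam V u (c \<otimes> v) w = c \<otimes> gam V u v w"
  by (simp_all add: gam_def plane.scale_left_distrib plane.scale_right_distrib algebra_simps mult.commute)

lemma od_linear: "od (u + u') z = od u z + od u' z" "od (u - u') z = od u z - od u' z" "od (c \<otimes> u) z = scl B c (od u z)"
  by (simp_all add: od_def scl_B plane.scale_right_distrib plane.scale_right_diff_distrib mult.commute)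

lemma t12_linear: "t12 (x + x') y z = t12 x y z + t12 x' y z" "t12 x (y + y') z = t12 x y z + t12 x y' z"
  "t12 (scl B c x) y z = scl B c (t12 x y z)" "t12 x (scl B c y) z = scl B c (t12 x y z)"
  by (simp_all add: t12_def gam_linear od_def scl_B plane.scale_left_distrib plane.scale_right_distrib
      plane.scale_right_diff_distrib algebra_simps mult.commute)

text \<open>
  The three entries agree; for two odd vectors this is the Plucker relation.
\<close>

lemma tri_elt_B_parts:
  "tri_elt B (a, 0) (b, 0) i = 0"
  "tri_elt B (a, 0) (0, v) i = od (a \<otimes> v)"
  "tri_elt B (0, u) (b, 0) i = od (- (b \<otimes> u))"
  "tri_elt B (0, u) (0, v) i = (\<lambda>z. - (0, gam V u v (snd z)))"
proof -
  have id: "form v w \<otimes> u = - (form u v \<otimes> w) - form w u \<otimes> v" for w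
    using plane_identity[of u v w] by (simp add: eq_diff_eq eq_neg_iff_add_eq_0 algebra_simps)
  have id': "form w v \<otimes> u = form u v \<otimes> w - form u w \<otimes> v" for w
    using plane_identity[of u v w] by (simp add: form_swap[of w v] form_swap[of w u] eq_diff_eq eq_neg_iff_add_eq_0 algebra_simps)
  note defs = tri_elt_def sigma_def lft_def rgt_def sum_lessThan_2 fun_eq_iff od_def gam_def
  show "tri_elt B (a, 0) (b, 0) i = 0"
    using index3_exhaust[of i] by (elim disjE) (simp_all add: defs zero_prod_def split_paired_All plane.scale_left_distrib algebra_simps double_k double_plane)
  show "tri_elt B (a, 0) (0, v) i = od (a \<otimes> v)"
    using index3_exhaust[of i] by (elim disjE) (simp_all add: defs split_paired_All form_swap[of v] algebra_simps double_k double_plane)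
  show "tri_elt B (0, u) (b, 0) i = od (- (b \<otimes> u))"
    using index3_exhaust[of i] by (elim disjE) (simp_all add: defs split_paired_All form_swap[of u] algebra_simps double_k double_plane)
  show "tri_elt B (0, u) (0, v) i = (\<lambda>z. - (0, gam V u v (snd z)))"
    using index3_exhaust[of i] form_swap[of v u]
    by (elim disjE) (simp_all add: defs split_paired_All id id' form_swap[of _ u] algebra_simps double_k double_plane)
qed

lemma ttri1_kernel: "ttri1 B S = lift2 (\<lambda>x a y b i z. scl B (bf a b) (t12 x y z))"
proof -
  have sc: "scl B c (x + y) = scl B c x + scl B c y" for c x y by (simp add: scl_B plane.scale_right_distrib distrib_left)
  have "scl B c (tri_elt B (fst x, 0) (fst y, 0) i z) + scl B c (tri_elt B (fst x, 0) (0, snd y) i z)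
      + (scl B c (tri_elt B (0, snd x) (fst y, 0) i z) + scl B c (tri_elt B (0, snd x) (0, snd y) i z)) = scl B c (t12 x y z)" for c x y i z
    by (simp only: tri_elt_B_parts flip: sc) (simp add: t12_def od_def plane.scale_right_diff_distrib)
  moreover have "scl B 0 z = 0" for z by (simp add: scl_B zero_prod_def)
  ultimately show ?thesis
    unfolding ttri1_def tlift_def tensor_lift2_def
    by (intro ext) (simp add: sum_lessThan_2 prt_B)
qed

lemma vector_space_triple: "vector_space sc \<Longrightarrow> vector_space (\<lambda>c (d :: 'i \<Rightarrow> 'j \<Rightarrow> 'w::ab_group_add) i z. sc c (d i z))"
  using vector_space_fun[OF vector_space_fun] .

lemma ttri1_quadrilinear: "quadrilinear_map (vs_of B) (vs_of S) (\<lambda>c d i z. scl B c (d i z)) (\<lambda>x a y b (i :: 3) z. scl B (bf a b) (t12 x y z))"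
proof -
  interpret vB: vector_space "scl B" by (rule vector_space_B)
  show ?thesis
    unfolding quadrilinear_map_def
    by (intro conjI ballI bilinear_BSI vector_space_triple vector_space_B)
       (simp_all add: fun_eq_iff t12_linear vB.scale_left_distrib vB.scale_right_distrib mult.commute)
qed

lemma tri_elt_S_linear:
  "tri_elt S (x + x') y i z = tri_elt S x y i z + tri_elt S x' y i z"
  "tri_elt S x (y + y') i z = tri_elt S x y i z + tri_elt S x y' i z"
  "tri_elt S (c \<odot> x) y i z = c \<odot> tri_elt S x y i z" "tri_elt S x (c \<odot> y) i z = c \<odot> tri_elt S x y i z"
  using index3_exhaust[of i] by (auto simp: tri_elt_simps kc_simps)

lemma pol_B_linear: "pol B (x + x') y = pol B x y + pol B x' y" "pol B x (y + y') = pol B x y + pol B x y'"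
  "pol B (scl B c x) y = c * pol B x y" "pol B x (scl B c y) = c * pol B x y"
  by (simp_all add: pol_B scl_B algebra_simps)

lemma ttri2_kernel: "ttri2 B S = lift2 (\<lambda>x a y b i z. pol B x y \<odot> tri_elt S a b i z)"
proof -
  have "tri_elt S 0 b i z = 0" for b i z
    using tri_elt_S_linear(1)[of 0 0 b i z] by simp
  moreover have "pol B x (fst y, 0) \<odot> w + pol B x (0, snd y) \<odot> w = pol B x y \<odot> w" for x y w
    by (simp add: pol_B scale_left_diff_distrib)
  ultimately show ?thesis
    unfolding ttri2_def tlift_def tensor_lift2_def
    by (intro ext) (simp add: sum_lessThan_2 prt_B)
qed

lemma ttri2_quadrilinear: "quadrilinear_map (vs_of B) (vs_of S) (\<lambda>c d i z. c \<odot> d i z) (\<lambda>x a y b (i :: 3) z. pol B x y \<odot> tri_elt S a b i z)"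
  unfolding quadrilinear_map_def
  by (intro conjI ballI bilinear_BSI vector_space_triple vector_space_axioms)
     (simp_all add: fun_eq_iff tri_elt_S_linear pol_B_linear kc_simps)

subsection \<open>Biadditivity\<close>

lemma scl_B_add: "scl B c (x + y) = scl B c x + scl B c y"
  by (simp add: scl_B plane.scale_right_distrib distrib_left)

lemma lift_TT:
  assumes f: "bilinear_map (vs_of B) (vs_of S) sc f" and TT: "\<And>x a. f x a \<in> TT" and t: "t \<in> TT"
  shows "lift f t \<in> TT"
  using t
proof (induction t rule: TT_induct)
  case zero
  show ?case using tensor_lift_0[OF f] by (metis TT_0)
next
  case (add x a s)
  have "lift f (tt x a + s) = f x a + lift f s"
    unfolding tensor_lift_add[OF f tt_TT add(1)] lift_tt[OF f] ..
  then show ?case using TT_add[OF TT add(2), of x a] by metis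
qed

lemma act1_add_left: "linB d \<Longrightarrow> linB e \<Longrightarrow> t \<in> TT \<Longrightarrow>
    act1 B S (\<lambda>x. d x + e x) t = act1 B S d t + act1 B S e t"
  unfolding act1_kernel tt_add(1) by (rule tensor_lift_add_map[OF act1_bilinear act1_bilinear])

lemma act1_add_right: "linB d \<Longrightarrow> s \<in> TT \<Longrightarrow> t \<in> TT \<Longrightarrow>
    act1 B S d (s + t) = act1 B S d s + act1 B S d t"
  unfolding act1_kernel by (rule tensor_lift_add[OF act1_bilinear])

lemma linC_add: "linC d \<Longrightarrow> linC e \<Longrightarrow> linC (\<lambda>x. d x + e x)"
  unfolding Vector_Spaces.linear_iff by (auto simp: kc_simps)

lemma linB_add: "linB d \<Longrightarrow> linB e \<Longrightarrow> linB (\<lambda>x. d x + e x)"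
  unfolding linear_B_iff by (simp add: scl_B plane.scale_right_distrib distrib_left algebra_simps)

lemma act2_add_left:
  assumes "linC d" "linC e" "t \<in> TT"
  shows "act2 B S (\<lambda>x. d x + e x) t = act2 B S d t + act2 B S e t"
  unfolding act2_kernel[OF assms(1)] act2_kernel[OF assms(2)] act2_kernel[OF linC_add[OF assms(1,2)]] tt_add(2)
  by (rule tensor_lift_add_map[OF act2_bilinear[OF assms(1)] act2_bilinear[OF assms(2)] assms(3)])

lemma act2_add_right: "linC d \<Longrightarrow> s \<in> TT \<Longrightarrow> t \<in> TT \<Longrightarrow>
    act2 B S d (s + t) = act2 B S d s + act2 B S d t"
  by (simp only: act2_kernel) (rule tensor_lift_add[OF act2_bilinear])

lemma tensor_prt_add: "p < 2 \<Longrightarrow> s \<in> TT \<Longrightarrow> t \<in> TT \<Longrightarrow> tensor_prt B S p (s + t) = tensor_prt B S p s + tensor_prt B S p t"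
  unfolding tensor_prt_kernel by (rule tensor_lift_add[OF tensor_prt_bilinear])

lemma tensor_prt_TT [simp]: "p < 2 \<Longrightarrow> t \<in> TT \<Longrightarrow> tensor_prt B S p t \<in> TT"
  unfolding tensor_prt_kernel by (rule lift_TT[OF tensor_prt_bilinear]) simp_all

lemma endo_prt_B_add: "endo_prt B p (\<lambda>x. d x + e x) = (\<lambda>x. endo_prt B p d x + endo_prt B p e x)"
  unfolding endo_prt_def by (simp add: fun_eq_iff sum_lessThan_2 prt_B_linear algebra_simps)

lemma endo_prt_B_linear: "linB d \<Longrightarrow> linB (endo_prt B p d)"
  unfolding linear_B_iff endo_prt_def by (simp add: sum_lessThan_2 prt_B_linear algebra_simps scl_B_add)

lemma endo_prt_S: "linC d \<Longrightarrow> p < 2 \<Longrightarrow> endo_prt S p d = (if p = 0 then d else 0)"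
  using endo_prt_C[of d p] linear_rules(5)[of "scl C" "scl C" d] by (auto simp: less_2_cases_iff)

lemma act2_0: "t \<in> TT \<Longrightarrow> act2 B S 0 t = 0"
proof -
  assume t: "t \<in> TT"
  have "linC (\<lambda>x. 0)" unfolding Vector_Spaces.linear_iff using vector_space_axioms by simp
  from act2_add_left[OF this this t] show ?thesis by (simp add: zero_fun_def)
qed

lemma super_commutator_S:
  assumes "linC d" "linC e"
  shows "super_commutator S d e = (\<lambda>x. d (e x) - e (d x))"
  using linear_rules(5)[OF assms(1)] linear_rules(5)[OF assms(2)]
  unfolding super_commutator_def by (simp add: fun_eq_iff sum_lessThan_2 endo_prt_C)

lemma super_commutator_B_add:
  assumes "linB d" "linB d'" "linB e"
  shows "super_commutator B (\<lambda>x. d x + d' x) e = (\<lambda>x. super_commutator B d e x + super_commutator B d' e x)" (is ?A)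
    "super_commutator B e (\<lambda>x. d x + d' x) = (\<lambda>x. super_commutator B e d x + super_commutator B e d' x)" (is ?B)
proof -
  have l: "endo_prt B p e (x + y) = endo_prt B p e x + endo_prt B p e y" for p x y
    using endo_prt_B_linear[OF assms(3), of p] unfolding linear_B_iff by blast
  show "?A"
    "?B"
    unfolding super_commutator_def endo_prt_B_add l scl_B_add
    by (simp_all add: fun_eq_iff sum_lessThan_2 algebra_simps)
qed

text \<open>The elements on which the bracket is biadditive: linear entries, and tensors rather than arbitrary functionals.\<close>

definition W :: "('k, 'k \<times> 'v, 'c) gelt set" where
  "W = {(d, d', T). (\<forall>i. linB (d i)) \<and> (\<forall>i. linC (d' i)) \<and> (\<forall>i. T i \<in> TT)}"

lemma W_cases:
  assumes "x \<in> W"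
  obtains d d' T where "x = (d, d', T)" "\<And>i. linB (d i)" "\<And>i. linC (d' i)" "\<And>i. T i \<in> TT"
  using assms unfolding W_def by blast

lemma W_I: "(\<And>i. linB (d i)) \<Longrightarrow> (\<And>i. linC (d' i)) \<Longrightarrow> (\<And>i. T i \<in> TT) \<Longrightarrow> (d, d', T) \<in> W"
  unfolding W_def by blast

lemma triple_add: "(d, d', T) + (e, e', U) = (\<lambda>i x. d i x + e i x, \<lambda>i x. d' i x + e' i x, \<lambda>i. T i + U i)"
  by (simp add: fun_eq_iff)

lemma theta_pow_add: "theta_pow i (d + e) = theta_pow i d + theta_pow i e"
  unfolding theta_pow_def by (simp add: fun_eq_iff)

lemmas tmul_add = tensor_lift2_add_left[OF tmul_quadrilinear] tensor_lift2_add_right[OF tmul_quadrilinear]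
lemmas ttri1_add = tensor_lift2_add_left[OF ttri1_quadrilinear] tensor_lift2_add_right[OF ttri1_quadrilinear]
lemmas ttri2_add = tensor_lift2_add_left[OF ttri2_quadrilinear] tensor_lift2_add_right[OF ttri2_quadrilinear]

text \<open>
  The Koszul sign of the parities \<open>p\<close> and \<open>q\<close>, as an operator on tensors.
\<close>

definition odd_sign where
  "odd_sign p q = tensor_scale ((-1) ^ (p * q))"

lemma odd_sign_add: "odd_sign p q (s + t) = odd_sign p q s + odd_sign p q t"
  unfolding odd_sign_def by (rule tensor_scale_linear)

text \<open>
  The terms of the bracket that come from the defining formulas with the two arguments exchanged,
  one for each pair of parities.
\<close>

definition act1_rev where
  "act1_rev f T = (\<Sum>p<2. \<Sum>q<2. odd_sign p q (act1 B S (endo_prt B q f) (tensor_prt B S p T)))"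

definition act2_rev where
  "act2_rev f T = (\<Sum>p<2. act2 B S f (tensor_prt B S p T))"

definition tmul_rev where
  "tmul_rev U T = (\<Sum>p<2. \<Sum>q<2. odd_sign p q (tmul B S (tensor_prt B S q U) (tensor_prt B S p T)))"

lemma act1_rev_add:
  "linB f \<Longrightarrow> T \<in> TT \<Longrightarrow> U \<in> TT \<Longrightarrow> act1_rev f (T + U) = act1_rev f T + act1_rev f U"
  "linB f \<Longrightarrow> linB g \<Longrightarrow> T \<in> TT \<Longrightarrow> act1_rev (\<lambda>x. f x + g x) T = act1_rev f T + act1_rev g T"
  unfolding act1_rev_def sum.distrib[symmetric] endo_prt_B_add
  by (intro sum.cong refl, simp only: lessThan_iff tensor_prt_add act1_add_left act1_add_right endo_prt_B_linear odd_sign_add tensor_prt_TT)+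

lemma act2_rev_add:
  "linC f \<Longrightarrow> T \<in> TT \<Longrightarrow> U \<in> TT \<Longrightarrow> act2_rev f (T + U) = act2_rev f T + act2_rev f U"
  "linC f \<Longrightarrow> linC g \<Longrightarrow> T \<in> TT \<Longrightarrow> act2_rev (\<lambda>x. f x + g x) T = act2_rev f T + act2_rev g T"
  unfolding act2_rev_def sum.distrib[symmetric]
  by (intro sum.cong refl, simp only: lessThan_iff tensor_prt_add act2_add_left act2_add_right tensor_prt_TT)+

lemma tmul_rev_add:
  "U \<in> TT \<Longrightarrow> T \<in> TT \<Longrightarrow> T' \<in> TT \<Longrightarrow> tmul_rev U (T + T') = tmul_rev U T + tmul_rev U T'"
  "U \<in> TT \<Longrightarrow> U' \<in> TT \<Longrightarrow> T \<in> TT \<Longrightarrow> tmul_rev (U + U') T = tmul_rev U T + tmul_rev U' T"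
  unfolding tmul_rev_def sum.distrib[symmetric]
  by (intro sum.cong refl, simp only: lessThan_iff tmul_kernel tensor_prt_add tmul_add odd_sign_add tensor_prt_TT)+

definition tensor_part where
  "tensor_part d d' T e e' U j = act1 B S (d j) (U j) + act2 B S (d' j) (U j) - act1_rev (e j) (T j) - act2_rev (e' j) (T j)
     + tmul B S (T (j + 1)) (U (j + 2)) - tmul_rev (U (j + 1)) (T (j + 2))"

lemma g_bracket_W:
  assumes "\<And>i. linC (d' i)" "\<And>i. linC (e' i)" "\<And>i. T i \<in> TT"
  shows "g_bracket B S (d, d', T) (e, e', U) =
     (\<lambda>i x. super_commutator B (d i) (e i) x + (\<Sum>l\<in>UNIV. theta_pow l (ttri1 B S (T l) (U l))) i x,
      \<lambda>i x. d' i (e' i x) - e' i (d' i x) + (\<Sum>l\<in>UNIV. theta_pow l (ttri2 B S (T l) (U l))) i x,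
      tensor_part d d' T e e' U)"
proof -
  have "(\<Sum>p<2. \<Sum>q<2. odd_sign p q (act1 B S (endo_prt B q (e j)) (tensor_prt B S p (T j)) + act2 B S (endo_prt S q (e' j)) (tensor_prt B S p (T j))))
    = (\<Sum>p<2. \<Sum>q<2. odd_sign p q (act1 B S (endo_prt B q (e j)) (tensor_prt B S p (T j)))) + (\<Sum>p<2. act2 B S (e' j) (tensor_prt B S p (T j)))" for j
    by (simp add: sum_lessThan_2 odd_sign_add endo_prt_S[OF assms(2)] act2_0 assms(3) cong: if_cong)
       (simp add: odd_sign_def tensor_scale_linear algebra_simps)
  then have 3: "tensor_part d d' T e e' U = (\<lambda>j. act1 B S (d j) (U j) + act2 B S (d' j) (U j)
        - (\<Sum>p<2. \<Sum>q<2. odd_sign p q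
             (act1 B S (endo_prt B q (e j)) (tensor_prt B S p (T j)) +
              act2 B S (endo_prt S q (e' j)) (tensor_prt B S p (T j))))
        + tmul B S (T (j + 1)) (U (j + 2))
        - (\<Sum>p<2. \<Sum>q<2. odd_sign p q (tmul B S (tensor_prt B S q (U (j + 1))) (tensor_prt B S p (T (j + 2))))))"
    unfolding tensor_part_def act1_rev_def act2_rev_def tmul_rev_def by (simp only: diff_diff_eq)
  show ?thesis
    unfolding g_bracket_def tri_bracket_def odd_sign_def[symmetric] prod.case 3[symmetric] super_commutator_S[OF assms(1,2)]
    by (simp add: fun_eq_iff)
qed

lemma add_six: "a + a' - (s + s') - (r + r') + (m + m') - (n + n') = (a - s - r + m - n) + (a' - s' - r' + m' - n')"
  for a :: "'w::ab_group_add"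
  by (simp add: algebra_simps)

lemma g_bracket_add_left:
  assumes "x \<in> W" "y \<in> W" "z \<in> W"
  shows "g_bracket B S (x + y) z = g_bracket B S x z + g_bracket B S y z"
proof -
  obtain d d' T where x: "x = (d, d', T)" and lx: "\<And>i. linB (d i)" "\<And>i. linC (d' i)" "\<And>i. T i \<in> TT"
    using assms(1) by (rule W_cases) blast
  obtain e e' U where y: "y = (e, e', U)" and ly: "\<And>i. linB (e i)" "\<And>i. linC (e' i)" "\<And>i. U i \<in> TT"
    using assms(2) by (rule W_cases) blast
  obtain f f' X where z: "z = (f, f', X)" and lz: "\<And>i. linB (f i)" "\<And>i. linC (f' i)" "\<And>i. X i \<in> TT"
    using assms(3) by (rule W_cases) blast
  note l = lx ly lz
  note lf = linear_rules[OF lz(2)]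
  have 1: "(\<Sum>i\<in>UNIV. theta_pow i (ttri1 B S (T i + U i) (X i))) = (\<Sum>i\<in>UNIV. theta_pow i (ttri1 B S (T i) (X i))) + (\<Sum>i\<in>UNIV. theta_pow i (ttri1 B S (U i) (X i)))"
    by (simp only: ttri1_kernel ttri1_add l theta_pow_add sum.distrib)
  have 2: "(\<Sum>i\<in>UNIV. theta_pow i (ttri2 B S (T i + U i) (X i))) = (\<Sum>i\<in>UNIV. theta_pow i (ttri2 B S (T i) (X i))) + (\<Sum>i\<in>UNIV. theta_pow i (ttri2 B S (U i) (X i)))"
    by (simp only: ttri2_kernel ttri2_add l theta_pow_add sum.distrib)
  have a: "act1 B S (\<lambda>x. d j x + e j x) (X j) + act2 B S (\<lambda>x. d' j x + e' j x) (X j) =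
     (act1 B S (d j) (X j) + act2 B S (d' j) (X j)) + (act1 B S (e j) (X j) + act2 B S (e' j) (X j))" for j
    unfolding act1_add_left[OF lx(1) ly(1) lz(3)] act2_add_left[OF lx(2) ly(2) lz(3)] by (simp only: ac_simps)
  have m: "tmul B S (T j + U j) (X i) = tmul B S (T j) (X i) + tmul B S (U j) (X i)" for i j
    by (simp only: tmul_kernel tmul_add l)
  have 3: "tensor_part (\<lambda>i x. d i x + e i x) (\<lambda>i x. d' i x + e' i x) (\<lambda>i. T i + U i) f f' X = (\<lambda>j. tensor_part d d' T f f' X j + tensor_part e e' U f f' X j)"
    unfolding tensor_part_def a m act1_rev_add(1)[OF lz(1) lx(3) ly(3)] act2_rev_add(1)[OF lz(2) lx(3) ly(3)]
      tmul_rev_add(1)[OF lz(3) lx(3) ly(3)] by (rule ext) (rule add_six)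
  have W: "\<And>i. linC (\<lambda>x. d' i x + e' i x)" "\<And>i. T i + U i \<in> TT" using l by (simp_all add: linC_add)
  show ?thesis
    unfolding x y z triple_add g_bracket_W[OF W(1) lz(2) W(2)] g_bracket_W[OF lx(2) lz(2) lx(3)] g_bracket_W[OF ly(2) lz(2) ly(3)]
      super_commutator_B_add(1)[OF lx(1) ly(1) lz(1)] 1 2 3
    by (simp add: lf fun_eq_iff algebra_simps)
qed

lemma g_bracket_add_right:
  assumes "x \<in> W" "y \<in> W" "z \<in> W"
  shows "g_bracket B S z (x + y) = g_bracket B S z x + g_bracket B S z y"
proof -
  obtain d d' T where x: "x = (d, d', T)" and lx: "\<And>i. linB (d i)" "\<And>i. linC (d' i)" "\<And>i. T i \<in> TT"
    using assms(1) by (rule W_cases) blast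
  obtain e e' U where y: "y = (e, e', U)" and ly: "\<And>i. linB (e i)" "\<And>i. linC (e' i)" "\<And>i. U i \<in> TT"
    using assms(2) by (rule W_cases) blast
  obtain f f' X where z: "z = (f, f', X)" and lz: "\<And>i. linB (f i)" "\<And>i. linC (f' i)" "\<And>i. X i \<in> TT"
    using assms(3) by (rule W_cases) blast
  note l = lx ly lz
  note lf = linear_rules[OF lz(2)]
  have 1: "(\<Sum>i\<in>UNIV. theta_pow i (ttri1 B S (X i) (T i + U i))) = (\<Sum>i\<in>UNIV. theta_pow i (ttri1 B S (X i) (T i))) + (\<Sum>i\<in>UNIV. theta_pow i (ttri1 B S (X i) (U i)))"
    by (simp only: ttri1_kernel ttri1_add l theta_pow_add sum.distrib)
  have 2: "(\<Sum>i\<in>UNIV. theta_pow i (ttri2 B S (X i) (T i + U i))) = (\<Sum>i\<in>UNIV. theta_pow i (ttri2 B S (X i) (T i))) + (\<Sum>i\<in>UNIV. theta_pow i (ttri2 B S (X i) (U i)))"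
    by (simp only: ttri2_kernel ttri2_add l theta_pow_add sum.distrib)
  have a: "act1 B S (f j) (T j + U j) + act2 B S (f' j) (T j + U j) =
     (act1 B S (f j) (T j) + act2 B S (f' j) (T j)) + (act1 B S (f j) (U j) + act2 B S (f' j) (U j))" for j
    unfolding act1_add_right[OF lz(1) lx(3) ly(3)] act2_add_right[OF lz(2) lx(3) ly(3)] by (simp only: ac_simps)
  have m: "tmul B S (X i) (T j + U j) = tmul B S (X i) (T j) + tmul B S (X i) (U j)" for i j
    by (simp only: tmul_kernel tmul_add l)
  have 3: "tensor_part f f' X (\<lambda>i x. d i x + e i x) (\<lambda>i x. d' i x + e' i x) (\<lambda>i. T i + U i) = (\<lambda>j. tensor_part f f' X d d' T j + tensor_part f f' X e e' U j)"
    unfolding tensor_part_def a m act1_rev_add(2)[OF lx(1) ly(1) lz(3)] act2_rev_add(2)[OF lx(2) ly(2) lz(3)]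
      tmul_rev_add(2)[OF lx(3) ly(3) lz(3)] by (rule ext) (rule add_six)
  have W: "\<And>i. linC (\<lambda>x. d' i x + e' i x)" using l by (simp_all add: linC_add)
  show ?thesis
    unfolding x y z triple_add g_bracket_W[OF lz(2) W(1) lz(3)] g_bracket_W[OF lz(2) lx(2) lz(3)] g_bracket_W[OF lz(2) ly(2) lz(3)]
      super_commutator_B_add(2)[OF lx(1) ly(1) lz(1)] 1 2 3
    by (simp add: lf fun_eq_iff algebra_simps)
qed

section \<open>Brackets of generators of g(S(1,2), S)\<close>

text \<open>
  The map \<open>D\<close> and the vector \<open>x\<close> are homogeneous of the same parity \<open>p\<close>, expressed by the projections that occur
  in the bracket; \<open>D\<close> or \<open>x\<close> may be zero.
\<close>

definition parity_pair :: "nat \<Rightarrow> ('k \<times> 'v \<Rightarrow> 'k \<times> 'v) \<Rightarrow> 'k \<times> 'v \<Rightarrow> bool" where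
  "parity_pair p D x \<longleftrightarrow> p < 2 \<and> linB D \<and> (\<forall>r<2. endo_prt B r D = (if r = p then D else (\<lambda>_. 0))) \<and>
     (\<forall>r<2. prt B r x = (if r = p then x else 0))"

lemma linB_const_0: "linB (\<lambda>_. 0)"
  unfolding linear_B_iff by (simp add: scl_B zero_prod_def)

lemma linB_ev: "s \<in> sp V \<Longrightarrow> linB (ev s)"
  and linB_od: "linB (od u)"
  using ev_osp od_osp unfolding osp_homog_def by blast+

lemma ev_zero: "ev (\<lambda>_. 0) = (\<lambda>_. 0)" "ev 0 = (\<lambda>_. 0)"
  unfolding ev_def by (simp_all add: zero_prod_def)

lemma parity_pair_ev: "s \<in> sp V \<Longrightarrow> parity_pair 0 (ev s) (a, 0)"
  unfolding parity_pair_def using linB_ev[of s]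
  by (auto simp: less_2_cases_iff endo_prt_def fun_eq_iff sum_lessThan_2 ev_def prt_B zero_prod_def sp_rules)

lemma parity_pair_od: "parity_pair (Suc 0) (od w) (0, u)"
  unfolding parity_pair_def using linB_od[of w]
  by (auto simp: less_2_cases_iff endo_prt_def fun_eq_iff sum_lessThan_2 od_def prt_B zero_prod_def)

lemma sp_zero: "(\<lambda>_. 0) \<in> sp V"
  unfolding sp_def linear_V_iff by simp

lemma parity_pair_0: "parity_pair 0 (\<lambda>_. 0) (a, 0)"
  using parity_pair_ev[OF sp_zero] unfolding ev_zero .

lemma tensor_prt_tt: "p < 2 \<Longrightarrow> tensor_prt B S p (tt x a) = tt (prt B p x) a"
  unfolding tensor_prt_kernel by (rule lift_tt[OF tensor_prt_bilinear])

lemma act1_tt: "linB d \<Longrightarrow> act1 B S d (tt x a) = tt (d x) a"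
  unfolding act1_kernel by (rule lift_tt[OF act1_bilinear])

lemma act2_tt: "linC d \<Longrightarrow> act2 B S d (tt x a) = tt x (d a)"
  by (simp only: act2_kernel) (rule lift_tt[OF act2_bilinear])

lemma tmul_tt: "tmul B S (tt x a) (tt y b) = tt (mul B x y) (a \<diamondop> b)"
  unfolding tmul_kernel by (rule lift2_tt[OF tmul_quadrilinear])

lemma ttri1_tt: "ttri1 B S (tt x a) (tt y b) = (\<lambda>i z. scl B (bf a b) (t12 x y z))"
  unfolding ttri1_kernel by (rule lift2_tt[OF ttri1_quadrilinear])

lemma ttri2_tt: "ttri2 B S (tt x a) (tt y b) = (\<lambda>i z. pol B x y \<odot> tri_elt S a b i z)"
  unfolding ttri2_kernel by (rule lift2_tt[OF ttri2_quadrilinear])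

lemma mul_B_0 [simp]: "mul B 0 x = 0" "mul B x 0 = 0"
  by (simp_all add: mul_B zero_prod_def)

lemma scl_B_0 [simp]: "scl B c 0 = 0"
  by (simp add: scl_B zero_prod_def)

text \<open>The bracket of two elements whose tensor components have a common first factor.\<close>

lemma g_bracket_homogeneous:
  assumes x: "parity_pair p D x" and y: "parity_pair q D' y"
    and d: "\<And>i. linC (d i)" and e: "\<And>i. linC (e i)"
  defines "sg \<equiv> (-1) ^ (p * q) :: 'k"
  shows "g_bracket B S (\<lambda>_. D, d, \<lambda>i. tt x (a i)) (\<lambda>_. D', e, \<lambda>i. tt y (b i)) =
    (\<lambda>i z. D (D' z) - scl B sg (D' (D z)) + scl B (\<Sum>l\<in>UNIV. bf (a l) (b l)) (t12 x y z),
     \<lambda>i z. d i (e i z) - e i (d i z) + pol B x y \<odot> theta_sum a b i z,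
     \<lambda>j. tt (D y) (b j) + tt y (d j (b j)) - tensor_scale sg (tt (D' x) (a j)) - tt x (e j (a j))
       + tt (mul B x y) (a (j + 1) \<diamondop> b (j + 2)) - tensor_scale sg (tt (mul B y x) (b (j + 1) \<diamondop> a (j + 2))))"
proof -
  have lD: "linB D" and lD': "linB D'" and p: "p = 0 \<or> p = Suc 0" and q: "q = 0 \<or> q = Suc 0"
    using x y unfolding parity_pair_def by (auto simp: less_2_cases_iff)
  have eD: "endo_prt B 0 D = (if p = 0 then D else (\<lambda>_. 0))" "endo_prt B (Suc 0) D = (if p = Suc 0 then D else (\<lambda>_. 0))"
    and eD': "endo_prt B 0 D' = (if q = 0 then D' else (\<lambda>_. 0))" "endo_prt B (Suc 0) D' = (if q = Suc 0 then D' else (\<lambda>_. 0))"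
    and px: "prt B 0 x = (if p = 0 then x else 0)" "prt B (Suc 0) x = (if p = Suc 0 then x else 0)"
    and py: "prt B 0 y = (if q = 0 then y else 0)" "prt B (Suc 0) y = (if q = Suc 0 then y else 0)"
    using x y unfolding parity_pair_def by auto
  have D0: "D 0 = 0" and D'0: "D' 0 = 0"
    using lD lD' unfolding linear_B_iff by (metis add_cancel_right_right)+
  have "super_commutator B D D' = (\<lambda>z. D (D' z) - scl B sg (D' (D z)))"
    unfolding super_commutator_def sg_def
    using p q by (elim disjE) (simp_all add: fun_eq_iff sum_lessThan_2 eD eD' D0 D'0)
  moreover have "(\<Sum>l\<in>UNIV. theta_pow l (ttri1 B S (tt x (a l)) (tt y (b l)))) i z = scl B (\<Sum>l\<in>UNIV. bf (a l) (b l)) (t12 x y z)" for i z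
    unfolding ttri1_tt theta_pow_def
    by (simp add: sum_index3[of _ 0] scl_B plane.scale_left_distrib algebra_simps)
  moreover have "(\<Sum>l\<in>UNIV. theta_pow l (ttri2 B S (tt x (a l)) (tt y (b l)))) i z = pol B x y \<odot> theta_sum a b i z" for i z
    unfolding ttri2_tt theta_pow_def theta_sum_def
    by (simp add: sum_index3[of _ 0] scale_right_distrib)
  moreover have "tensor_part (\<lambda>_. D) d (\<lambda>i. tt x (a i)) (\<lambda>_. D') e (\<lambda>i. tt y (b i)) =
    (\<lambda>j. tt (D y) (b j) + tt y (d j (b j)) - tensor_scale sg (tt (D' x) (a j)) - tt x (e j (a j))
       + tt (mul B x y) (a (j + 1) \<diamondop> b (j + 2)) - tensor_scale sg (tt (mul B y x) (b (j + 1) \<diamondop> a (j + 2))))"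
    unfolding tensor_part_def act1_rev_def act2_rev_def tmul_rev_def odd_sign_def sg_def
    using p q
    by (elim disjE) (simp_all add: fun_eq_iff sum_lessThan_2 tensor_prt_tt act1_tt act2_tt tmul_tt lD lD' d e eD' px py
        linB_const_0 tensor_scale_linear D'0 linear_rules[OF e])
  ultimately show ?thesis
    by (simp add: g_bracket_W[OF d e tt_TT])
qed

text \<open>
  The generators of the source: an element of \<open>sp(V)\<close>, an element of \<open>g(S\<^sub>1, S)\<close>, and
  \<open>t \<sigma>\<^sub>1\<^sub>,\<^sub>u + \<Sum>\<iota>\<^sub>i(u \<otimes> b\<^sub>i)\<close>. The brackets of these three families are closed up to sums.
\<close>

definition gA :: "('v \<Rightarrow> 'v) \<Rightarrow> ('k, 'k \<times> 'v, 'c) gelt" where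
  "gA s = (\<lambda>_. ev s, \<lambda>_ _. 0, \<lambda>_. 0)"

definition gF :: "'c triple \<Rightarrow> (3 \<Rightarrow> 'c) \<Rightarrow> ('k, 'k \<times> 'v, 'c) gelt" where
  "gF d a = (\<lambda>_ _. 0, d, \<lambda>i. tt (1, 0) (a i))"

definition gR :: "'v \<Rightarrow> 'k \<Rightarrow> (3 \<Rightarrow> 'c) \<Rightarrow> ('k, 'k \<times> 'v, 'c) gelt" where
  "gR u t b = (\<lambda>_. od (t \<otimes> u), \<lambda>_ _. 0, \<lambda>i. tt (0, u) (b i))"

lemma gA_alt: "gA s = (\<lambda>_. ev s, \<lambda>_ _. 0, \<lambda>i. tt (1, 0) 0)"
  unfolding gA_def by simp

lemma linC_const_0: "linC (\<lambda>_. 0)"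
  unfolding Vector_Spaces.linear_iff using vector_space_axioms by simp

lemma theta_sum_0 [simp]: "theta_sum (\<lambda>_. 0) b i z = 0" "theta_sum a (\<lambda>_. 0) i z = 0"
  by (simp_all add: theta_sum_apply)

lemma tt_even: "tt (c, 0) a = tensor_scale c (tt (1, 0) a)"
  using tt_scale(1)[of c "(1, 0)" a] by simp

lemma tt_odd: "tt (0, c \<otimes> u) a = tensor_scale c (tt (0, u) a)" "tt (0, - u) a = - tt (0, u) a"
  using tt_scale(1)[of c "(0, u)" a] tt_minus(1)[of "(0, u)" a] by simp_all

lemma tt_pair_0 [simp]: "tt (0, 0) a = 0"
  using tt_0(1)[of a] by (simp add: zero_prod_def)

lemma scale_tensor_scale: "tensor_scale c (tensor_scale c' t) = tensor_scale (c * c') t"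
  "tensor_scale (c + c') t = tensor_scale c t + tensor_scale c' t"
  "tensor_scale (- c) t = - tensor_scale c t" "tensor_scale 0 t = 0" "tensor_scale c (- t) = - tensor_scale c t"
  "tensor_scale c (s - t) = tensor_scale c s - tensor_scale c t"
  unfolding tensor_scale_def by (auto simp: fun_eq_iff algebra_simps)

lemmas tt_normalize = tt_add(2) tt_diff(2) tt_minus(2) tt_scale(2) tt_odd tensor_scale_linear scale_tensor_scale

lemma bracket_AA:
  assumes "s \<in> sp V" "s' \<in> sp V"
  shows "g_bracket B S (gA s) (gA s') = gA (\<lambda>u. s (s' u) - s' (s u))"
  unfolding gA_alt g_bracket_homogeneous[OF parity_pair_ev[OF assms(1)] parity_pair_ev[OF assms(2)] linC_const_0 linC_const_0]
  by (simp add: fun_eq_iff ev_def scl_B t12_def od_def gam_def tensor_scale_linear sp_rules[OF assms(1)] sp_rules[OF assms(2)] zero_prod_def)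

lemma bracket_AF:
  assumes "s \<in> sp V" "triality d"
  shows "g_bracket B S (gA s) (gF d a) = 0" "g_bracket B S (gF d a) (gA s) = 0"
  unfolding gA_alt gF_def
    g_bracket_homogeneous[OF parity_pair_ev[OF assms(1)] parity_pair_0 linC_const_0 triality_linear[OF assms(2)]]
    g_bracket_homogeneous[OF parity_pair_0 parity_pair_ev[OF assms(1)] triality_linear[OF assms(2)] linC_const_0]
  by (simp_all add: fun_eq_iff ev_def scl_B t12_def od_def gam_def tensor_scale_linear sp_rules[OF assms(1)]
      triality_rules[OF assms(2)] zero_prod_def)

lemma bracket_AR:
  assumes "s \<in> sp V"
  shows "g_bracket B S (gA s) (gR u t b) = gR (s u) t b" (is ?A) "g_bracket B S (gR u t b) (gA s) = gR (- s u) t b" (is ?B)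
proof -
  have 1: "form w (s u) = - form (s w) u" "form u (s w) = - form (s u) w" for u w using sp_skew[OF assms] by simp_all
  show "?A" "?B"
    unfolding gA_alt gR_def
      g_bracket_homogeneous[OF parity_pair_ev[OF assms(1)] parity_pair_od linC_const_0 linC_const_0]
      g_bracket_homogeneous[OF parity_pair_od parity_pair_ev[OF assms(1)] linC_const_0 linC_const_0]
    by (simp_all add: fun_eq_iff ev_def scl_B t12_def od_def gam_def tensor_scale_linear sp_rules[OF assms(1)] tt_odd(2)
        sp_skew[OF assms] zero_prod_def plane.scale_left_commute)
qed

lemma bracket_FF:
  assumes d: "triality d" and e: "triality e"
  shows "g_bracket B S (gF d a) (gF e b) = gF (tri_part d e a b)
      (even_bracket d a e b)"
  unfolding gF_def g_bracket_homogeneous[OF parity_pair_0 parity_pair_0 triality_linear[OF d] triality_linear[OF e]]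
  by (simp add: fun_eq_iff scl_B t12_def od_def gam_def zero_prod_def tt_normalize even_bracket_def tri_part_def)

lemma bracket_FR:
  assumes d: "triality d"
  shows "g_bracket B S (gF d a) (gR u t b) = gR u (\<Sum>i\<in>UNIV. bf (a i) (b i))
      (odd_action d a t b)" (is ?A)
    "g_bracket B S (gR u t b) (gF d a) = gR (- u) (\<Sum>i\<in>UNIV. bf (a i) (b i))
      (odd_action d a t b)" (is ?B)
proof -
  have s: "bf (b i) (a i) = bf (a i) (b i)" for i by (rule bf_sym)
  show "?A"
    "?B"
    unfolding gF_def gR_def
      g_bracket_homogeneous[OF parity_pair_0 parity_pair_od triality_linear[OF d] linC_const_0]
      g_bracket_homogeneous[OF parity_pair_od parity_pair_0 linC_const_0 triality_linear[OF d]]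
    by (simp_all add: fun_eq_iff scl_B t12_def od_def gam_def zero_prod_def tt_normalize s triality_rules[OF d] odd_action_def algebra_simps)
qed

lemma bracket_RR:
  "g_bracket B S (gR u t b) (gR v t' b') =
     gA (\<lambda>w. (t * t' - (\<Sum>i\<in>UNIV. bf (b i) (b' i))) \<otimes> gam V u v w) +
     gF (\<lambda>i z. form u v \<odot> theta_sum b b' i z)
       (\<lambda>j. form u v \<odot> odd_bracket t b t' b' j)"
  unfolding gA_def gF_def gR_def
    g_bracket_homogeneous[OF parity_pair_od parity_pair_od linC_const_0 linC_const_0]
    triple_add prod.inject
proof (intro conjI ext, goal_cases)
  case (1 i z)
  show ?case
    using form_swap[of v u]
    by (simp add: scl_B t12_def od_def ev_def gam_def plane.scale_right_distrib plane.scale_left_distrib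
        plane.scale_left_diff_distrib plane.scale_right_diff_distrib algebra_simps)
next
  case (2 i z)
  show ?case by simp
next
  case (3 j)
  show ?case
    by (simp add: od_def tt_even[of "_ * _"] tt_even[of "form _ _"] tt_even[of "- _"] tt_normalize form_swap[of v u] odd_bracket_def algebra_simps)
qed

section \<open>The bracket of g(J)\<close>

abbreviation tJ where "tJ v X \<equiv> tnJ V C v X"
abbreviation TJT where "TJT \<equiv> tensor_space (vs_plane V) (TJ C)"
abbreviation liftJ where "liftJ f t \<equiv> tensor_lift (vs_plane V) (TJ C) f t"
abbreviation liftJ2 where "liftJ2 F t u \<equiv> tensor_lift2 (vs_plane V) (TJ C) F t u"
abbreviation linV where "linV s \<equiv> Vector_Spaces.linear (pscl V) (pscl V) s"

lemma vs_plane_simps [simp]: "vcar (vs_plane V) = UNIV" "vadd (vs_plane V) = (+)" "vscl (vs_plane V) = pscl V"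
  by (simp_all add: vs_plane_def)

lemma TJ_cases: "X \<in> vcar (TJ C) \<Longrightarrow> (\<And>t b. X = TJel t b \<Longrightarrow> P) \<Longrightarrow> P"
  unfolding vcar_TJ by blast

lemma bilinear_VTI:
  assumes "vector_space sc" "\<And>x y t b. f (x + y) (TJel t b) = f x (TJel t b) + f y (TJel t b)"
    "\<And>x t b t' b'. f x (TJel (t + t') (\<lambda>i. b i + b' i)) = f x (TJel t b) + f x (TJel t' b')"
    "\<And>c x t b. f (c \<otimes> x) (TJel t b) = sc c (f x (TJel t b))"
    "\<And>c x t b. f x (TJel (c * t) (\<lambda>i. c \<odot> b i)) = sc c (f x (TJel t b))"
  shows "bilinear_map (vs_plane V) (TJ C) sc f"
  unfolding bilinear_map_def using assms
  by (auto elim!: TJ_cases simp: TJel_add TJel_scale)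

lemma tJ_bilinear: "bilinear_map (vs_plane V) (TJ C) tensor_scale (\<lambda>v X. tJ v X)"
  unfolding tnJ_def by (rule bilinear_map_tens)

lemma tJ_add: "tJ (u + v) (TJel t b) = tJ u (TJel t b) + tJ v (TJel t b)"
    "tJ u (TJel (t + t') (\<lambda>i. b i + b' i)) = tJ u (TJel t b) + tJ u (TJel t' b')"
  and tJ_scale: "tJ (c \<otimes> u) (TJel t b) = tensor_scale c (tJ u (TJel t b))"
    "tJ u (TJel (c * t) (\<lambda>i. c \<odot> b i)) = tensor_scale c (tJ u (TJel t b))"
  using tJ_bilinear unfolding bilinear_map_def by (simp_all flip: TJel_add TJel_scale)

lemma tJ_0: "tJ 0 (TJel t b) = 0" "tJ u (TJel 0 (\<lambda>_. 0)) = 0"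
  using tJ_add(1)[of 0 0 t b] tJ_add(2)[of u 0 0 "\<lambda>_. 0" "\<lambda>_. 0"] by simp_all

lemma tJ_minus: "tJ (- u) (TJel t b) = - tJ u (TJel t b)"
  using tJ_add(1)[of "- u" u t b] by (simp add: tJ_0 eq_neg_iff_add_eq_0)

lemma tJ_TJT [simp]: "tJ u (TJel t b) \<in> TJT"
  unfolding tnJ_def by (rule tensor_space_tens) simp_all

lemma TJT_add [simp]: "s \<in> TJT \<Longrightarrow> t \<in> TJT \<Longrightarrow> s + t \<in> TJT" and TJT_0 [simp]: "0 \<in> TJT"
  unfolding tensor_space_def by (rule tensor_span_add tensor_span_0; assumption)+

lemma TJT_basis: "t \<in> TJT \<Longrightarrow> \<exists>r b r' b'. t = tJ v1 (TJel r b) + tJ v2 (TJel r' b')"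
  unfolding tensor_space_def
proof (induction rule: tensor_span_induct)
  case zero
  have "0 = tJ v1 (TJel 0 (\<lambda>_. 0)) + tJ v2 (TJel 0 (\<lambda>_. 0))" by (simp add: tJ_0)
  then show ?case by blast
next
  case (add u X s)
  then obtain r b r' b' where s: "s = tJ v1 (TJel r b) + tJ v2 (TJel r' b')" by blast
  have "X \<in> vcar (TJ C)" using add(1) by simp
  then obtain t c where X: "X = TJel t c" by (rule TJ_cases)
  define p q where "p = form u v2" and "q = form v1 u"
  have u: "u = p \<otimes> v1 + q \<otimes> v2" unfolding p_def q_def by (rule basis_expand)
  have "tJ u X + s = tJ v1 (TJel (p * t + r) (\<lambda>i. p \<odot> c i + b i)) + tJ v2 (TJel (q * t + r') (\<lambda>i. q \<odot> c i + b' i))"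
    unfolding s X u tJ_add tJ_scale by (simp only: ac_simps)
  then show ?case unfolding tnJ_def by blast
qed

lemma TJ_act_der:
  assumes D: "D \<in> der C"
  obtains r c where "TJ_act C D (TJel t b) = TJel r c"
proof -
  obtain d a where "triality d" "D = Phi d a" using der_is_Phi[OF D] by blast
  then show ?thesis using that TJ_act_TJel by blast
qed

lemma TJ_act_linear:
  assumes D: "D \<in> der C"
  shows "TJ_act C D (TJel (t + t') (\<lambda>i. b i + b' i)) = vadd (TJ C) (TJ_act C D (TJel t b)) (TJ_act C D (TJel t' b'))" (is ?A)
    "TJ_act C D (TJel (c * t) (\<lambda>i. c \<odot> b i)) = vscl (TJ C) c (TJ_act C D (TJel t b))" (is ?B)
proof -
  obtain d a where d: "triality d" "D = Phi d a" using der_is_Phi[OF D] by blast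
  show "?A"
    "?B"
    unfolding d(2) TJ_act_TJel[OF d(1)] TJel_add TJel_scale TJel_inject
    by (simp_all add: fun_eq_iff sum_index3[of _ 0] triality_rules[OF d(1)] odd_action_def kc_simps)
qed

lemma TJ_act_add_der:
  assumes D: "D \<in> der C" and D': "D' \<in> der C"
  shows "TJ_act C (\<lambda>x. D x + D' x) (TJel t b) = vadd (TJ C) (TJ_act C D (TJel t b)) (TJ_act C D' (TJel t b))"
proof -
  obtain d a where d: "triality d" "D = Phi d a" using der_is_Phi[OF D] by blast
  obtain e c where e: "triality e" "D' = Phi e c" using der_is_Phi[OF D'] by blast
  have "(\<lambda>x. D x + D' x) = Phi (d + e) (\<lambda>i. a i + c i)"
    unfolding Phi_add[OF d(1) e(1)] d(2) e(2) by (simp add: fun_eq_iff)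
  then show ?thesis
    unfolding d(2) e(2) TJ_act_TJel[OF d(1)] TJ_act_TJel[OF e(1)] TJ_act_TJel[OF triality_add[OF d(1) e(1)]] TJel_add TJel_inject
    by (simp add: fun_eq_iff sum_index3[of _ 0] odd_action_def kc_simps TJ_act_TJel[OF triality_add[OF d(1) e(1)]] TJel_inject)
qed

lemma actJ_kernel: "actJ V C s D = liftJ (\<lambda>v X. tJ (s v) X + tJ v (TJ_act C D X))"
  unfolding actJ_def tliftJ_def ..

lemma actJ_bilinear:
  assumes s: "linV s" and D: "D \<in> der C"
  shows "bilinear_map (vs_plane V) (TJ C) tensor_scale (\<lambda>v X. tJ (s v) X + tJ v (TJ_act C D X))"
proof (rule bilinear_VTI[OF vector_space_tensor_scale])
  note sl = linear_rules[OF s]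
  fix x y t b t' b' c
  obtain r e where X: "TJ_act C D (TJel t b) = TJel r e" using D by (rule TJ_act_der)
  obtain r' e' where Y: "TJ_act C D (TJel t' b') = TJel r' e'" using D by (rule TJ_act_der)
  note T = TJ_act_linear(1)[OF D, of t t' b b'] TJ_act_linear(2)[OF D, of c t b]
  show "tJ (s (x + y)) (TJel t b) + tJ (x + y) (TJ_act C D (TJel t b)) =
    tJ (s x) (TJel t b) + tJ x (TJ_act C D (TJel t b)) + (tJ (s y) (TJel t b) + tJ y (TJ_act C D (TJel t b)))"
    unfolding X sl tJ_add by (simp only: ac_simps)
  show "tJ (s x) (TJel (t + t') (\<lambda>i. b i + b' i)) + tJ x (TJ_act C D (TJel (t + t') (\<lambda>i. b i + b' i))) =
    tJ (s x) (TJel t b) + tJ x (TJ_act C D (TJel t b)) + (tJ (s x) (TJel t' b') + tJ x (TJ_act C D (TJel t' b')))"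
    unfolding T X Y TJel_add tJ_add by (simp only: ac_simps)
  show "tJ (s (c \<otimes> x)) (TJel t b) + tJ (c \<otimes> x) (TJ_act C D (TJel t b)) =
    tensor_scale c (tJ (s x) (TJel t b) + tJ x (TJ_act C D (TJel t b)))"
    unfolding X sl tJ_scale tensor_scale_linear ..
  show "tJ (s x) (TJel (c * t) (\<lambda>i. c \<odot> b i)) + tJ x (TJ_act C D (TJel (c * t) (\<lambda>i. c \<odot> b i))) =
    tensor_scale c (tJ (s x) (TJel t b) + tJ x (TJ_act C D (TJel t b)))"
    unfolding T X TJel_scale tJ_scale tensor_scale_linear ..
qed

lemma actJ_tJ: "linV s \<Longrightarrow> D \<in> der C \<Longrightarrow> actJ V C s D (tJ v (TJel t b)) = tJ (s v) (TJel t b) + tJ v (TJ_act C D (TJel t b))"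
  unfolding actJ_kernel using tensor_lift_tens[OF actJ_bilinear, of s D v "TJel t b"] by (simp add: tnJ_def)

lemma actJ_add_tensor: "linV s \<Longrightarrow> D \<in> der C \<Longrightarrow> t \<in> TJT \<Longrightarrow> t' \<in> TJT \<Longrightarrow>
    actJ V C s D (t + t') = actJ V C s D t + actJ V C s D t'"
  unfolding actJ_kernel by (rule tensor_lift_add[OF actJ_bilinear])

lemma actJ_add_map:
  assumes "linV s" "linV s'" "D \<in> der C" "D' \<in> der C" "t \<in> TJT"
  shows "actJ V C (\<lambda>v. s v + s' v) (\<lambda>x. D x + D' x) t = actJ V C s D t + actJ V C s' D' t"
proof -
  have "liftJ (\<lambda>v X. tJ (s v + s' v) X + tJ v (TJ_act C (\<lambda>x. D x + D' x) X)) t =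
    liftJ (\<lambda>v X. (tJ (s v) X + tJ v (TJ_act C D X)) + (tJ (s' v) X + tJ v (TJ_act C D' X))) t"
  proof (rule tensor_lift_cong)
    fix v X
    assume "X \<in> vcar (TJ C)"
    then obtain r b where X: "X = TJel r b" by (rule TJ_cases)
    obtain q e where Y: "TJ_act C D (TJel r b) = TJel q e" using assms(3) by (rule TJ_act_der)
    obtain q' e' where Y': "TJ_act C D' (TJel r b) = TJel q' e'" using assms(4) by (rule TJ_act_der)
    show "tJ (s v + s' v) X + tJ v (TJ_act C (\<lambda>x. D x + D' x) X) =
      (tJ (s v) X + tJ v (TJ_act C D X)) + (tJ (s' v) X + tJ v (TJ_act C D' X))"
      unfolding X TJ_act_add_der[OF assms(3,4)] Y Y' TJel_add tJ_add by (simp only: ac_simps)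
  qed
  then show ?thesis
    unfolding actJ_kernel tensor_lift_add_map[OF actJ_bilinear[OF assms(1,3)] actJ_bilinear[OF assms(2,4)] assms(5)] .
qed

lemma oddJ1_kernel: "oddJ1 V C = liftJ2 (\<lambda>u X v Y w. - TJ_form C X Y \<otimes> gam V u v w)"
  unfolding oddJ1_def tliftJ_def tensor_lift2_def by (simp add: fun_eq_iff)

lemma oddJ1_quadrilinear: "quadrilinear_map (vs_plane V) (TJ C) (\<lambda>c f w. c \<otimes> f w) (\<lambda>u X v Y w. - TJ_form C X Y \<otimes> gam V u v w)"
  unfolding quadrilinear_map_def
  by (auto elim!: TJ_cases intro!: bilinear_VTI vector_space_fun plane.vector_space_axioms
      simp: fun_eq_iff gam_linear TJ_form_TJel sum_index3[of _ 0] plane.scale_right_distrib plane.scale_left_distrib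
        plane.scale_left_diff_distrib algebra_simps)

lemma theta_sum_linear:
  "theta_sum (\<lambda>i. a i + a' i) b i z = theta_sum a b i z + theta_sum a' b i z"
  "theta_sum a (\<lambda>i. b i + b' i) i z = theta_sum a b i z + theta_sum a b' i z"
  "theta_sum (\<lambda>i. c \<odot> a i) b i z = c \<odot> theta_sum a b i z"
  "theta_sum a (\<lambda>i. c \<odot> b i) i z = c \<odot> theta_sum a b i z"
  by (simp_all add: theta_sum_apply kc_simps)

lemma Phi_linear:
  "(\<And>i z. d'' i z = d i z + d' i z) \<Longrightarrow> (\<And>i. a'' i = a i + a' i) \<Longrightarrow> Phi d'' a'' x = Phi d a x + Phi d' a' x"
  "(\<And>i z. d'' i z = c \<odot> d i z) \<Longrightarrow> (\<And>i. a'' i = c \<odot> a i) \<Longrightarrow> Phi d'' a'' x = mat_scale C c (Phi d a x)"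
  by (cases "x \<in> jordan C"; auto elim!: jordanE simp: Phi_outside mat_scale_zero Phi_jel jel_add jel_scale jel_inject
      Phi_diag_def Phi_off_def fun_eq_iff kc_simps)+

lemma TJ_comm_linear:
  "TJ_comm C (TJel (t + t') (\<lambda>i. b i + b' i)) (TJel r c) z = TJ_comm C (TJel t b) (TJel r c) z + TJ_comm C (TJel t' b') (TJel r c) z"
  "TJ_comm C (TJel r c) (TJel (t + t') (\<lambda>i. b i + b' i)) z = TJ_comm C (TJel r c) (TJel t b) z + TJ_comm C (TJel r c) (TJel t' b') z"
  "TJ_comm C (TJel (k * t) (\<lambda>i. k \<odot> b i)) (TJel r c) z = mat_scale C k (TJ_comm C (TJel t b) (TJel r c) z)"
  "TJ_comm C (TJel r c) (TJel (k * t) (\<lambda>i. k \<odot> b i)) z = mat_scale C k (TJ_comm C (TJel r c) (TJel t b) z)"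
  unfolding TJ_comm_TJel
  by (rule Phi_linear, simp add: theta_sum_linear, simp add: odd_bracket_def kc_simps)+

lemma oddJ2_kernel: "oddJ2 V C = liftJ2 (\<lambda>u X v Y z. mat_scale C (form u v) (TJ_comm C X Y z))"
  unfolding oddJ2_def tliftJ_def tensor_lift2_def by (simp add: fun_eq_iff)

lemma oddJ2_quadrilinear: "quadrilinear_map (vs_plane V) (TJ C) (\<lambda>c f z. mat_scale C c (f z)) (\<lambda>u X v Y z. mat_scale C (form u v) (TJ_comm C X Y z))"
  unfolding quadrilinear_map_def
  by (auto elim!: TJ_cases intro!: bilinear_VTI vector_space_fun vector_space_mat
      simp: fun_eq_iff TJ_comm_linear mat_scale_add mat_scale_add_left mat_scale_mat_scale mult.commute)

lemma oddJ1_tJ: "oddJ1 V C (tJ u (TJel t b)) (tJ v (TJel t' b')) = (\<lambda>w. - TJ_form C (TJel t b) (TJel t' b') \<otimes> gam V u v w)"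
  unfolding oddJ1_kernel tnJ_def by (rule tensor_lift2_tens[OF oddJ1_quadrilinear]) simp_all

lemma oddJ2_tJ: "oddJ2 V C (tJ u (TJel t b)) (tJ v (TJel t' b')) = (\<lambda>z. mat_scale C (form u v) (TJ_comm C (TJel t b) (TJel t' b') z))"
  unfolding oddJ2_kernel tnJ_def by (rule tensor_lift2_tens[OF oddJ2_quadrilinear]) simp_all

lemmas oddJ1_add = tensor_lift2_add_left[OF oddJ1_quadrilinear] tensor_lift2_add_right[OF oddJ1_quadrilinear]
lemmas oddJ2_add = tensor_lift2_add_left[OF oddJ2_quadrilinear] tensor_lift2_add_right[OF oddJ2_quadrilinear]

text \<open>
  The analogue of \<open>W\<close> for \<open>g(J)\<close>.
\<close>

definition WH :: "('k, 'v, 'c) gJelt set" where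
  "WH = {(s, D, t). linV s \<and> D \<in> der C \<and> t \<in> TJT}"

lemma WH_cases:
  assumes "x \<in> WH"
  obtains s D t where "x = (s, D, t)" "linV s" "D \<in> der C" "t \<in> TJT"
  using assms unfolding WH_def by blast

lemma gJ_bracket_eq: "gJ_bracket V C (s, D, t) (s', D', t') =
    (\<lambda>w. s (s' w) - s' (s w) + oddJ1 V C t t' w, \<lambda>x. D (D' x) - D' (D x) + oddJ2 V C t t' x, actJ V C s D t' - actJ V C s' D' t)"
  unfolding gJ_bracket_def commutator_def by (simp add: fun_eq_iff)

lemma gJ_triple_add: "(s, D, t) + (s', D', t') = (\<lambda>v. s v + s' v, \<lambda>x. D x + D' x, t + t')"
  by (simp add: fun_eq_iff)

lemma der_add_value: "D \<in> der C \<Longrightarrow> D' \<in> der C \<Longrightarrow> D'' \<in> der C \<Longrightarrow> D (D' x + D'' x) = D (D' x) + D (D'' x)"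
  by (cases "x \<in> jordan C") (simp_all add: der_add der_jordan der_outside der_zero)

lemma gJ_bracket_add:
  assumes "x \<in> WH" "y \<in> WH" "z \<in> WH"
  shows "gJ_bracket V C (x + y) z = gJ_bracket V C x z + gJ_bracket V C y z" (is ?A)
    "gJ_bracket V C z (x + y) = gJ_bracket V C z x + gJ_bracket V C z y" (is ?B)
proof -
  obtain s D t where x: "x = (s, D, t)" and lx: "linV s" "D \<in> der C" "t \<in> TJT" using assms(1) by (rule WH_cases)
  obtain s' D' t' where y: "y = (s', D', t')" and ly: "linV s'" "D' \<in> der C" "t' \<in> TJT" using assms(2) by (rule WH_cases)
  obtain s'' D'' t'' where z: "z = (s'', D'', t'')" and lz: "linV s''" "D'' \<in> der C" "t'' \<in> TJT" using assms(3) by (rule WH_cases)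
  note o = oddJ1_add(1)[OF lx(3) ly(3) lz(3)] oddJ1_add(2)[OF lz(3) lx(3) ly(3)]
    oddJ2_add(1)[OF lx(3) ly(3) lz(3)] oddJ2_add(2)[OF lz(3) lx(3) ly(3)]
  show "?A"
    "?B"
    unfolding x y z gJ_triple_add gJ_bracket_eq oddJ1_kernel oddJ2_kernel o
      actJ_add_map[OF lx(1) ly(1) lx(2) ly(2) lz(3)] actJ_add_tensor[OF lz(1,2) lx(3) ly(3)]
    by (simp_all add: fun_eq_iff linear_rules[OF lz(1)] der_add_value lx ly lz)
qed

section \<open>The isomorphism\<close>

abbreviation G where "G \<equiv> g_alg B S"
abbreviation H where "H \<equiv> gJ_alg V C"

lemma G_simps: "lbr G = g_bracket B S"
  "lscl G = (\<lambda>c (d, d', T). (\<lambda>i x. scl B c (d i x), \<lambda>i x. c \<odot> d' i x, \<lambda>i. tensor_scale c (T i)))"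
  "lprt G p = {(d, d', T). d \<in> tri_homog B p \<and> d' \<in> tri_homog S p \<and> (\<forall>i. T i \<in> tensor_homog B S p)}"
  by (simp_all add: g_alg_def)

lemma H_simps: "lbr H = gJ_bracket V C"
  "lscl H = (\<lambda>c (s, d, t). (\<lambda>v. c \<otimes> s v, \<lambda>x. mat_scale C c (d x), tensor_scale c t))"
  "lprt H 0 = sp V \<times> der C \<times> {0}" "lprt H (Suc 0) = {0} \<times> {0} \<times> TJT"
  by (simp_all add: gJ_alg_def)

subsection \<open>Normal forms in the source\<close>

lemma gA_add: "gA s + gA s' = gA (\<lambda>v. s v + s' v)"
  by (simp add: gA_def triple_add ev_def fun_eq_iff)

lemma gF_add: "gF d a + gF e b = gF (\<lambda>i x. d i x + e i x) (\<lambda>i. a i + b i)"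
  by (simp add: gF_def triple_add tt_add fun_eq_iff)

lemma gR_add: "gR u t b + gR u t' b' = gR u (t + t') (\<lambda>i. b i + b' i)"
  by (simp add: gR_def triple_add tt_add od_def fun_eq_iff plane.scale_left_distrib plane.scale_right_distrib)

lemma tensor_homog_cases:
  "t \<in> tensor_homog B S 0 \<Longrightarrow> \<exists>a. t = tt (1, 0) a"
  "t \<in> tensor_homog B S (Suc 0) \<Longrightarrow> \<exists>a b. t = tt (0, v1) a + tt (0, v2) b"
proof -
  have R0: "snd x = 0 \<or> a = 0" if "(x, a) \<in> (\<Union>r<2. \<Union>s\<in>{s. s < 2 \<and> (r + s) mod 2 = 0}. homog B r \<times> homog S s)" for x a
    using that by (auto simp: less_2_cases_iff)
  have R1: "fst x = 0 \<or> a = 0" if "(x, a) \<in> (\<Union>r<2. \<Union>s\<in>{s. s < 2 \<and> (r + s) mod 2 = Suc 0}. homog B r \<times> homog S s)" for x a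
    using that by (auto simp: less_2_cases_iff)
  show "\<exists>a. t = tt (1, 0) a" if "t \<in> tensor_homog B S 0"
    using that unfolding tensor_homog_def
  proof (induction rule: tensor_span_induct)
    case zero
    have "0 = tt (1, 0) 0" by simp
    then show ?case by blast
  next
    case (add x a s)
    then obtain b where s: "s = tt (1, 0) b" by blast
    obtain c w where x: "x = (c, w)" by (cases x)
    have "tt x a = tt (1, 0) (c \<odot> a)"
      using R0[OF add(1)] tt_even[of c a] unfolding x by (auto simp: tt_scale)
    then have "tt x a + s = tt (1, 0) (c \<odot> a + b)" unfolding s tt_add by simp
    then show ?case unfolding tn_def by blast
  qed
  show "\<exists>a b. t = tt (0, v1) a + tt (0, v2) b" if "t \<in> tensor_homog B S (Suc 0)"
    using that unfolding tensor_homog_def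
  proof (induction rule: tensor_span_induct)
    case zero
    have "0 = tt (0, v1) 0 + tt (0, v2) 0" by simp
    then show ?case by blast
  next
    case (add x a s)
    then obtain b b' where s: "s = tt (0, v1) b + tt (0, v2) b'" by blast
    obtain c w where x: "x = (c, w)" by (cases x)
    define p where "p = form w v2"
    define q where "q = form v1 w"
    have w: "w = p \<otimes> v1 + q \<otimes> v2" unfolding p_def q_def by (rule basis_expand)
    have "tt x a = tt (0, v1) (p \<odot> a) + tt (0, v2) (q \<odot> a)"
    proof (cases "a = 0")
      case False
      then have "x = (0, p \<otimes> v1) + (0, q \<otimes> v2)" using R1[OF add(1)] w unfolding x by simp
      then show ?thesis by (simp only: tt_add(1) tt_odd tt_scale)
    qed simp
    then have "tt x a + s = tt (0, v1) (p \<odot> a + b) + tt (0, v2) (q \<odot> a + b')"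
      unfolding s tt_add by (simp only: ac_simps)
    then show ?case unfolding tn_def by blast
  qed
qed

lemma tensor_homog_tt: "tt (1, 0) a \<in> tensor_homog B S 0" "tt (0, u) a \<in> tensor_homog B S (Suc 0)"
  unfolding tensor_homog_def tn_def
  by (rule tensor_span_tens, force simp: less_2_cases_iff)+

lemma tensor_homog_add: "s \<in> tensor_homog B S p \<Longrightarrow> t \<in> tensor_homog B S p \<Longrightarrow> s + t \<in> tensor_homog B S p"
  unfolding tensor_homog_def by (rule tensor_span_add)

lemma lprt_G_even: "lprt G 0 = {gA s + gF d a | s d a. s \<in> sp V \<and> triality d}"
proof (intro set_eqI iffI)
  fix x
  assume "x \<in> lprt G 0"
  then obtain s d T where x: "x = (\<lambda>_. ev s, d, T)" "s \<in> sp V" "triality d" "\<And>i. T i \<in> tensor_homog B S 0"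
    unfolding G_simps tri_homog_B_even tri_homog_even by blast
  obtain a where "\<And>i. T i = tt (1, 0) (a i)" using tensor_homog_cases(1)[OF x(4)] by metis
  then have "x = gA s + gF d a" unfolding x(1) gA_def gF_def triple_add by (simp add: fun_eq_iff)
  then show "x \<in> {gA s + gF d a | s d a. s \<in> sp V \<and> triality d}" using x by blast
next
  fix x
  assume "x \<in> {gA s + gF d a | s d a. s \<in> sp V \<and> triality d}"
  then obtain s d a where x: "x = gA s + gF d a" "s \<in> sp V" "triality d" by blast
  have "x = (\<lambda>_. ev s, d, \<lambda>i. tt (1, 0) (a i))" unfolding x(1) gA_def gF_def triple_add by (simp add: fun_eq_iff)
  then show "x \<in> lprt G 0" using x tensor_homog_tt(1)
    unfolding G_simps tri_homog_B_even tri_homog_even by blast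
qed

lemma lprt_G_odd: "lprt G (Suc 0) = {gR v1 t b + gR v2 t' b' | t b t' b'. True}"
proof (intro set_eqI iffI)
  fix x
  assume "x \<in> lprt G (Suc 0)"
  then obtain u T where x: "x = (\<lambda>_. od u, 0, T)" "\<And>i. T i \<in> tensor_homog B S (Suc 0)"
    unfolding G_simps tri_homog_B_odd tri_homog_odd by blast
  obtain b b' where T: "\<And>i. T i = tt (0, v1) (b i) + tt (0, v2) (b' i)" using tensor_homog_cases(2)[OF x(2)] by metis
  define p where "p = form u v2"
  define q where "q = form v1 u"
  have u: "u = p \<otimes> v1 + q \<otimes> v2" unfolding p_def q_def by (rule basis_expand)
  have "od u z = od (p \<otimes> v1) z + od (q \<otimes> v2) z" for z by (subst u) (rule od_linear)
  then have "x = gR v1 p b + gR v2 q b'" unfolding x(1) gR_def triple_add by (simp add: fun_eq_iff T)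
  then show "x \<in> {gR v1 t b + gR v2 t' b' | t b t' b'. True}" by blast
next
  fix x
  assume "x \<in> {gR v1 t b + gR v2 t' b' | t b t' b'. True}"
  then obtain t b t' b' where x: "x = gR v1 t b + gR v2 t' b'" by blast
  have "x = (\<lambda>_. od (t \<otimes> v1 + t' \<otimes> v2), 0, \<lambda>i. tt (0, v1) (b i) + tt (0, v2) (b' i))"
    unfolding x gR_def triple_add by (simp add: fun_eq_iff od_linear(1))
  then show "x \<in> lprt G (Suc 0)" using tensor_homog_add[OF tensor_homog_tt(2) tensor_homog_tt(2)]
    unfolding G_simps tri_homog_B_odd tri_homog_odd by blast
qed

lemma lcar_G: "lcar G = {gA s + gF d a + (gR v1 t b + gR v2 t' b') | s d a t b t' b'. s \<in> sp V \<and> triality d}"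
  unfolding lcar_def One_nat_def lprt_G_even lprt_G_odd by blast

lemma lcar_G_cases:
  assumes "x \<in> lcar G"
  obtains s d a t b t' b' where "s \<in> sp V" "triality d" "x = gA s + gF d a + (gR v1 t b + gR v2 t' b')"
  using assms unfolding lcar_G by blast

lemma gR_zero: "gR u 0 (\<lambda>_. 0) = 0"
  by (simp add: gR_def od_def zero_prod_def fun_eq_iff)

lemma gF_zero: "gF (\<lambda>_ _. 0) (\<lambda>_. 0) = 0"
  by (simp add: gF_def zero_prod_def fun_eq_iff)

lemma gA_zero: "gA (\<lambda>_. 0) = 0"
  by (simp add: gA_def ev_def zero_prod_def fun_eq_iff)

lemma triality_const_0: "triality (\<lambda>_ _. 0)"
  using triality_0 by (simp add: zero_fun_def)

lemma gR_basis: "gR u t b = gR v1 (form u v2 * t) (\<lambda>i. form u v2 \<odot> b i) + gR v2 (form v1 u * t) (\<lambda>i. form v1 u \<odot> b i)"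
proof -
  define p where "p = form u v2"
  define q where "q = form v1 u"
  have u: "u = p \<otimes> v1 + q \<otimes> v2" unfolding p_def q_def by (rule basis_expand)
  have "od (t \<otimes> u) z = od ((p * t) \<otimes> v1) z + od ((q * t) \<otimes> v2) z" for z
    by (subst u) (simp add: plane.scale_right_distrib od_linear(1) mult.commute)
  moreover have "tt (0, u) a = tt (0, v1) (p \<odot> a) + tt (0, v2) (q \<odot> a)" for a
  proof -
    have "(0, u) = (0, p \<otimes> v1) + (0 :: 'k, q \<otimes> v2)" using u by simp
    then show ?thesis by (simp only: tt_add(1) tt_odd tt_scale)
  qed
  ultimately show ?thesis unfolding gR_def triple_add p_def[symmetric] q_def[symmetric] by (simp add: fun_eq_iff)
qed

lemma generators_lcar: "s \<in> sp V \<Longrightarrow> gA s \<in> lcar G" "triality d \<Longrightarrow> gF d a \<in> lcar G" "gR u t b \<in> lcar G"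
proof -
  show "gA s \<in> lcar G" if "s \<in> sp V"
  proof -
    have "gA s = gA s + gF (\<lambda>_ _. 0) (\<lambda>_. 0) + (gR v1 0 (\<lambda>_. 0) + gR v2 0 (\<lambda>_. 0))"
      by (simp add: gF_zero gR_zero)
    then show ?thesis unfolding lcar_G using that triality_const_0 by blast
  qed
  show "gF d a \<in> lcar G" if "triality d"
  proof -
    have "gF d a = gA (\<lambda>_. 0) + gF d a + (gR v1 0 (\<lambda>_. 0) + gR v2 0 (\<lambda>_. 0))"
      by (simp add: gA_zero gR_zero)
    then show ?thesis unfolding lcar_G using that sp_zero by blast
  qed
  have "gR u t b = gA (\<lambda>_. 0) + gF (\<lambda>_ _. 0) (\<lambda>_. 0) + (gR v1 (form u v2 * t) (\<lambda>i. form u v2 \<odot> b i) + gR v2 (form v1 u * t) (\<lambda>i. form v1 u \<odot> b i))"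
    unfolding gR_basis[of u t b] gA_zero gF_zero by simp
  then show "gR u t b \<in> lcar G" unfolding lcar_G using sp_zero triality_const_0 by blast
qed

lemma sp_add: "s \<in> sp V \<Longrightarrow> s' \<in> sp V \<Longrightarrow> (\<lambda>v. s v + s' v) \<in> sp V"
  unfolding sp_def linear_V_iff by (auto simp: plane.scale_right_distrib algebra_simps)

lemma triality_add': "triality d \<Longrightarrow> triality e \<Longrightarrow> triality (\<lambda>i x. d i x + e i x)"
  using triality_add[of d e] by (simp add: plus_fun_def)

lemma lcar_G_add:
  assumes "x \<in> lcar G" "y \<in> lcar G"
  shows "x + y \<in> lcar G"
proof -
  obtain s d a t b t' b' where x: "s \<in> sp V" "triality d" "x = gA s + gF d a + (gR v1 t b + gR v2 t' b')"
    using assms(1) by (rule lcar_G_cases)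
  obtain r e c q f q' f' where y: "r \<in> sp V" "triality e" "y = gA r + gF e c + (gR v1 q f + gR v2 q' f')"
    using assms(2) by (rule lcar_G_cases)
  have "x + y = (gA s + gA r) + (gF d a + gF e c) + ((gR v1 t b + gR v1 q f) + (gR v2 t' b' + gR v2 q' f'))"
    unfolding x(3) y(3) by (simp only: ac_simps)
  then show ?thesis
    unfolding lcar_G gA_add gF_add gR_add using sp_add[OF x(1) y(1)] triality_add'[OF x(2) y(2)] by blast
qed

lemma lcar_G_induct [consumes 1, case_names A F R add]:
  assumes "x \<in> lcar G" "\<And>s. s \<in> sp V \<Longrightarrow> P (gA s)" "\<And>d a. triality d \<Longrightarrow> P (gF d a)" "\<And>u t b. P (gR u t b)"
    and "\<And>x y. x \<in> lcar G \<Longrightarrow> y \<in> lcar G \<Longrightarrow> P x \<Longrightarrow> P y \<Longrightarrow> P (x + y)"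
  shows "P x"
  using assms(1)
proof (rule lcar_G_cases)
  fix s d a t b t' b'
  assume s: "s \<in> sp V" and d: "triality d" and x: "x = gA s + gF d a + (gR v1 t b + gR v2 t' b')"
  note g = generators_lcar(1)[OF s] generators_lcar(2)[OF d, of a] generators_lcar(3)
  show "P x" unfolding x
    by (intro assms(5) lcar_G_add g assms(2)[OF s] assms(3)[OF d] assms(4))
qed

lemma lcar_G_W: "x \<in> lcar G \<Longrightarrow> x \<in> W"
proof (erule lcar_G_cases)
  fix s d a t b t' b'
  assume s: "s \<in> sp V" and d: "triality d" and x: "x = gA s + gF d a + (gR v1 t b + gR v2 t' b')"
  show "x \<in> W"
    unfolding x gA_def gF_def gR_def triple_add
    by (intro W_I linB_add linC_add linB_ev[OF s] linB_od linB_const_0 linC_const_0 triality_linear[OF d] TT_add TT_0 tt_TT)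
qed

subsection \<open>Normal forms in the target\<close>

text \<open>
  The images of \<open>gA\<close>, \<open>gF\<close>, \<open>gR\<close>.
\<close>

definition hA :: "('v \<Rightarrow> 'v) \<Rightarrow> ('k, 'v, 'c) gJelt" where
  "hA s = (s, \<lambda>_. 0, 0)"

definition hF :: "'c triple \<Rightarrow> (3 \<Rightarrow> 'c) \<Rightarrow> ('k, 'v, 'c) gJelt" where
  "hF d a = (\<lambda>_. 0, Phi d a, 0)"

definition hR :: "'v \<Rightarrow> 'k \<Rightarrow> (3 \<Rightarrow> 'c) \<Rightarrow> ('k, 'v, 'c) gJelt" where
  "hR u t b = (\<lambda>_. 0, \<lambda>_. 0, tJ u (TJel t b))"

lemma lcar_H: "lcar H = {(s, D, t). s \<in> sp V \<and> D \<in> der C \<and> t \<in> TJT}"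
proof -
  have "(s, D, t) \<in> lcar H" if "s \<in> sp V" "D \<in> der C" "t \<in> TJT" for s D t
  proof -
    have "(s, D, t) = (s, D, 0) + (0, 0, t)" by simp
    then show ?thesis unfolding lcar_def One_nat_def H_simps using that by blast
  qed
  then show ?thesis unfolding lcar_def One_nat_def H_simps by auto
qed

lemma der_zero_map: "(\<lambda>_. 0) \<in> der C"
  unfolding der_def by (auto simp: jordan_0 mat_scale_zero jL_zero[unfolded jL_def] elim!: jordanE)
    (simp_all add: jmul_jel jel_inject jprod_diag_def jprod_off_def flip: jel_0)

lemma hA_lcar: "s \<in> sp V \<Longrightarrow> hA s \<in> lcar H" and hF_lcar: "triality d \<Longrightarrow> hF d a \<in> lcar H" and hR_lcar: "hR u t b \<in> lcar H"
  unfolding lcar_H hA_def hF_def hR_def using der_zero_map sp_zero Phi_in_der by auto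

lemma der_add_map:
  assumes "D \<in> der C" "D' \<in> der C"
  shows "(\<lambda>x. D x + D' x) \<in> der C"
proof -
  obtain d a where d: "triality d" "D = Phi d a" using der_is_Phi[OF assms(1)] by blast
  obtain e b where e: "triality e" "D' = Phi e b" using der_is_Phi[OF assms(2)] by blast
  have "(\<lambda>x. D x + D' x) = Phi (d + e) (\<lambda>i. a i + b i)"
    unfolding Phi_add[OF d(1) e(1)] d(2) e(2) by (simp add: fun_eq_iff)
  then show ?thesis using Phi_in_der[OF triality_add[OF d(1) e(1)]] by simp
qed

lemma lcar_H_add:
  assumes "x \<in> lcar H" "y \<in> lcar H"
  shows "x + y \<in> lcar H"
proof -
  obtain s D t where x: "x = (s, D, t)" "s \<in> sp V" "D \<in> der C" "t \<in> TJT" using assms(1) unfolding lcar_H by blast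
  obtain s' D' t' where y: "y = (s', D', t')" "s' \<in> sp V" "D' \<in> der C" "t' \<in> TJT" using assms(2) unfolding lcar_H by blast
  show ?thesis unfolding x(1) y(1) gJ_triple_add lcar_H
    using sp_add[OF x(2) y(2)] der_add_map[OF x(3) y(3)] TJT_add[OF x(4) y(4)] by blast
qed

lemma lcar_H_WH: "x \<in> lcar H \<Longrightarrow> x \<in> WH"
  unfolding lcar_H WH_def using sp_linear by blast

lemma linV_0: "linV (\<lambda>_. 0)"
  unfolding linear_V_iff by simp

lemma Phi_zero: "Phi (\<lambda>_ _. 0) (\<lambda>_. 0) = (\<lambda>_. 0)"
  by (rule endo_eqI) (simp_all add: Phi_outside Phi_jel Phi_diag_def Phi_off_def jel_0)

text \<open>
  In this uniform shape all brackets of generators are instances of one formula.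
\<close>

lemma h_alt:
  "hA s = (s, Phi (\<lambda>_ _. 0) (\<lambda>_. 0), tJ 0 (TJel 0 (\<lambda>_. 0)))"
  "hF d a = (\<lambda>_. 0, Phi d a, tJ 0 (TJel 0 (\<lambda>_. 0)))"
  "hR u t b = (\<lambda>_. 0, Phi (\<lambda>_ _. 0) (\<lambda>_. 0), tJ u (TJel t b))"
  unfolding hA_def hF_def hR_def Phi_zero tJ_0 by simp_all

lemma gJ_bracket_generators:
  assumes s: "linV s" "linV s'" and d: "triality d" and e: "triality e"
  shows "gJ_bracket V C (s, Phi d a, tJ u (TJel t b)) (s', Phi e c, tJ v (TJel t' b')) =
    (\<lambda>w. s (s' w) - s' (s w) + (t * t' - (\<Sum>i\<in>UNIV. bf (b i) (b' i))) \<otimes> gam V u v w,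
     \<lambda>x. Phi (tri_part d e a c)
         (even_bracket d a e c) x +
       mat_scale C (form u v) (Phi (theta_sum b b')
         (odd_bracket t b t' b') x),
     tJ (s v) (TJel t' b') + tJ v (TJel (\<Sum>i\<in>UNIV. bf (a i) (b' i))
         (odd_action d a t' b'))
     - (tJ (s' u) (TJel t b) + tJ u (TJel (\<Sum>i\<in>UNIV. bf (c i) (b i))
         (odd_action e c t b))))"
  unfolding gJ_bracket_eq actJ_tJ[OF s(1) Phi_in_der[OF d]] actJ_tJ[OF s(2) Phi_in_der[OF e]]
    TJ_act_TJel[OF d] TJ_act_TJel[OF e] oddJ1_tJ oddJ2_tJ TJ_form_TJel TJ_comm_TJel commutator_Phi[OF d e, symmetric] commutator_def
  by (simp add: fun_eq_iff)

lemma gam_0: "gam V 0 v w = 0" "gam V u 0 w = 0"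
  by (simp_all add: gam_def)

lemmas bracket_parts = even_bracket_def tri_part_def odd_action_def odd_bracket_def

lemma hbracket_AA:
  assumes "s \<in> sp V" "s' \<in> sp V"
  shows "gJ_bracket V C (hA s) (hA s') = hA (\<lambda>u. s (s' u) - s' (s u))"
proof -
  have 0: "theta_sum (\<lambda>_. 0) (\<lambda>_. 0) = (\<lambda>_ _. 0)" by (simp add: fun_eq_iff)
  show ?thesis
    unfolding h_alt gJ_bracket_generators[OF sp_linear[OF assms(1)] sp_linear[OF assms(2)] triality_const_0 triality_const_0]
    by (simp add: sp_rules[OF assms(1)] sp_rules[OF assms(2)] gam_0 tJ_0 bracket_parts mat_scale_0 0 Phi_zero)
qed

lemma hbracket_AF:
  assumes "s \<in> sp V" "triality d"
  shows "gJ_bracket V C (hA s) (hF d a) = 0" (is ?A) "gJ_bracket V C (hF d a) (hA s) = 0" (is ?B)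
proof -
  note sr = sp_rules[OF assms(1)] and dr = triality_rules[OF assms(2)]
  show "?A" "?B"
    unfolding h_alt gJ_bracket_generators[OF sp_linear[OF assms(1)] linV_0 triality_const_0 assms(2)]
      gJ_bracket_generators[OF linV_0 sp_linear[OF assms(1)] assms(2) triality_const_0]
    by (simp_all add: sr dr gam_0 tJ_0 bracket_parts mat_scale_0 Phi_zero zero_prod_def zero_fun_def)
qed

lemma hbracket_AR:
  assumes "s \<in> sp V"
  shows "gJ_bracket V C (hA s) (hR u t b) = hR (s u) t b" (is ?A) "gJ_bracket V C (hR u t b) (hA s) = hR (- s u) t b" (is ?B)
proof -
  note sr = sp_rules[OF assms(1)]
  show "?A" "?B"
    unfolding h_alt gJ_bracket_generators[OF sp_linear[OF assms(1)] linV_0 triality_const_0 triality_const_0]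
      gJ_bracket_generators[OF linV_0 sp_linear[OF assms(1)] triality_const_0 triality_const_0]
    by (simp_all add: sr gam_0 tJ_0 bracket_parts mat_scale_0 Phi_zero tJ_minus)
qed

lemma hbracket_FF:
  assumes d: "triality d" and e: "triality e"
  shows "gJ_bracket V C (hF d a) (hF e b) = hF (tri_part d e a b)
      (even_bracket d a e b)"
  unfolding h_alt gJ_bracket_generators[OF linV_0 linV_0 d e]
  by (simp add: gam_0 tJ_0 bracket_parts mat_scale_0)

lemma hbracket_FR:
  assumes d: "triality d"
  shows "gJ_bracket V C (hF d a) (hR u t b) = hR u (\<Sum>i\<in>UNIV. bf (a i) (b i))
      (odd_action d a t b)"
    "gJ_bracket V C (hR u t b) (hF d a) = hR (- u) (\<Sum>i\<in>UNIV. bf (a i) (b i))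
      (odd_action d a t b)"
  unfolding h_alt gJ_bracket_generators[OF linV_0 linV_0 d triality_const_0] gJ_bracket_generators[OF linV_0 linV_0 triality_const_0 d]
  by (simp_all add: gam_0 tJ_0 bracket_parts mat_scale_0 Phi_zero tJ_minus triality_rules[OF d])

lemma hbracket_RR:
  "gJ_bracket V C (hR u t b) (hR v t' b') =
     hA (\<lambda>w. (t * t' - (\<Sum>i\<in>UNIV. bf (b i) (b' i))) \<otimes> gam V u v w) +
     hF (\<lambda>i z. form u v \<odot> theta_sum b b' i z)
       (\<lambda>j. form u v \<odot> odd_bracket t b t' b' j)"
proof -
  have "Phi (\<lambda>i z. form u v \<odot> theta_sum b b' i z)
       (\<lambda>j. form u v \<odot> odd_bracket t b t' b' j) x =
     mat_scale C (form u v) (Phi (theta_sum b b') (odd_bracket t b t' b') x)" for x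
    by (rule Phi_linear) simp_all
  then show ?thesis
    unfolding h_alt gJ_bracket_generators[OF linV_0 linV_0 triality_const_0 triality_const_0] gJ_triple_add
    by (simp add: Phi_zero tJ_0 bracket_parts)
qed

text \<open>Uniqueness of the normal form, seen by bilinear forms on the tensor product of the plane and \<open>T\<^sub>J\<close>.\<close>

lemma TJT_coordinates:
  assumes "tJ v1 (TJel t b) + tJ v2 (TJel t' b') = tJ v1 (TJel r c) + tJ v2 (TJel r' c')"
  shows "t = r \<and> b = c \<and> t' = r' \<and> b' = c'"
proof -
  define co where "co X = (THE p. X = TJel (fst p) (snd p))" for X
  have co: "co (TJel t b) = (t, b)" for t b
    unfolding co_def by (rule the_equality) (auto simp: TJel_inject)
  \<comment> \<open>Evaluate at \<open>\<langle>w|u\<rangle> f(t, b)\<close> for a linear form \<open>f\<close>, with \<open>w\<close> a basis vector.\<close>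
  have ev: "form w v1 * f t b + form w v2 * f t' b' = form w v1 * f r c + form w v2 * f r' c'"
    if "\<And>t b t' b'. f (t + t') (\<lambda>i. b i + b' i) = f t b + f t' b'" "\<And>k t b. f (k * t) (\<lambda>i. k \<odot> b i) = k * f t b"
    for f :: "'k \<Rightarrow> (3 \<Rightarrow> 'c) \<Rightarrow> 'k" and w
  proof -
    have bl: "bilinear_map (vs_plane V) (TJ C) (*) (\<lambda>u X. form w u * (case co X of (t, b) \<Rightarrow> f t b))"
      by (rule bilinear_VTI) (simp_all add: co that vector_space_mult algebra_simps)
    have l: "liftJ (\<lambda>u X. form w u * (case co X of (t, b) \<Rightarrow> f t b)) (tJ u (TJel t b)) = form w u * f t b" for u t b
      using tensor_lift_tens[OF bl, of u "TJel t b"] by (simp add: tnJ_def co)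
    show ?thesis
      using arg_cong[OF assms, of "liftJ (\<lambda>u X. form w u * (case co X of (t, b) \<Rightarrow> f t b))"]
      by (simp only: tensor_lift_add[OF bl tJ_TJT tJ_TJT] l)
  qed
  have "t = r" "t' = r'" using ev[of "\<lambda>t b. t" v2] ev[of "\<lambda>t b. t" v1] by simp_all
  moreover have "b i = c i" for i
    by (rule bf_eqI) (use ev[of "\<lambda>t b. bf (b i) _" v2] in simp)
  moreover have "b' i = c' i" for i
    by (rule bf_eqI) (use ev[of "\<lambda>t b. bf (b i) _" v1] in simp)
  ultimately show ?thesis by blast
qed

lemma Phi_inject:
  assumes d: "triality d" and e: "triality e" and eq: "Phi d a = Phi e b"
  shows "d = e \<and> a = b"
proof -
  have p: "Phi_off d a \<beta> x = Phi_off e b \<beta> x" for \<beta> x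
    using fun_cong[OF eq, of "jel \<beta> x"] unfolding Phi_jel jel_inject by blast
  have "a j = b j" for j
    using fun_cong[OF p[of "single (j + 2) 1" "\<lambda>_. 0"], of j]
    by (simp add: Phi_off_def triality_rules[OF d] triality_rules[OF e])
  moreover have "d j z = e j z" for j z
    using fun_cong[OF p[of "\<lambda>_. 0" "single j z"], of j] by (simp add: Phi_off_def)
  ultimately show ?thesis by (auto simp: fun_eq_iff)
qed

lemma D_iota_outside: "x \<notin> jordan C \<Longrightarrow> D_iota C i a x = 0"
  unfolding D_iota_def
  by (subst commutator_outside) (simp_all add: jL_outside jL_zero jiota_jel je_jel mat_scale_zero)

lemma D_iota_Phi: "D_iota C i a = Phi (\<lambda>_ _. 0) (single i a)"
proof (rule endo_eqI)
  fix \<beta> b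
  show "D_iota C i a (jel \<beta> b) = Phi (\<lambda>_ _. 0) (single i a) (jel \<beta> b)"
    unfolding D_iota_jel Phi_jel jel_inject Phi_diag_def Phi_off_def
  proof (intro conjI ext, goal_cases)
    case (1 j) then show ?case by (cases rule: index3_cases[of j i]) simp_all
  next
    case (2 j) then show ?case by (cases rule: index3_cases[of j i]) simp_all
  qed
qed (simp_all add: D_iota_outside Phi_outside)

lemma D_tri_Phi: "D_tri C d = Phi d (\<lambda>_. 0)"
  by (rule endo_eqI) (simp_all add: Phi_outside D_tri_jel Phi_jel Phi_diag_def Phi_off_def jel_inject, simp add: D_tri_def)

lemma g_iota_generators:
  "g_iota i (tt (1, 0) a) = gF (\<lambda>_ _. 0) (single i a)"
  "g_iota i (tt (0, u) s) = gR u 0 (single i s)"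
  unfolding g_iota_def gF_def gR_def by (auto simp: fun_eq_iff od_def zero_prod_def)

lemma single_sum: "(\<lambda>i. single 0 (a 0) i + single 1 (a 1) i + single 2 (a 2) i) = a"
  for a :: "3 \<Rightarrow> 'w::monoid_add"
proof
  fix i show "single 0 (a 0) i + single 1 (a 1) i + single 2 (a 2) i = a i"
    using index3_exhaust[of i] by (elim disjE) simp_all
qed

lemma gF_decompose: "gF d a = gF d (\<lambda>_. 0) + (gF (\<lambda>_ _. 0) (single 0 (a 0)) + gF (\<lambda>_ _. 0) (single 1 (a 1)) + gF (\<lambda>_ _. 0) (single 2 (a 2)))"
  unfolding gF_add single_sum by simp

lemma gR_decompose: "gR u t b = gR (t \<otimes> u) 1 (\<lambda>_. 0) + (gR u 0 (single 0 (b 0)) + gR u 0 (single 1 (b 1)) + gR u 0 (single 2 (b 2)))"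
proof -
  have "gR (t \<otimes> u) 1 (\<lambda>_. 0) = gR u t (\<lambda>_. 0)" unfolding gR_def by simp
  then show ?thesis unfolding gR_add single_sum by (simp add: gR_add)
qed

lemma hF_add: "triality d \<Longrightarrow> triality e \<Longrightarrow> hF d a + hF e b = hF (\<lambda>i x. d i x + e i x) (\<lambda>i. a i + b i)"
  unfolding hF_def gJ_triple_add using Phi_linear(1)[of "\<lambda>i x. d i x + e i x" d e "\<lambda>i. a i + b i" a b] by (simp add: fun_eq_iff)

lemma hR_add: "hR u t b + hR u t' b' = hR u (t + t') (\<lambda>i. b i + b' i)"
  unfolding hR_def gJ_triple_add tJ_add by simp

lemma hF_decompose:
  assumes "triality d"
  shows "hF d a = hF d (\<lambda>_. 0) + (hF (\<lambda>_ _. 0) (single 0 (a 0)) + hF (\<lambda>_ _. 0) (single 1 (a 1)) + hF (\<lambda>_ _. 0) (single 2 (a 2)))"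
  by (simp add: hF_add triality_const_0 assms single_sum)

lemma hR_decompose: "hR u t b = hR (t \<otimes> u) 1 (\<lambda>_. 0) + (hR u 0 (single 0 (b 0)) + hR u 0 (single 1 (b 1)) + hR u 0 (single 2 (b 2)))"
proof -
  have "hR (t \<otimes> u) 1 (\<lambda>_. 0) = hR u t (\<lambda>_. 0)"
    unfolding hR_def tJ_scale(1) using tJ_scale(2)[of u t 1 "\<lambda>_. 0"] by simp
  then show ?thesis unfolding hR_add single_sum by (simp add: hR_add)
qed

lemma linear_on_add: "linear_on G H \<Psi> \<Longrightarrow> x \<in> lcar G \<Longrightarrow> y \<in> lcar G \<Longrightarrow> \<Psi> (x + y) = \<Psi> x + \<Psi> y"
  unfolding linear_on_def by blast

text \<open>Linearity and the five conditions fix the values of the map on the generators.\<close>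

lemma Psi_generators:
  assumes lin: "linear_on G H \<Psi>" and c: "Psi_conditions V C \<Psi>"
  shows "s \<in> sp V \<Longrightarrow> \<Psi> (gA s) = hA s" "triality d \<Longrightarrow> \<Psi> (gF d a) = hF d a" "\<Psi> (gR u t b) = hR u t b"
proof -
  note add = linear_on_add[OF lin]
  note g = generators_lcar lcar_G_add
  have z: "(\<lambda>_ _. 0) = (0 :: 'w \<Rightarrow> 'u \<Rightarrow> 'z::zero)" "(\<lambda>_. 0) = (0 :: 'w \<Rightarrow> 'z::zero)" by (simp_all add: fun_eq_iff)
  show "\<Psi> (gA s) = hA s" if s: "s \<in> sp V" for s
  proof -
    have "(\<lambda>_. ev s) \<in> tri_homog B 0" unfolding tri_homog_B_even using s by blast
    then show ?thesis using c unfolding Psi_conditions_def gA_def hA_def z by (force simp: ev_def)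
  qed
  have F0: "\<Psi> (gF d (\<lambda>_. 0)) = hF d (\<lambda>_. 0)" if "triality d" for d
  proof -
    have "gF d (\<lambda>_. 0) = (0, d, 0)" unfolding gF_def by (simp add: fun_eq_iff)
    moreover have "hF d (\<lambda>_. 0) = (0, D_tri C d, 0)" unfolding hF_def D_tri_Phi by (simp add: fun_eq_iff)
    ultimately show ?thesis using c that unfolding Psi_conditions_def tri_para by auto
  qed
  have Fi: "\<Psi> (gF (\<lambda>_ _. 0) (single i a)) = hF (\<lambda>_ _. 0) (single i a)" for i a
  proof -
    have "hF (\<lambda>_ _. 0) (single i a) = (0, D_iota C i a, 0)" unfolding hF_def D_iota_Phi by (simp add: fun_eq_iff)
    then show ?thesis using c unfolding Psi_conditions_def g_iota_generators by auto
  qed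
  show "\<Psi> (gF d a) = hF d a" if d: "triality d" for d a
    unfolding gF_decompose[of d a] hF_decompose[OF d, of a]
    by (simp only: add g d triality_const_0 F0 Fi)
  have R1: "\<Psi> (gR u 1 (\<lambda>_. 0)) = hR u 1 (\<lambda>_. 0)" for u
  proof -
    have "gR u 1 (\<lambda>_. 0) = (\<lambda>_. sigma B (1, 0) (0, u), 0, 0)" unfolding gR_def sigma_B by (simp add: fun_eq_iff)
    moreover have "hR u 1 (\<lambda>_. 0) = (0, 0, tJ u (hat_iota1 C))" unfolding hR_def hat_iota1_TJel by (simp add: fun_eq_iff)
    ultimately show ?thesis using c unfolding Psi_conditions_def by auto
  qed
  have Ri: "\<Psi> (gR u 0 (single i s)) = hR u 0 (single i s)" for u i s
  proof -
    have "hR u 0 (single i s) = (0, 0, tJ u (hat_iota C i s))" unfolding hR_def hat_iota_TJel by (simp add: fun_eq_iff)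
    then show ?thesis using c unfolding Psi_conditions_def g_iota_generators by auto
  qed
  show "\<Psi> (gR u t b) = hR u t b" for u t b
    unfolding gR_decompose[of u t b] hR_decompose[of u t b]
    by (simp only: add g R1 Ri)
qed

lemma Psi_normal_form:
  assumes lin: "linear_on G H \<Psi>" and c: "Psi_conditions V C \<Psi>" and s: "s \<in> sp V" and d: "triality d"
  shows "\<Psi> (gA s + gF d a + (gR v1 t b + gR v2 t' b')) = (s, Phi d a, tJ v1 (TJel t b) + tJ v2 (TJel t' b'))"
proof -
  note add = linear_on_add[OF lin]
  show ?thesis
    by (simp only: add generators_lcar lcar_G_add s d Psi_generators[OF lin c])
       (simp add: hA_def hF_def hR_def fun_eq_iff)
qed

lemma Psi_unique:
  assumes "linear_on G H \<Psi>" "Psi_conditions V C \<Psi>" "linear_on G H \<Psi>'" "Psi_conditions V C \<Psi>'" and x: "x \<in> lcar G"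
  shows "\<Psi> x = \<Psi>' x"
  using x by (rule lcar_G_cases) (simp only: Psi_normal_form[OF assms(1,2)] Psi_normal_form[OF assms(3,4)])

lemma triality_tri_part: "triality d \<Longrightarrow> triality e \<Longrightarrow> triality (tri_part d e a b)"
proof -
  assume d: "triality d" and e: "triality e"
  have "triality (\<lambda>i z. (d i (e i z) - e i (d i z)) + (-1) \<odot> theta_sum a b i z)"
    by (intro triality_add' triality_commutator triality_scale d e triality_theta_sum)
  then show ?thesis by (simp add: tri_part_def)
qed

lemma gam_sp: "(\<lambda>w. c \<otimes> gam V u v w) \<in> sp V"
  unfolding sp_def linear_V_iff gam_def
  by (simp add: plane.scale_right_distrib plane.scale_left_distrib algebra_simps form_swap[of _ u] form_swap[of _ v])

lemma commutator_sp:
  assumes "s \<in> sp V" "s' \<in> sp V"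
  shows "(\<lambda>u. s (s' u) - s' (s u)) \<in> sp V"
  unfolding sp_def linear_V_iff
  by (simp add: sp_rules[OF assms(1)] sp_rules[OF assms(2)] sp_skew[OF assms(1)] sp_skew[OF assms(2)]
      plane.scale_right_diff_distrib)

lemma zero_lcar_G: "0 \<in> lcar G"
  using generators_lcar(3)[of v1 0 "\<lambda>_. 0"] by (simp add: gR_zero)

lemma Psi_bracket_generators:
  assumes lin: "linear_on G H \<Psi>" and c: "Psi_conditions V C \<Psi>"
    and x: "(\<exists>s \<in> sp V. x = gA s) \<or> (\<exists>d a. triality d \<and> x = gF d a) \<or> (\<exists>u t b. x = gR u t b)"
    and y: "(\<exists>s \<in> sp V. y = gA s) \<or> (\<exists>d a. triality d \<and> y = gF d a) \<or> (\<exists>u t b. y = gR u t b)"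
  shows "g_bracket B S x y \<in> lcar G \<and> \<Psi> (g_bracket B S x y) = gJ_bracket V C (\<Psi> x) (\<Psi> y)"
proof -
  note add = linear_on_add[OF lin]
  have "\<Psi> 0 = 0" using add[OF zero_lcar_G zero_lcar_G] by simp
  moreover have "triality (\<lambda>i z. form u v \<odot> theta_sum b b' i z)" for u v b b'
    by (rule triality_scale[OF triality_theta_sum])
  ultimately show ?thesis
    using x y
    by (elim disjE bexE exE conjE; simp only:)
       (simp_all add: bracket_AA bracket_AF bracket_AR bracket_FF bracket_FR bracket_RR
        hbracket_AA hbracket_AF hbracket_AR hbracket_FF hbracket_FR hbracket_RR Psi_generators[OF lin c]
        generators_lcar lcar_G_add zero_lcar_G add gam_sp commutator_sp triality_tri_part)
qed

text \<open>
  Both brackets are biadditive and the generators span, so the brackets of generators decide.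
\<close>

lemma Psi_bracket:
  assumes lin: "linear_on G H \<Psi>" and c: "Psi_conditions V C \<Psi>" and x: "x \<in> lcar G" and y: "y \<in> lcar G"
  shows "g_bracket B S x y \<in> lcar G \<and> \<Psi> (g_bracket B S x y) = gJ_bracket V C (\<Psi> x) (\<Psi> y)"
proof -
  note Psi_add = linear_on_add[OF lin]
  have W: "x \<in> lcar G \<Longrightarrow> \<Psi> x \<in> WH" for x using lin lcar_H_WH unfolding linear_on_def by blast
  define gen where "gen x \<longleftrightarrow> (\<exists>s \<in> sp V. x = gA s) \<or> (\<exists>d a. triality d \<and> x = gF d a) \<or> (\<exists>u t b. x = gR u t b)" for x
  have gen: "s \<in> sp V \<Longrightarrow> gen (gA s)" "triality d \<Longrightarrow> gen (gF d a)" "gen (gR u t b)" for s d a u t b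
    unfolding gen_def by blast+
  have gg: "g_bracket B S x y \<in> lcar G \<and> \<Psi> (g_bracket B S x y) = gJ_bracket V C (\<Psi> x) (\<Psi> y)" if "gen x" "gen y" for x y
    using Psi_bracket_generators[OF lin c] that unfolding gen_def by blast
  have gx: "g_bracket B S x y \<in> lcar G \<and> \<Psi> (g_bracket B S x y) = gJ_bracket V C (\<Psi> x) (\<Psi> y)" if x: "gen x" "x \<in> lcar G" for x
    using y
  proof (induction y rule: lcar_G_induct)
    case (add y z)
    note e = g_bracket_add_right[OF lcar_G_W[OF add(1)] lcar_G_W[OF add(2)] lcar_G_W[OF x(2)]]
      gJ_bracket_add(2)[OF W[OF add(1)] W[OF add(2)] W[OF x(2)]]
    show ?case unfolding e Psi_add[OF add(1,2)]
      using add lcar_G_add Psi_add e by simp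
  qed (rule gg[OF x(1) gen(1)] gg[OF x(1) gen(2)] gg[OF x(1) gen(3)]; assumption?)+
  show ?thesis using x
  proof (induction x rule: lcar_G_induct)
    case (add x z)
    note e = g_bracket_add_left[OF lcar_G_W[OF add(1)] lcar_G_W[OF add(2)] lcar_G_W[OF y]]
      gJ_bracket_add(1)[OF W[OF add(1)] W[OF add(2)] W[OF y]]
    show ?case unfolding e Psi_add[OF add(1,2)]
      using add lcar_G_add Psi_add e by simp
  qed (auto intro!: gx gen generators_lcar)
qed

lemma Psi_iso:
  assumes lin: "linear_on G H \<Psi>" and c: "Psi_conditions V C \<Psi>"
  shows "lie_superalg_iso G H \<Psi>"
proof -
  note nf = Psi_normal_form[OF lin c]
  have inj: "inj_on \<Psi> (lcar G)"
  proof (rule inj_onI)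
    fix x y
    assume "x \<in> lcar G" "y \<in> lcar G" and eq: "\<Psi> x = \<Psi> y"
    obtain s d a t b t' b' where x: "s \<in> sp V" "triality d" "x = gA s + gF d a + (gR v1 t b + gR v2 t' b')"
      using \<open>x \<in> lcar G\<close> by (rule lcar_G_cases)
    obtain r e h q f q' f' where y: "r \<in> sp V" "triality e" "y = gA r + gF e h + (gR v1 q f + gR v2 q' f')"
      using \<open>y \<in> lcar G\<close> by (rule lcar_G_cases)
    have "s = r" "Phi d a = Phi e h" "tJ v1 (TJel t b) + tJ v2 (TJel t' b') = tJ v1 (TJel q f) + tJ v2 (TJel q' f')"
      using eq unfolding x(3) y(3) nf[OF x(1,2)] nf[OF y(1,2)] by simp_all
    with Phi_inject[OF x(2) y(2)] TJT_coordinates show "x = y" unfolding x(3) y(3) by metis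
  qed
  have surj: "\<Psi> ` lcar G = lcar H"
  proof
    show "\<Psi> ` lcar G \<subseteq> lcar H" using lin unfolding linear_on_def by blast
    show "lcar H \<subseteq> \<Psi> ` lcar G"
    proof
      fix y
      assume "y \<in> lcar H"
      then obtain s D T where y: "y = (s, D, T)" "s \<in> sp V" "D \<in> der C" "T \<in> TJT" unfolding lcar_H by blast
      obtain d a where d: "triality d" "D = Phi d a" using der_is_Phi[OF y(3)] by blast
      obtain t b t' b' where T: "T = tJ v1 (TJel t b) + tJ v2 (TJel t' b')" using TJT_basis[OF y(4)] by blast
      have "y = \<Psi> (gA s + gF d a + (gR v1 t b + gR v2 t' b'))" unfolding nf[OF y(2) d(1)] y(1) d(2) T ..
      moreover have "gA s + gF d a + (gR v1 t b + gR v2 t' b') \<in> lcar G" unfolding lcar_G using y(2) d(1) by blast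
      ultimately show "y \<in> \<Psi> ` lcar G" by blast
    qed
  qed
  have even: "\<Psi> x \<in> lprt H 0" if x0: "x \<in> lprt G 0" for x
  proof -
    obtain s d a where x: "s \<in> sp V" "triality d" "x = gA s + gF d a" using x0 unfolding lprt_G_even by blast
    have "\<Psi> x = (s, Phi d a, 0)"
      using nf[OF x(1,2), of a 0 "\<lambda>_. 0" 0 "\<lambda>_. 0"] unfolding x(3) gR_zero tJ_0 by simp
    then show ?thesis using x Phi_in_der unfolding H_simps by simp
  qed
  have odd: "\<Psi> x \<in> lprt H 1" if x1: "x \<in> lprt G 1" for x
  proof -
    obtain t b t' b' where x: "x = gR v1 t b + gR v2 t' b'" using x1 unfolding One_nat_def lprt_G_odd by blast
    have "\<Psi> x = (\<lambda>_. 0, \<lambda>_. 0, tJ v1 (TJel t b) + tJ v2 (TJel t' b'))"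
      using nf[OF sp_zero triality_const_0, of "\<lambda>_. 0" t b t' b'] unfolding x gA_zero gF_zero Phi_zero by simp
    then show ?thesis unfolding One_nat_def H_simps by (simp add: zero_fun_def)
  qed
  show ?thesis
    unfolding lie_superalg_iso_def bij_betw_def G_simps(1) H_simps(1)
    using lin inj surj even odd Psi_bracket[OF lin c] by (auto simp: less_2_cases_iff)
qed

subsection \<open>Existence of the map\<close>

abbreviation even_lift where "even_lift i \<equiv> lift (\<lambda>x s. D_iota C i (fst x \<odot> s))"
abbreviation odd_lift where "odd_lift i \<equiv> lift (\<lambda>x s. tJ (snd x) (TJel 0 (single i s)))"

lemma even_lift_bilinear: "bilinear_map (vs_of B) (vs_of S) (\<lambda>c f z. mat_scale C c (f z)) (\<lambda>x s. D_iota C i (fst x \<odot> s))"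
proof (rule bilinear_BSI)
  show "vector_space (\<lambda>c (f :: 'c^3^3 \<Rightarrow> 'c^3^3) z. mat_scale C c (f z))" by (rule vector_space_fun[OF vector_space_mat])
  fix x y :: "'k \<times> 'v" and a b :: 'c and c
  show "D_iota C i (fst (x + y) \<odot> a) = D_iota C i (fst x \<odot> a) + D_iota C i (fst y \<odot> a)"
    "D_iota C i (fst x \<odot> (a + b)) = D_iota C i (fst x \<odot> a) + D_iota C i (fst x \<odot> b)"
    "D_iota C i (fst (scl B c x) \<odot> a) = (\<lambda>z. mat_scale C c (D_iota C i (fst x \<odot> a) z))"
    "D_iota C i (fst x \<odot> (c \<odot> a)) = (\<lambda>z. mat_scale C c (D_iota C i (fst x \<odot> a) z))"
    unfolding D_iota_Phi fun_eq_iff plus_fun_def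
    by (intro allI Phi_linear; simp add: scl_B kc_simps)+
qed

lemma odd_lift_bilinear: "bilinear_map (vs_of B) (vs_of S) tensor_scale (\<lambda>x s. tJ (snd x) (TJel 0 (single i s)))"
proof (rule bilinear_BSI[OF vector_space_tensor_scale])
  fix x y :: "'k \<times> 'v" and a b :: 'c and c
  have 1: "single i (a + b) = (\<lambda>j. single i a j + single i b j)" for a b :: 'c by auto
  have 2: "single i (c \<odot> a) = (\<lambda>j. c \<odot> single i a j)" for c a by auto
  show "tJ (snd (x + y)) (TJel 0 (single i a)) = tJ (snd x) (TJel 0 (single i a)) + tJ (snd y) (TJel 0 (single i a))"
    by (simp add: tJ_add)
  show "tJ (snd x) (TJel 0 (single i (a + b))) = tJ (snd x) (TJel 0 (single i a)) + tJ (snd x) (TJel 0 (single i b))"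
    unfolding 1 using tJ_add(2)[of "snd x" 0 0] by simp
  show "tJ (snd (scl B c x)) (TJel 0 (single i a)) = tensor_scale c (tJ (snd x) (TJel 0 (single i a)))"
    by (simp add: scl_B tJ_scale)
  show "tJ (snd x) (TJel 0 (single i (c \<odot> a))) = tensor_scale c (tJ (snd x) (TJel 0 (single i a)))"
    unfolding 2 using tJ_scale(2)[of "snd x" c 0] by simp
qed

text \<open>
  The tensor components are the linear extensions of \<open>(c + u) \<otimes> s \<mapsto> c D\<^sub>i(s)\<close> and
  \<open>(c + u) \<otimes> s \<mapsto> u \<otimes> \<iota>\<^sub>i(s)\<close>. The vector \<open>u\<close> of \<open>\<sigma>\<^sub>1\<^sub>,\<^sub>u\<close> is recovered from \<open>\<sigma>\<^sub>1\<^sub>,\<^sub>u(1) = 2u = -u\<close>.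
\<close>

definition Psi0 :: "('k, 'k \<times> 'v, 'c) gelt \<Rightarrow> ('k, 'v, 'c) gJelt" where
  "Psi0 = (\<lambda>(d, d', T).
     (\<lambda>v. snd (d 0 (0, v)),
      \<lambda>z. D_tri C d' z + (\<Sum>i\<in>UNIV. even_lift i (T i) z),
      tJ (- snd (d 0 (1, 0))) (TJel 1 (\<lambda>_. 0)) + (\<Sum>i\<in>UNIV. odd_lift i (T i))))"

lemma Psi0_add:
  assumes "x \<in> W" "y \<in> W"
  shows "Psi0 (x + y) = Psi0 x + Psi0 y"
proof -
  obtain d d' T where x: "x = (d, d', T)" "\<And>i. T i \<in> TT" using assms(1) by (rule W_cases) blast
  obtain e e' U where y: "y = (e, e', U)" "\<And>i. U i \<in> TT" using assms(2) by (rule W_cases) blast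
  have l: "even_lift i (T j + U j) = even_lift i (T j) + even_lift i (U j)"
    "odd_lift i (T j + U j) = odd_lift i (T j) + odd_lift i (U j)" for i j
    by (rule tensor_lift_add[OF even_lift_bilinear x(2) y(2)] tensor_lift_add[OF odd_lift_bilinear x(2) y(2)])+
  have D: "D_tri C (\<lambda>i x. d' i x + e' i x) z = D_tri C d' z + D_tri C e' z" for z
    unfolding D_tri_Phi by (rule Phi_linear) simp_all
  have t: "tJ (- snd (d 0 (1, 0) + e 0 (1, 0))) (TJel 1 (\<lambda>_. 0)) = tJ (- snd (d 0 (1, 0))) (TJel 1 (\<lambda>_. 0)) + tJ (- snd (e 0 (1, 0))) (TJel 1 (\<lambda>_. 0))"
    by (simp add: tJ_add(1)[symmetric])
  show ?thesis
    unfolding x(1) y(1) triple_add Psi0_def prod.case l D t gJ_triple_add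
    by (simp add: fun_eq_iff sum.distrib ac_simps)
qed

lemma Psi0_scale:
  assumes "x \<in> W"
  shows "Psi0 (lscl G c x) = lscl H c (Psi0 x)"
proof -
  obtain d d' T where x: "x = (d, d', T)" "\<And>i. T i \<in> TT" using assms(1) by (rule W_cases) blast
  have l: "even_lift i (tensor_scale c (T j)) = (\<lambda>z. mat_scale C c (even_lift i (T j) z))"
    "odd_lift i (tensor_scale c (T j)) = tensor_scale c (odd_lift i (T j))" for i j
    by (rule tensor_lift_scale[OF even_lift_bilinear x(2)] tensor_lift_scale[OF odd_lift_bilinear x(2)]; simp)+
  have D: "D_tri C (\<lambda>i x. c \<odot> d' i x) z = mat_scale C c (D_tri C d' z)" for z
    unfolding D_tri_Phi by (rule Phi_linear) simp_all
  have t: "tJ (- snd (scl B c (d 0 (1, 0)))) (TJel 1 (\<lambda>_. 0)) = tensor_scale c (tJ (- snd (d 0 (1, 0))) (TJel 1 (\<lambda>_. 0)))"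
    by (simp add: scl_B tJ_scale(1)[symmetric])
  show ?thesis
    unfolding x(1) G_simps H_simps Psi0_def prod.case l D t
    by (simp add: fun_eq_iff scl_B sum_index3[of _ 0] mat_scale_add tensor_scale_linear)
qed

lemma Psi0_gA: "s \<in> sp V \<Longrightarrow> Psi0 (gA s) = hA s"
  unfolding Psi0_def gA_def hA_def D_tri_Phi
  by (simp add: ev_def tensor_lift_0[OF even_lift_bilinear] tensor_lift_0[OF odd_lift_bilinear] sp_rules tJ_0 Phi_zero fun_eq_iff)

lemma Psi0_gF: "triality d \<Longrightarrow> Psi0 (gF d a) = hF d a"
proof -
  assume d: "triality d"
  have "Phi d a z = Phi d (\<lambda>_. 0) z + (\<Sum>i\<in>UNIV. D_iota C i (a i) z)" for z
    using Phi_def[of d a] unfolding D_tri_Phi by (simp add: sum_index3[of _ 0])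
  then show ?thesis
    unfolding Psi0_def gF_def hF_def D_tri_Phi
    by (simp add: lift_tt[OF even_lift_bilinear] lift_tt[OF odd_lift_bilinear] tJ_0 fun_eq_iff)
qed

lemma Psi0_gR: "Psi0 (gR u t b) = hR u t b"
proof -
  have z: "D_iota C i 0 x = 0" for i x
    unfolding D_iota_Phi using Phi_zero by (simp add: fun_eq_iff)
  have "tJ u (TJel t b) = tJ u (TJel t (\<lambda>_. 0)) + (tJ u (TJel 0 (single 0 (b 0))) + tJ u (TJel 0 (single 1 (b 1))) + tJ u (TJel 0 (single 2 (b 2))))"
    unfolding tJ_add(2)[symmetric] single_sum by (simp add: tJ_add(2)[symmetric])
  moreover have "tJ (t \<otimes> u) (TJel 1 (\<lambda>_. 0)) = tJ u (TJel t (\<lambda>_. 0))"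
    unfolding tJ_scale(1) using tJ_scale(2)[of u t 1 "\<lambda>_. 0"] by simp
  ultimately show ?thesis
    unfolding Psi0_def gR_def hR_def D_tri_Phi
    by (simp add: lift_tt[OF even_lift_bilinear] lift_tt[OF odd_lift_bilinear] od_def z Phi_zero sum_index3[of _ 0])
qed

lemma Psi0_linear: "linear_on G H Psi0"
proof -
  have "Psi0 x \<in> lcar H" if "x \<in> lcar G" for x
    using that
  proof (induction x rule: lcar_G_induct)
    case (add x y)
    then show ?case using Psi0_add[OF lcar_G_W lcar_G_W] lcar_H_add by metis
  qed (simp_all only: Psi0_gA Psi0_gF Psi0_gR hA_lcar hF_lcar hR_lcar)
  then show ?thesis
    unfolding linear_on_def using Psi0_add Psi0_scale lcar_G_W by blast
qed

lemma Psi0_conditions: "Psi_conditions V C Psi0"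
  unfolding Psi_conditions_def
proof (intro conjI ballI allI)
  fix d
  assume "d \<in> tri_homog B 0"
  then obtain s where s: "s \<in> sp V" "d = (\<lambda>_. ev s)" unfolding tri_homog_B_even by blast
  have "(d, 0, 0) = gA s" unfolding gA_def s(2) by (simp add: fun_eq_iff)
  then show "Psi0 (d, 0, 0) = (\<lambda>v. snd (d 0 (0, v)), 0, 0)"
    using Psi0_gA[OF s(1)] unfolding hA_def s(2) by (simp add: ev_def zero_fun_def)
next
  fix d
  assume "d \<in> tri S"
  then have d: "triality d" unfolding tri_para by simp
  have "(0, d, 0) = gF d (\<lambda>_. 0)" unfolding gF_def by (simp add: fun_eq_iff)
  then show "Psi0 (0, d, 0) = (0, D_tri C d, 0)"
    using Psi0_gF[OF d, of "\<lambda>_. 0"] unfolding hF_def D_tri_Phi by (simp add: zero_fun_def)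
next
  fix i a
  show "Psi0 (g_iota i (tt (1, 0) a)) = (0, D_iota C i a, 0)"
    using Psi0_gF[OF triality_const_0, of "single i a"] unfolding hF_def D_iota_Phi g_iota_generators by (simp add: zero_fun_def)
next
  fix u
  have "gR u 1 (\<lambda>_. 0) = (\<lambda>_. sigma B (1, 0) (0, u), 0, 0)" unfolding gR_def sigma_B by (simp add: fun_eq_iff)
  then show "Psi0 (\<lambda>_. sigma B (1, 0) (0, u), 0, 0) = (0, 0, tJ u (hat_iota1 C))"
    using Psi0_gR[of u 1 "\<lambda>_. 0"] unfolding hR_def hat_iota1_TJel by (simp add: zero_fun_def)
next
  fix i u s
  show "Psi0 (g_iota i (tt (0, u) s)) = (0, 0, tJ u (hat_iota C i s))"
    using Psi0_gR[of u 0 "single i s"] unfolding hR_def hat_iota_TJel g_iota_generators by (simp add: zero_fun_def)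
qed

end

theorem theorem4p9:
  fixes C :: "('k::field, 'c::ab_group_add) superalg"
    and V :: "('k, 'v::ab_group_add) plane"
  assumes "CHAR('k) = 3"
    and "hurwitz_algebra C"
    and "symplectic_plane V"
  defines "G \<equiv> g_alg (S12 V) (para_hurwitz C)"
    and "H \<equiv> gJ_alg V C"
  shows "(\<exists>\<Psi>. linear_on G H \<Psi> \<and> Psi_conditions V C \<Psi>) \<and>
    (\<forall>\<Psi> \<Psi>'. linear_on G H \<Psi> \<and> Psi_conditions V C \<Psi> \<and>
        linear_on G H \<Psi>' \<and> Psi_conditions V C \<Psi>' \<longrightarrow> (\<forall>x\<in>lcar G. \<Psi> x = \<Psi>' x)) \<and>
    (\<forall>\<Psi>. linear_on G H \<Psi> \<and> Psi_conditions V C \<Psi> \<longrightarrow> lie_superalg_iso G H \<Psi>)"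
proof -
  interpret hurwitz_plane C V
    using assms(1-3) by unfold_locales
  show ?thesis
    unfolding G_def H_def using Psi0_linear Psi0_conditions Psi_unique Psi_iso by blast
qed

end
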